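(* Let $\vec u^*=u^*_\varphi\vec e_\varphi+u^*_\theta\vec e_\theta+u^*_\rho\vec e_\rho$ and $p^*$ be the limit velocity and limit pressure of the Stokes problems described in the context. Then, in $\Omega$, $$u^*_\varphi=\frac{h^2}{2\mu R}\frac{\partial p^*}{\partial\xi_1}\,\xi_3(\xi_3-1),$$ $$u^*_\theta=\frac{h^2}{2\mu R\sin\xi_1}\frac{\partial p^*}{\partial\xi_2}\,\xi_3(\xi_3-1)+R\omega\sin\xi_1\,(1-\xi_3),$$ $$u^*_\rho=0.$$
   Context: Geometry. Fix $R>0$, $\mu>0$, $\omega\in\mathbb R$, $0<\varphi_0<\varphi_1<\pi$; $D=(\varphi_0,\varphi_1)\times(0,2\pi)$; $\Omega=D\times(0,1)$ with variables $\vec\xi=(\xi_1,\xi_2,\xi_3)$, where $\xi_1=\varphi$ and $\xi_2=\theta$. Let $h$ be a smooth function on $\overline D$, $2\pi$-periodic in $\theta$, with $0<h_0\le h\le h_1$. Let $\vec e_\varphi=(\cos\xi_1\cos\xi_2,\cos\xi_1\sin\xi_2,-\sin\xi_1)$, $\vec e_\theta=(-\sin\xi_2,\cos\xi_2,0)$, $\vec e_\rho=(\sin\xi_1\cos\xi_2,\sin\xi_1\sin\xi_2,\cos\xi_1)$. For a small parameter $\varepsilon\in(0,1]$ let $\Phi^\varepsilon(\vec\xi)=(R+\varepsilon\xi_3h(\xi_1,\xi_2))\,\vec e_\rho(\xi_1,\xi_2)$ and $\Omega^\varepsilon=\Phi^\varepsilon(\Omega)\subset\mathbb R^3$, a spherical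 shell region closed in the $\theta$-direction: the faces $\theta=0$ and $\theta=2\pi$ are identified, all functions are $2\pi$-periodic in $\xi_2$, and $\partial\Omega^\varepsilon$ consists of the images of $\xi_3=0$, $\xi_3=1$, $\xi_1=\varphi_0$, $\xi_1=\varphi_1$. Functions on $\Omega^\varepsilon$ are identified with functions on $\Omega$ through $\Phi^\varepsilon$. Boundary data. $\vec g^\varepsilon$ on $\partial\Omega^\varepsilon$ is given, in the variables $\vec\xi$, by: $\vec g^\varepsilon=R\omega\sin\xi_1\,\vec e_\theta$ on $\xi_3=0$; $\vec g^\varepsilon=\vec0$ on $\xi_3=1$; $\vec g^\varepsilon=k_i^\varepsilon(\xi_2,\xi_3)\vec e_\varphi+R\omega\sin\varphi_i\,g_i(\xi_3)\vec e_\theta$ on $\xi_1=\varphi_i$ ($i=0,1$). Here $g_0,g_1$ are smooth with $g_i(0)=1$, $g_i(1)=0$; $k_0^\varepsilon,k_1^\varepsilon$ are smooth functions of $(\xi_2,\xi_3)$, $2\pi$-periodic in $\xi_2$, with $k_i^\varepsilon(\xi_2,0)=k_i^\varepsilon(\xi_2,1)=0$ and $|k_i^\varepsilon|_{L^\infty}\le C$ with $C$ independent of $\varepsilon$; and the compatibility condition $\int_{\varphi=\varphi_1}k_1^\varepsilon\,dA-\int_{\varphi=\varphi_0}k_0^\varepsilon\,dA=0$ holds (integrals over the corresponding lateral faces of $\Omega^\varepsilon$), which is equivalent to $\int_{\partial\Omega^\varepsilon}\vec g^\varepsilon\cdot\vec n^\varepsilon\,dA=0$. Stokes problem. $(\vec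 u^\varepsilon,p^\varepsilon)\in(H^1(\Omega^\varepsilon))^3\times L^2_0(\Omega^\varepsilon)$, where $L^2_0$ denotes the $L^2$ functions of zero integral, is the unique solution of $-\mu\Delta\vec u^\varepsilon+\nabla p^\varepsilon=\vec0$, $\operatorname{div}\vec u^\varepsilon=0$ in $\Omega^\varepsilon$, $\vec u^\varepsilon=\vec g^\varepsilon$ on $\partial\Omega^\varepsilon$. Limits. $\vec u^*$ and $p^*$ are limits along a common subsequence $\varepsilon\to0$ in the following sense: $\vec u^*,\partial\vec u^*/\partial\xi_3\in(L^2(\Omega))^3$; $\vec u^\varepsilon\rightharpoonup\vec u^*$, $\partial\vec u^\varepsilon/\partial\xi_3\rightharpoonup\partial\vec u^*/\partial\xi_3$ and $\varepsilon\,\partial\vec u^\varepsilon/\partial\xi_i\rightharpoonup\vec0$ ($i=1,2$) weakly in $(L^2(\Omega))^3$; $\vec u^*=R\omega\sin\xi_1\vec e_\theta$ on $\xi_3=0$ and $\vec u^*=\vec0$ on $\xi_3=1$; $p^*\in L^2(\Omega)$; $\varepsilon^2p^\varepsilon\rightharpoonup p^*$ weakly in $L^2(\Omega)$; $\varepsilon^2\partial p^\varepsilon/\partial\xi_i\rightharpoonup\partial p^*/\partial\xi_i$ ($i=1,2$) and $\varepsilon^2\partial p^\varepsilon/\partial\xi_3\rightharpoonup0$ weakly in $H^{-1}(\Omega)$ (so $p^*$ is independent of $\xi_3$). Derivatives of $p^*$ are distributional. *)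

theory Defs
  imports "HOL-Analysis.Analysis"
begin

section \<open>Smooth functions\<close>

definition dir_deriv ::
  "'a::euclidean_space \<Rightarrow> ('a \<Rightarrow> 'b::real_normed_vector) \<Rightarrow> 'a \<Rightarrow> 'b" where
  "dir_deriv b f x = vector_derivative (\<lambda>t::real. f (x + t *\<^sub>R b)) (at 0)"

abbreviation pderiv3 :: "3 \<Rightarrow> (real^3 \<Rightarrow> 'b::real_normed_vector) \<Rightarrow> real^3 \<Rightarrow> 'b" where
  "pderiv3 i \<equiv> dir_deriv (axis i 1)"

text \<open>For an open set \<open>S\<close>: \<open>f\<close> is of class \<open>C\<^sup>k\<close> on \<open>S\<close>.\<close>

fun Ck_on :: "nat \<Rightarrow> 'a::euclidean_space set \<Rightarrow> ('a \<Rightarrow> 'b::real_normed_vector) \<Rightarrow> bool" where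
  "Ck_on 0 S f = continuous_on S f"
| "Ck_on (Suc k) S f \<longleftrightarrow>
     (\<forall>x\<in>S. f differentiable (at x)) \<and> (\<forall>b\<in>Basis. Ck_on k S (dir_deriv b f))"

definition smooth_on :: "'a::euclidean_space set \<Rightarrow> ('a \<Rightarrow> 'b::real_normed_vector) \<Rightarrow> bool" where
  "smooth_on S f \<longleftrightarrow> (\<forall>k. Ck_on k S f)"

text \<open>Smoothness on a closed set, i.e. up to the boundary: \<open>f\<close> agrees on \<open>S\<close> with a function
  that is smooth on a neighbourhood of \<open>S\<close>. Values of \<open>f\<close> outside \<open>S\<close> do not matter.\<close>

definition smooth_up_to :: "'a::euclidean_space set \<Rightarrow> ('a \<Rightarrow> 'b::real_normed_vector) \<Rightarrow> bool" where
  "smooth_up_to S f \<longleftrightarrow>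
     (\<exists>U g. open U \<and> S \<subseteq> U \<and> smooth_on U g \<and> (\<forall>x\<in>S. g x = f x))"


section \<open>The space \<open>L\<^sup>2\<close>\<close>

definition L2 :: "'a::euclidean_space set \<Rightarrow> ('a \<Rightarrow> 'b::euclidean_space) \<Rightarrow> bool" where
  "L2 S f \<longleftrightarrow> f \<in> borel_measurable (lebesgue_on S) \<and>
     integrable (lebesgue_on S) (\<lambda>x. (norm (f x))\<^sup>2)"

definition L2_conv ::
  "'a::euclidean_space set \<Rightarrow> (nat \<Rightarrow> 'a \<Rightarrow> 'b::euclidean_space) \<Rightarrow> ('a \<Rightarrow> 'b) \<Rightarrow> bool" where
  "L2_conv S f l \<longleftrightarrow> (\<forall>n. L2 S (f n)) \<and> L2 S l \<and>
     (\<lambda>n. LINT x|lebesgue_on S. (norm (f n x - l x))\<^sup>2) \<longlonglongrightarrow> 0"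

definition L2_weak_conv ::
  "'a::euclidean_space set \<Rightarrow> (nat \<Rightarrow> 'a \<Rightarrow> 'b::euclidean_space) \<Rightarrow> ('a \<Rightarrow> 'b) \<Rightarrow> bool" where
  "L2_weak_conv S f l \<longleftrightarrow> (\<forall>n. L2 S (f n)) \<and> L2 S l \<and>
     (\<forall>w. L2 S w \<longrightarrow>
       (\<lambda>n. LINT x|lebesgue_on S. f n x \<bullet> w x) \<longlonglongrightarrow> (LINT x|lebesgue_on S. l x \<bullet> w x))"


section \<open>Distributions and weak derivatives\<close>

text \<open>A (possibly vector-valued) distribution is represented by its action on real test functions.
  Two test function spaces are used: compactly supported functions on an open set of physical
  space, and, on the reference domain, functions that are periodic in the second variable.\<close>

definition dist_fun ::
  "(real^3) set \<Rightarrow> (real^3 \<Rightarrow> 'b::euclidean_space) \<Rightarrow> (real^3 \<Rightarrow> real) \<Rightarrow> 'b" where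
  "dist_fun S f \<psi> = (LINT x|lebesgue_on S. \<psi> x *\<^sub>R f x)"

definition dist_deriv ::
  "3 \<Rightarrow> ((real^3 \<Rightarrow> real) \<Rightarrow> 'b::euclidean_space) \<Rightarrow> (real^3 \<Rightarrow> real) \<Rightarrow> 'b" where
  "dist_deriv i T \<psi> = - T (pderiv3 i \<psi>)"

definition dist_mult ::
  "(real^3 \<Rightarrow> real) \<Rightarrow> ((real^3 \<Rightarrow> real) \<Rightarrow> 'b::euclidean_space) \<Rightarrow> (real^3 \<Rightarrow> real) \<Rightarrow> 'b" where
  "dist_mult a T \<psi> = T (\<lambda>x. a x * \<psi> x)"

definition test_functions :: "(real^3) set \<Rightarrow> (real^3 \<Rightarrow> real) set" where
  "test_functions S =
     {\<psi>. smooth_on UNIV \<psi> \<and> compact (closure {x. \<psi> x \<noteq> 0}) \<and> closure {x. \<psi> x \<noteq> 0} \<subseteq> S}"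

text \<open>The parameter \<open>\<T>\<close> is the space of test functions.\<close>

definition weak_deriv ::
  "(real^3 \<Rightarrow> real) set \<Rightarrow> (real^3) set \<Rightarrow> 3 \<Rightarrow> (real^3 \<Rightarrow> 'b::euclidean_space) \<Rightarrow> (real^3 \<Rightarrow> 'b) \<Rightarrow> bool"
  where
  "weak_deriv \<T> S i f d \<longleftrightarrow> (\<forall>\<psi>\<in>\<T>. dist_fun S d \<psi> = dist_deriv i (dist_fun S f) \<psi>)"

definition H1 :: "(real^3) set \<Rightarrow> (real^3 \<Rightarrow> 'b::euclidean_space) \<Rightarrow> bool" where
  "H1 S f \<longleftrightarrow> L2 S f \<and> (\<forall>i. \<exists>d. L2 S d \<and> weak_deriv (test_functions S) S i f d)"

text \<open>Traces as continuous extension of the restriction of smooth functions. \<open>\<A>\<close> is the class of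
  approximating smooth functions, \<open>I\<close> the set of directions in which \<open>f\<close> has square integrable
  derivatives (all of them for \<open>H\<^sup>1\<close>), and \<open>X\<close> parametrizes over \<open>Q\<close> the part of the
  boundary considered; \<open>g\<close> is the boundary value in terms of the parameters. The limit \<open>d\<close>
  below is necessarily the weak derivative of \<open>f\<close>.\<close>

definition has_trace ::
  "(real^3 \<Rightarrow> 'b::euclidean_space) set \<Rightarrow> (real^3) set \<Rightarrow> 3 set \<Rightarrow> (real \<times> real) set \<Rightarrow>
   (real \<times> real \<Rightarrow> real^3) \<Rightarrow> (real^3 \<Rightarrow> 'b) \<Rightarrow> (real \<times> real \<Rightarrow> 'b) \<Rightarrow> bool" where
  "has_trace \<A> S I Q X f g \<longleftrightarrow>
     (\<exists>\<psi>. (\<forall>n. \<psi> n \<in> \<A>) \<and> L2_conv S \<psi> f \<and>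
        (\<forall>i\<in>I. \<exists>d. L2_conv S (\<lambda>n. pderiv3 i (\<psi> n)) d) \<and>
        L2_conv Q (\<lambda>n y. \<psi> n (X y)) g)"

definition surface_integral ::
  "(real \<times> real) set \<Rightarrow> (real \<times> real \<Rightarrow> real^3) \<Rightarrow> (real \<times> real \<Rightarrow> real) \<Rightarrow> real" where
  "surface_integral Q X f =
     (LINT y|lebesgue_on Q. f y * norm (cross3 (dir_deriv (1, 0) X y) (dir_deriv (0, 1) X y)))"


section \<open>Geometry of the shell\<close>

definition e_phi :: "real^3 \<Rightarrow> real^3" where
  "e_phi \<xi> = vector [cos (\<xi>$1) * cos (\<xi>$2), cos (\<xi>$1) * sin (\<xi>$2), - sin (\<xi>$1)]"

definition e_theta :: "real^3 \<Rightarrow> real^3" where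
  "e_theta \<xi> = vector [- sin (\<xi>$2), cos (\<xi>$2), 0]"

definition e_rho :: "real^3 \<Rightarrow> real^3" where
  "e_rho \<xi> = vector [sin (\<xi>$1) * cos (\<xi>$2), sin (\<xi>$1) * sin (\<xi>$2), cos (\<xi>$1)]"

definition Ref_dom :: "real \<Rightarrow> real \<Rightarrow> (real^3) set" where
  "Ref_dom \<phi>0 \<phi>1 =
     {\<xi>. \<phi>0 < \<xi>$1 \<and> \<xi>$1 < \<phi>1 \<and> 0 < \<xi>$2 \<and> \<xi>$2 < 2 * pi \<and> 0 < \<xi>$3 \<and> \<xi>$3 < 1}"

definition Shell_map :: "real \<Rightarrow> (real \<times> real \<Rightarrow> real) \<Rightarrow> real \<Rightarrow> real^3 \<Rightarrow> real^3" where
  "Shell_map R h \<epsilon> \<xi> = (R + \<epsilon> * \<xi>$3 * h (\<xi>$1, \<xi>$2)) *\<^sub>R e_rho \<xi>"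

text \<open>The shell is closed in the second direction: \<open>\<xi>\<^sub>2\<close> ranges over all reals, so that
  the image of \<open>\<xi>\<^sub>2 = 0\<close>, which is that of \<open>\<xi>\<^sub>2 = 2\<pi>\<close>, belongs to the (open) domain.\<close>

definition Shell_dom :: "real \<Rightarrow> (real \<times> real \<Rightarrow> real) \<Rightarrow> real \<Rightarrow> real \<Rightarrow> real \<Rightarrow> (real^3) set" where
  "Shell_dom R h \<phi>0 \<phi>1 \<epsilon> =
     Shell_map R h \<epsilon> ` {\<xi>. \<phi>0 < \<xi>$1 \<and> \<xi>$1 < \<phi>1 \<and> 0 < \<xi>$3 \<and> \<xi>$3 < 1}"

text \<open>The faces \<open>\<xi>\<^sub>3 = c\<close> and \<open>\<xi>\<^sub>1 = c\<close> of the reference domain.\<close>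

definition face3 :: "real \<Rightarrow> real \<times> real \<Rightarrow> real^3" where
  "face3 c y = vector [fst y, snd y, c]"

definition face1 :: "real \<Rightarrow> real \<times> real \<Rightarrow> real^3" where
  "face1 c y = vector [c, fst y, snd y]"

abbreviation face3_params :: "real \<Rightarrow> real \<Rightarrow> (real \<times> real) set" where
  "face3_params \<phi>0 \<phi>1 \<equiv> {\<phi>0<..<\<phi>1} \<times> {0<..<2 * pi}"

abbreviation face1_params :: "(real \<times> real) set" where
  "face1_params \<equiv> {0<..<2 * pi} \<times> {0<..<1}"


section \<open>Function spaces on the reference domain with identified faces\<close>

text \<open>Square integrable functions on the reference domain need no periodicity condition. The
  identification of the faces \<open>\<xi>\<^sub>2 = 0\<close> and \<open>\<xi>\<^sub>2 = 2\<pi>\<close> enters through the test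
  functions, which are periodic in \<open>\<xi>\<^sub>2\<close> and vanish near the other faces only.\<close>

definition periodic2 :: "(real^3 \<Rightarrow> 'b) \<Rightarrow> bool" where
  "periodic2 f \<longleftrightarrow> (\<forall>\<xi>. f (\<xi> + axis 2 (2 * pi)) = f \<xi>)"

definition per_smooth :: "(real^3 \<Rightarrow> 'b::real_normed_vector) set" where
  "per_smooth = {\<psi>. smooth_on UNIV \<psi> \<and> periodic2 \<psi>}"

definition per_test :: "real \<Rightarrow> real \<Rightarrow> (real^3 \<Rightarrow> real) set" where
  "per_test \<phi>0 \<phi>1 = {\<psi> \<in> per_smooth. \<exists>\<delta>>0. \<forall>\<xi>. \<psi> \<xi> \<noteq> 0 \<longrightarrow>
     \<phi>0 + \<delta> \<le> \<xi>$1 \<and> \<xi>$1 \<le> \<phi>1 - \<delta> \<and> \<delta> \<le> \<xi>$3 \<and> \<xi>$3 \<le> 1 - \<delta>}"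

text \<open>\<open>H\<^sub>0\<^sup>1\<close> as the closure of the test functions; its elements are recorded together with
  their weak gradient.\<close>

definition H10 :: "real \<Rightarrow> real \<Rightarrow> ((real^3 \<Rightarrow> real) \<times> (real^3 \<Rightarrow> real^3)) set" where
  "H10 \<phi>0 \<phi>1 = {(v, G). \<exists>\<psi>. (\<forall>n. \<psi> n \<in> per_test \<phi>0 \<phi>1) \<and> L2_conv (Ref_dom \<phi>0 \<phi>1) \<psi> v \<and>
     L2_conv (Ref_dom \<phi>0 \<phi>1) (\<lambda>n \<xi>. \<chi> i. pderiv3 i (\<psi> n) \<xi>) G}"

text \<open>For a square integrable \<open>f\<close>, the element \<open>\<partial>f/\<partial>\<xi>\<^sub>i\<close> of the dual \<open>H\<^sup>-\<^sup>1\<close> of \<open>H\<^sub>0\<^sup>1\<close>;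
  weak convergence in \<open>H\<^sup>-\<^sup>1\<close> is convergence on each element of \<open>H\<^sub>0\<^sup>1\<close>, which is reflexive.\<close>

definition Hm1_deriv ::
  "real \<Rightarrow> real \<Rightarrow> 3 \<Rightarrow> (real^3 \<Rightarrow> real) \<Rightarrow> (real^3 \<Rightarrow> real) \<times> (real^3 \<Rightarrow> real^3) \<Rightarrow> real" where
  "Hm1_deriv \<phi>0 \<phi>1 i f w = - (LINT \<xi>|lebesgue_on (Ref_dom \<phi>0 \<phi>1). f \<xi> * snd w \<xi> $ i)"

definition Hm1_weak_conv ::
  "real \<Rightarrow> real \<Rightarrow> (nat \<Rightarrow> (real^3 \<Rightarrow> real) \<times> (real^3 \<Rightarrow> real^3) \<Rightarrow> real) \<Rightarrow>
   ((real^3 \<Rightarrow> real) \<times> (real^3 \<Rightarrow> real^3) \<Rightarrow> real) \<Rightarrow> bool" where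
  "Hm1_weak_conv \<phi>0 \<phi>1 T L \<longleftrightarrow> (\<forall>w\<in>H10 \<phi>0 \<phi>1. (\<lambda>n. T n w) \<longlonglongrightarrow> L w)"


section \<open>The Stokes problem\<close>

text \<open>The equations hold in the sense of distributions; pressures have zero integral.\<close>

definition stokes_equations ::
  "real \<Rightarrow> (real^3) set \<Rightarrow> (real^3 \<Rightarrow> real^3) \<Rightarrow> (real^3 \<Rightarrow> real) \<Rightarrow> bool" where
  "stokes_equations \<mu> S u p \<longleftrightarrow>
     H1 S u \<and> L2 S p \<and> (LINT x|lebesgue_on S. p x) = 0 \<and>
     (\<forall>\<psi>\<in>test_functions S.
        - \<mu> *\<^sub>R (\<Sum>j\<in>UNIV. dist_deriv j (dist_deriv j (dist_fun S u)) \<psi>)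
          + (\<chi> i. dist_deriv i (dist_fun S p) \<psi>) = 0 \<and>
        (\<Sum>i\<in>UNIV. dist_deriv i (dist_fun S (\<lambda>x. u x $ i)) \<psi>) = 0)"

text \<open>Boundary data are functions of the two free variables on each face. For fixed \<open>\<epsilon>\<close> the surface
  density of each face is bounded above and away from zero, so convergence in \<open>L\<^sup>2\<close> of the
  parameters, as used in the traces, is convergence in \<open>L\<^sup>2\<close> of the face. The arguments
  \<open>k0 k1\<close> below are the lateral data for the given \<open>\<epsilon>\<close>.\<close>

definition lateral_data ::
  "real \<Rightarrow> real \<Rightarrow> real \<Rightarrow> (real \<times> real \<Rightarrow> real) \<Rightarrow> (real \<Rightarrow> real) \<Rightarrow> real \<times> real \<Rightarrow> real^3" where
  "lateral_data R \<omega> c k g y =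
     k y *\<^sub>R e_phi (face1 c y) + (R * \<omega> * sin c * g (snd y)) *\<^sub>R e_theta (face1 c y)"

definition bottom_data :: "real \<Rightarrow> real \<Rightarrow> real \<times> real \<Rightarrow> real^3" where
  "bottom_data R \<omega> y = (R * \<omega> * sin (fst y)) *\<^sub>R e_theta (face3 0 y)"

definition shell_boundary_values ::
  "real \<Rightarrow> real \<Rightarrow> real \<Rightarrow> real \<Rightarrow> (real \<times> real \<Rightarrow> real) \<Rightarrow> (real \<Rightarrow> real) \<Rightarrow> (real \<Rightarrow> real) \<Rightarrow>
   (real \<times> real \<Rightarrow> real) \<Rightarrow> (real \<times> real \<Rightarrow> real) \<Rightarrow> real \<Rightarrow> (real^3 \<Rightarrow> real^3) \<Rightarrow> bool" where
  "shell_boundary_values R \<omega> \<phi>0 \<phi>1 h g0 g1 k0 k1 \<epsilon> u \<longleftrightarrow>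
     (let tr = has_trace {\<psi>. smooth_on UNIV \<psi>} (Shell_dom R h \<phi>0 \<phi>1 \<epsilon>) UNIV;
          \<Phi> = Shell_map R h \<epsilon>
      in tr (face3_params \<phi>0 \<phi>1) (\<Phi> \<circ> face3 0) u (bottom_data R \<omega>) \<and>
         tr (face3_params \<phi>0 \<phi>1) (\<Phi> \<circ> face3 1) u (\<lambda>y. 0) \<and>
         tr face1_params (\<Phi> \<circ> face1 \<phi>0) u (lateral_data R \<omega> \<phi>0 k0 g0) \<and>
         tr face1_params (\<Phi> \<circ> face1 \<phi>1) u (lateral_data R \<omega> \<phi>1 k1 g1))"

definition lateral_profile :: "(real \<times> real \<Rightarrow> real) \<Rightarrow> real \<Rightarrow> bool" where
  "lateral_profile k C \<longleftrightarrow> smooth_up_to (UNIV \<times> {0..1}) k \<and>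
     (\<forall>s. \<forall>t\<in>{0..1}. k (s + 2 * pi, t) = k (s, t) \<and> \<bar>k (s, t)\<bar> \<le> C) \<and>
     (\<forall>s. k (s, 0) = 0 \<and> k (s, 1) = 0)"

end

theory Submission
  imports Defs
begin

text \<open>In the variables \<open>\<xi>\<close> the Cartesian derivatives on the shell are \<open>\<partial>/\<partial>x\<^sub>i = A\<^sub>i / \<epsilon> + B\<^sub>i / r\<close>, where
  \<open>A\<^sub>i\<close> is \<open>\<partial>/\<partial>\<xi>\<^sub>3\<close> up to a factor and \<open>A\<^sub>i\<close>, \<open>B\<^sub>i\<close> do not depend on \<open>\<epsilon>\<close>. Hence the Stokes equations,
  tested with the push-forward of a fixed periodic function, multiplied by \<open>\<epsilon>\<close> and pulled back to
  \<open>\<Omega>\<close>, are polynomials in \<open>\<epsilon>\<close> whose coefficients are fixed test functions, and weak convergence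
  alone gives the limit: \<open>\<mu> R \<partial>\<^sub>3\<^sup>2 u\<^sub>\<phi> = h\<^sup>2 \<partial>\<^sub>1 p\<close>, \<open>\<mu> R \<partial>\<^sub>3\<^sup>2 u\<^sub>\<theta> = h\<^sup>2 \<partial>\<^sub>2 p / sin \<xi>\<^sub>1\<close> (the field test
  functions being orthogonal to \<open>e\<^sub>\<rho>\<close>, the singular pressure term vanishes) and, from
  incompressibility, \<open>\<partial>\<^sub>3 u\<^sub>\<rho> = 0\<close>. Together with the traces at \<open>\<xi>\<^sub>3 = 0, 1\<close> these are boundary value
  problems in \<open>\<xi>\<^sub>3\<close>. Since the derivatives of \<open>p\<close> are only distributions, they are
  solved by duality: one tests with the solution \<open>\<eta>\<close> of \<open>\<partial>\<^sub>3\<^sup>2 \<eta> = \<zeta>\<close> that vanishes on both faces.\<close>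


section \<open>Calculus of smooth functions\<close>

text \<open>The orders of magnitude dictate the scaling. The Jacobian carries one factor \<epsilon>
  and two factors of the radius r, the Laplacian two factors 1/\<epsilon> or 1/r, so \<epsilon>
  times the Jacobian clears all denominators. The pressure is of order 1/\<epsilon>^2, and after
  this scaling its pairing with the \<open>A\<close> part of a divergence is still of order
  1/\<epsilon>, while the pairing with the \<open>B\<close> part converges; hence the need for
  tangential test fields. The obstacle in the duality argument is that the equations admit only test
  functions vanishing near the faces, whereas \<eta> merely vanishes on them. A cutoff has
  \<xi>_3-derivatives of size n in a layer of thickness about 1/n. One of them is harmless next to a
  factor that vanishes on the faces, two are not. Therefore one derivative is moved onto the
  velocity, whose \<xi>_3-derivative is square integrable, and only one falls on the cut-off
  function. The slope of h contributes a remainder to the pressure term, but in the form of a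
  \<xi>_3-derivative, which a pressure independent of \<xi>_3 annihilates; what is left has h^2
  inside the derivative.\<close>

lemma has_derivative_dir_deriv:
  assumes "(f has_derivative f') (at x)"
  shows "dir_deriv b f x = f' b"
proof -
  have "((\<lambda>t::real. x + t *\<^sub>R b) has_derivative (\<lambda>t. t *\<^sub>R b)) (at 0)"
    by (auto intro!: derivative_eq_intros)
  moreover have "(f has_derivative f') (at (x + 0 *\<^sub>R b))" using assms by simp
  ultimately have "(f \<circ> (\<lambda>t::real. x + t *\<^sub>R b) has_derivative f' \<circ> (\<lambda>t. t *\<^sub>R b)) (at 0)"
    by (rule diff_chain_at)
  moreover have "f' \<circ> (\<lambda>t. t *\<^sub>R b) = (\<lambda>t. t *\<^sub>R f' b)"
    using has_derivative_linear[OF assms] by (auto simp: linear_scale)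
  ultimately have "((\<lambda>t. f (x + t *\<^sub>R b)) has_vector_derivative f' b) (at 0)"
    by (simp add: has_vector_derivative_def o_def)
  then show ?thesis unfolding dir_deriv_def by (rule vector_derivative_at)
qed

lemma dir_deriv_cong_open:
  assumes "open S" "x \<in> S" "\<And>y. y \<in> S \<Longrightarrow> f y = g y"
  shows "dir_deriv b f x = dir_deriv b g x"
proof -
  have "((\<lambda>t::real. x + t *\<^sub>R b) \<longlongrightarrow> x + 0 *\<^sub>R b) (nhds 0)"
    by (intro tendsto_intros filterlim_ident)
  then have "\<forall>\<^sub>F t in nhds (0::real). x + t *\<^sub>R b \<in> S"
    using assms by (auto simp: tendsto_def)
  then have "\<forall>\<^sub>F t in nhds 0. f (x + t *\<^sub>R b) = g (x + t *\<^sub>R b)"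
    by (rule eventually_mono) (use assms in auto)
  then show ?thesis unfolding dir_deriv_def
    by (intro vector_derivative_cong_eq) (auto simp: eventually_at_filter elim: eventually_mono)
qed

lemma differentiable_cong_open:
  assumes "open S" "x \<in> S" "\<And>y. y \<in> S \<Longrightarrow> f y = g y" "f differentiable (at x)"
  shows "g differentiable (at x)"
  using assms has_derivative_transform_within_open[of f _ x UNIV S g]
  by (auto simp: differentiable_def)

lemma differentiable_frechet_derivative:
  "f differentiable (at x) \<Longrightarrow> (f has_derivative frechet_derivative f (at x)) (at x)"
  by (simp add: frechet_derivative_works)

lemma differentiable_dir_deriv:
  assumes "f differentiable (at x)"
  shows "(f has_derivative (\<lambda>y. \<Sum>b\<in>Basis. (y \<bullet> b) *\<^sub>R dir_deriv b f x)) (at x)"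
proof -
  obtain f' where f': "(f has_derivative f') (at x)" using assms by (auto simp: differentiable_def)
  have "f' y = (\<Sum>b\<in>Basis. (y \<bullet> b) *\<^sub>R f' b)" for y
  proof -
    have "f' y = f' (\<Sum>b\<in>Basis. (y \<bullet> b) *\<^sub>R b)" by (simp add: euclidean_representation)
    also have "\<dots> = (\<Sum>b\<in>Basis. (y \<bullet> b) *\<^sub>R f' b)"
      using has_derivative_linear[OF f'] by (simp add: linear_sum linear_scale)
    finally show ?thesis .
  qed
  then have "f' = (\<lambda>y. \<Sum>b\<in>Basis. (y \<bullet> b) *\<^sub>R dir_deriv b f x)"
    unfolding has_derivative_dir_deriv[OF f'] by (rule ext)
  then show ?thesis using f' by simp
qed

text \<open>Openness makes directional derivatives local, so equality on \<open>S\<close> passes to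
  all derivatives. Below, this replaces a derivative by the formula of a differentiation rule that
  is known only on \<open>S\<close>.\<close>

lemma Ck_on_cong:
  assumes "open S" "\<And>x. x \<in> S \<Longrightarrow> f x = g x" "Ck_on k S f"
  shows "Ck_on k S g"
  using assms(2,3)
proof (induction k arbitrary: f g)
  case 0
  then show ?case by (metis Ck_on.simps(1) continuous_on_cong)
next
  case (Suc k)
  have *: "dir_deriv b f x = dir_deriv b g x" if "x \<in> S" for b x
    using dir_deriv_cong_open[OF assms(1) that] Suc.prems by blast
  have "Ck_on k S (dir_deriv b g)" if "b \<in> Basis" for b
    by (rule Suc.IH[of "dir_deriv b f"]) (use Suc.prems that * in auto)
  moreover have "g differentiable (at x)" if "x \<in> S" for x
    using differentiable_cong_open[OF assms(1) that Suc.prems(1)] Suc.prems(2) that by auto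
  ultimately show ?case by simp
qed

lemma Ck_on_SucD: "Ck_on (Suc k) S f \<Longrightarrow> Ck_on k S f"
proof (induction k arbitrary: f)
  case 0
  then show ?case
    by (auto intro!: continuous_at_imp_continuous_on differentiable_imp_continuous_within)
next
  case (Suc k)
  have "Ck_on k S (dir_deriv b f)" if "b \<in> Basis" for b
    by (rule Suc.IH) (use Suc.prems that in simp)
  then show ?case using Suc.prems by simp
qed

lemma Ck_on_subset: "Ck_on k S f \<Longrightarrow> T \<subseteq> S \<Longrightarrow> Ck_on k T f"
  by (induction k arbitrary: f) (auto intro: continuous_on_subset)

lemma Ck_on_Un:
  assumes "open S" "open T"
  shows "Ck_on k S f \<Longrightarrow> Ck_on k T f \<Longrightarrow> Ck_on k (S \<union> T) f"
  by (induction k arbitrary: f) (auto intro!: continuous_on_open_Un assms)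

lemma dir_deriv_const [simp]: "dir_deriv b (\<lambda>x. c) x = 0"
  by (rule has_derivative_dir_deriv) simp

lemma Ck_on_const: "Ck_on k S (\<lambda>x. c)"
proof (induction k arbitrary: c)
  case (Suc k)
  have "dir_deriv b (\<lambda>x. c) = (\<lambda>x. 0)" for b :: 'a by auto
  with Suc show ?case by simp
qed simp

lemma Ck_on_bounded_linear_comp:
  assumes L: "bounded_linear L" and "open S"
  shows "Ck_on k S f \<Longrightarrow> Ck_on k S (\<lambda>x. L (f x))"
proof (induction k arbitrary: f)
  case 0
  then show ?case using L by (auto intro: bounded_linear.continuous_on)
next
  case (Suc k)
  have df: "(f has_derivative frechet_derivative f (at x)) (at x)" if "x \<in> S" for x
    by (rule differentiable_frechet_derivative) (use Suc.prems that in auto)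
  have der: "((\<lambda>x. L (f x)) has_derivative (\<lambda>y. L (frechet_derivative f (at x) y))) (at x)" if "x \<in> S" for x
    by (rule bounded_linear.has_derivative[OF L df[OF that]])
  note fd = has_derivative_dir_deriv[OF df]
  have "Ck_on k S (dir_deriv b (\<lambda>x. L (f x)))" if "b \<in> Basis" for b
    by (rule Ck_on_cong[OF assms(2) _ Suc.IH[of "dir_deriv b f"]])
      (use Suc.prems that has_derivative_dir_deriv[OF der] fd in auto)
  then show ?case using der by (auto simp: differentiable_def)
qed

lemma Ck_on_add:
  assumes "open S"
  shows "Ck_on k S f \<Longrightarrow> Ck_on k S g \<Longrightarrow> Ck_on k S (\<lambda>x. f x + g x)"
proof (induction k arbitrary: f g)
  case 0
  then show ?case by (auto intro: continuous_intros)
next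
  case (Suc k)
  have df: "(f has_derivative frechet_derivative f (at x)) (at x)" if "x \<in> S" for x
    by (rule differentiable_frechet_derivative) (use Suc.prems that in auto)
  have dg: "(g has_derivative frechet_derivative g (at x)) (at x)" if "x \<in> S" for x
    by (rule differentiable_frechet_derivative) (use Suc.prems that in auto)
  have der: "((\<lambda>x. f x + g x) has_derivative (\<lambda>y. frechet_derivative f (at x) y + frechet_derivative g (at x) y)) (at x)"
    if "x \<in> S" for x
    by (rule has_derivative_add[OF df[OF that] dg[OF that]])
  note fd = has_derivative_dir_deriv[OF df] has_derivative_dir_deriv[OF dg]
  have "Ck_on k S (dir_deriv b (\<lambda>x. f x + g x))" if "b \<in> Basis" for b
    by (rule Ck_on_cong[OF assms _ Suc.IH[of "dir_deriv b f" "dir_deriv b g"]])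
      (use Suc.prems that has_derivative_dir_deriv[OF der] fd in auto)
  then show ?case using der by (auto simp: differentiable_def)
qed

text \<open>One induction for products, scalings and inner products: the product rule leaves two
  bilinear terms in which one factor has lost a derivative, and \<open>Ck_on_SucD\<close> lowers the
  other factor.\<close>

lemma Ck_on_bilinear:
  assumes P: "bounded_bilinear pr" and "open S"
  shows "Ck_on k S f \<Longrightarrow> Ck_on k S g \<Longrightarrow> Ck_on k S (\<lambda>x. pr (f x) (g x))"
proof (induction k arbitrary: f g)
  case 0
  then show ?case using P by (auto intro: bounded_bilinear.continuous_on)
next
  case (Suc k)
  have df: "(f has_derivative frechet_derivative f (at x)) (at x)" if "x \<in> S" for x
    by (rule differentiable_frechet_derivative) (use Suc.prems that in auto)
  have dg: "(g has_derivative frechet_derivative g (at x)) (at x)" if "x \<in> S" for x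
    by (rule differentiable_frechet_derivative) (use Suc.prems that in auto)
  have der: "((\<lambda>x. pr (f x) (g x)) has_derivative
     (\<lambda>y. pr (f x) (frechet_derivative g (at x) y) + pr (frechet_derivative f (at x) y) (g x))) (at x)"
    if "x \<in> S" for x
    by (rule bounded_bilinear.FDERIV[OF P df[OF that] dg[OF that]])
  note fd = has_derivative_dir_deriv[OF df] has_derivative_dir_deriv[OF dg]
  have "Ck_on k S (dir_deriv b (\<lambda>x. pr (f x) (g x)))" if "b \<in> Basis" for b
  proof -
    have "Ck_on k S (\<lambda>x. pr (f x) (dir_deriv b g x) + pr (dir_deriv b f x) (g x))"
      by (intro Ck_on_add assms Suc.IH Suc.prems[THEN Ck_on_SucD]) (use Suc.prems that in auto)
    then show ?thesis
      by (rule Ck_on_cong[OF assms(2), rotated]) (use has_derivative_dir_deriv[OF der] fd in auto)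
  qed
  then show ?case using der by (auto simp: differentiable_def)
qed

lemma Ck_on_sum:
  assumes "open S" "\<And>i. i \<in> I \<Longrightarrow> Ck_on k S (f i)"
  shows "Ck_on k S (\<lambda>x. \<Sum>i\<in>I. f i x)"
  using assms(2)
proof (induction I rule: infinite_finite_induct)
  case (insert i I)
  have "Ck_on k S (\<lambda>x. f i x + (\<Sum>i\<in>I. f i x))"
    by (rule Ck_on_add[OF assms(1)]) (use insert in auto)
  then show ?case using insert by simp
qed (auto simp: Ck_on_const)

lemma dir_deriv_compose:
  assumes "f differentiable (at x)" "g differentiable (at (f x))"
  shows "(\<lambda>x. g (f x)) differentiable (at x)"
    "dir_deriv b (\<lambda>x. g (f x)) x = (\<Sum>i\<in>Basis. (dir_deriv b f x \<bullet> i) *\<^sub>R dir_deriv i g (f x))"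
proof -
  have "(g \<circ> f has_derivative (\<lambda>y. \<Sum>b\<in>Basis. (y \<bullet> b) *\<^sub>R dir_deriv b g (f x)) \<circ> frechet_derivative f (at x)) (at x)"
    using assms by (intro diff_chain_at differentiable_dir_deriv differentiable_frechet_derivative) auto
  moreover have "dir_deriv b f x = frechet_derivative f (at x) b"
    by (intro has_derivative_dir_deriv differentiable_frechet_derivative assms)
  ultimately show "(\<lambda>x. g (f x)) differentiable (at x)"
    "dir_deriv b (\<lambda>x. g (f x)) x = (\<Sum>i\<in>Basis. (dir_deriv b f x \<bullet> i) *\<^sub>R dir_deriv i g (f x))"
    using has_derivative_dir_deriv[of "g \<circ> f" _ x b] by (auto simp: o_def differentiable_def)
qed

text \<open>The induction varies only \<open>g\<close>: the chain rule gives products of components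
  of derivatives of \<open>f\<close> with \<open>dir_deriv i g\<close> after \<open>f\<close>, and
  the hypothesis applies to the latter with the same \<open>f\<close>.\<close>

lemma Ck_on_compose:
  fixes f :: "'a::euclidean_space \<Rightarrow> 'b::euclidean_space" and g :: "'b \<Rightarrow> 'c::real_normed_vector"
  assumes "open S" "open T" "f ` S \<subseteq> T"
  shows "Ck_on k S f \<Longrightarrow> Ck_on k T g \<Longrightarrow> Ck_on k S (\<lambda>x. g (f x))"
proof (induction k arbitrary: g)
  case 0
  then show ?case using assms by (auto intro: continuous_on_compose2)
next
  case (Suc k)
  have d: "f differentiable (at x)" "g differentiable (at (f x))" if "x \<in> S" for x
    using Suc.prems that assms by auto
  have "Ck_on k S (dir_deriv b (\<lambda>x. g (f x)))" if "b \<in> Basis" for b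
  proof -
    have "Ck_on k S (\<lambda>x. \<Sum>i\<in>Basis. (dir_deriv b f x \<bullet> i) *\<^sub>R dir_deriv i g (f x))"
    proof (intro Ck_on_sum assms(1) Ck_on_bilinear[OF bounded_bilinear_scaleR])
      fix i :: 'b assume i: "i \<in> Basis"
      show "Ck_on k S (\<lambda>x. dir_deriv i g (f x))"
        by (intro Suc.IH Ck_on_SucD[OF Suc.prems(1)]) (use Suc.prems i in auto)
      show "Ck_on k S (\<lambda>x. dir_deriv b f x \<bullet> i)"
        using Suc.prems that by (intro Ck_on_bounded_linear_comp[OF bounded_linear_inner_left] assms) auto
    qed
    then show ?thesis
      by (rule Ck_on_cong[OF assms(1), rotated]) (simp add: dir_deriv_compose d)
  qed
  then show ?case using dir_deriv_compose(1)[OF d] by simp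
qed

text \<open>The derivative of 1/f is -f'/f^2, which contains 1/f again but is needed one order
  lower, so the induction closes through the product rule.\<close>

lemma Ck_on_inverse:
  fixes f :: "'a::euclidean_space \<Rightarrow> real"
  assumes "open S" "\<And>x. x \<in> S \<Longrightarrow> f x \<noteq> 0"
  shows "Ck_on k S f \<Longrightarrow> Ck_on k S (\<lambda>x. inverse (f x))"
proof (induction k)
  case 0
  then show ?case using assms by (auto intro: continuous_intros)
next
  case (Suc k)
  have df: "(f has_derivative frechet_derivative f (at x)) (at x)" if "x \<in> S" for x
    by (rule differentiable_frechet_derivative) (use Suc.prems that in auto)
  have der: "((\<lambda>x. inverse (f x)) has_derivative
     (\<lambda>y. - (inverse (f x) * frechet_derivative f (at x) y * inverse (f x)))) (at x)"
    if "x \<in> S" for x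
    by (rule Deriv.has_derivative_inverse[OF assms(2)[OF that] df[OF that]])
  note fd = has_derivative_dir_deriv[OF df]
  have "Ck_on k S (dir_deriv b (\<lambda>x. inverse (f x)))" if "b \<in> Basis" for b
  proof -
    have "Ck_on k S (\<lambda>x. inverse (f x) * (inverse (f x) * (-1 * dir_deriv b f x)))"
      using Suc.prems Suc.IH[OF Ck_on_SucD[OF Suc.prems]] that
      by (intro Ck_on_bilinear[OF bounded_bilinear_mult] assms Ck_on_const) auto
    then show ?thesis
      by (rule Ck_on_cong[OF assms(1), rotated]) (use has_derivative_dir_deriv[OF der] fd in auto)
  qed
  then show ?case using der by (auto simp: differentiable_def)
qed

text \<open>Meant for families closed under differentiation, such as sine and cosine or
  \<open>bump\<close>: an induction on the order then needs only the derivative formula.\<close>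

lemma Ck_on_real_Suc:
  fixes f :: "real \<Rightarrow> 'b::real_normed_vector"
  assumes "open S" "\<And>x. x \<in> S \<Longrightarrow> (f has_vector_derivative g x) (at x)" "Ck_on k S g"
  shows "Ck_on (Suc k) S f"
proof -
  have "dir_deriv b f x = g x" if "x \<in> S" "b \<in> Basis" for b x
    using has_derivative_dir_deriv[of f _ x b] assms(2)[OF that(1)] that(2)
    by (auto simp: has_vector_derivative_def)
  moreover have "f differentiable (at x)" if "x \<in> S" for x
    using assms(2)[OF that] by (auto simp: has_vector_derivative_def differentiable_def)
  ultimately show ?thesis using Ck_on_cong[OF assms(1) _ assms(3)] by auto
qed

lemma Ck_on_sin_cos: "Ck_on k UNIV (sin :: real \<Rightarrow> real) \<and> Ck_on k UNIV (cos :: real \<Rightarrow> real)"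
proof (induction k)
  case 0
  show ?case by (auto intro: continuous_intros)
next
  case (Suc k)
  have "Ck_on (Suc k) UNIV (sin :: real \<Rightarrow> real)"
    by (rule Ck_on_real_Suc[where g = cos]) (use Suc in \<open>auto intro!: derivative_eq_intros simp flip: has_real_derivative_iff_has_vector_derivative\<close>)
  moreover have "Ck_on (Suc k) UNIV (cos :: real \<Rightarrow> real)"
  proof (rule Ck_on_real_Suc[where g = "\<lambda>x. - sin x"])
    show "Ck_on k UNIV (\<lambda>x::real. - sin x)"
      by (rule Ck_on_bounded_linear_comp[OF bounded_linear_minus[OF bounded_linear_ident]]) (use Suc in auto)
  qed (auto intro!: derivative_eq_intros simp flip: has_real_derivative_iff_has_vector_derivative)
  ultimately show ?case by blast
qed

lemma Ck_on_ident: "Ck_on k UNIV (\<lambda>x::'a::euclidean_space. x)"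
proof (cases k)
  case (Suc l)
  have "dir_deriv b (\<lambda>x::'a. x) = (\<lambda>x. b)" for b
    using has_derivative_dir_deriv[OF has_derivative_ident] by blast
  then show ?thesis using Suc Ck_on_const by auto
qed auto

lemma smooth_on_cong:
  "open S \<Longrightarrow> (\<And>x. x \<in> S \<Longrightarrow> f x = g x) \<Longrightarrow> smooth_on S f \<Longrightarrow> smooth_on S g"
  unfolding smooth_on_def using Ck_on_cong by metis

lemma smooth_on_subset: "smooth_on S f \<Longrightarrow> T \<subseteq> S \<Longrightarrow> smooth_on T f"
  unfolding smooth_on_def using Ck_on_subset by metis

lemma smooth_on_Un: "open S \<Longrightarrow> open T \<Longrightarrow> smooth_on S f \<Longrightarrow> smooth_on T f \<Longrightarrow> smooth_on (S \<union> T) f"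
  unfolding smooth_on_def using Ck_on_Un by metis

lemma smooth_on_differentiable: "smooth_on S f \<Longrightarrow> x \<in> S \<Longrightarrow> f differentiable (at x)"
  unfolding smooth_on_def by (meson Ck_on.simps(2))

lemma smooth_on_continuous_on: "smooth_on S f \<Longrightarrow> continuous_on S f"
  unfolding smooth_on_def by (meson Ck_on.simps(1))

lemma smooth_on_dir_deriv: "smooth_on S f \<Longrightarrow> b \<in> Basis \<Longrightarrow> smooth_on S (dir_deriv b f)"
  unfolding smooth_on_def by (meson Ck_on.simps(2))

lemma smooth_on_const: "smooth_on S (\<lambda>x. c)"
  by (simp add: smooth_on_def Ck_on_const)

lemma smooth_on_bounded_linear_comp:
  "bounded_linear L \<Longrightarrow> open S \<Longrightarrow> smooth_on S f \<Longrightarrow> smooth_on S (\<lambda>x. L (f x))"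
  by (simp add: smooth_on_def Ck_on_bounded_linear_comp)

lemma smooth_on_bounded_linear:
  "bounded_linear L \<Longrightarrow> open S \<Longrightarrow> smooth_on S L"
  using smooth_on_bounded_linear_comp[of L S "\<lambda>x. x"] Ck_on_ident Ck_on_subset[of _ UNIV]
  by (auto simp: smooth_on_def)

lemma smooth_on_add: "open S \<Longrightarrow> smooth_on S f \<Longrightarrow> smooth_on S g \<Longrightarrow> smooth_on S (\<lambda>x. f x + g x)"
  by (simp add: smooth_on_def Ck_on_add)

lemma smooth_on_minus: "open S \<Longrightarrow> smooth_on S f \<Longrightarrow> smooth_on S (\<lambda>x. - f x)"
  by (rule smooth_on_bounded_linear_comp[OF bounded_linear_minus[OF bounded_linear_ident]])

lemma smooth_on_diff: "open S \<Longrightarrow> smooth_on S f \<Longrightarrow> smooth_on S g \<Longrightarrow> smooth_on S (\<lambda>x. f x - g x)"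
  using smooth_on_add[of S f "\<lambda>x. - g x"] smooth_on_minus[of S g] by simp

lemma smooth_on_mult:
  fixes f g :: "'a::euclidean_space \<Rightarrow> real"
  shows "open S \<Longrightarrow> smooth_on S f \<Longrightarrow> smooth_on S g \<Longrightarrow> smooth_on S (\<lambda>x. f x * g x)"
  by (simp add: smooth_on_def Ck_on_bilinear[OF bounded_bilinear_mult])

lemma smooth_on_scaleR:
  "open S \<Longrightarrow> smooth_on S f \<Longrightarrow> smooth_on S g \<Longrightarrow> smooth_on S (\<lambda>x. f x *\<^sub>R g x)"
  by (simp add: smooth_on_def Ck_on_bilinear[OF bounded_bilinear_scaleR])

lemma smooth_on_inner:
  "open S \<Longrightarrow> smooth_on S f \<Longrightarrow> smooth_on S g \<Longrightarrow> smooth_on S (\<lambda>x. f x \<bullet> g x)"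
  by (simp add: smooth_on_def Ck_on_bilinear[OF bounded_bilinear_inner])

lemma smooth_on_sum:
  "open S \<Longrightarrow> (\<And>i. i \<in> I \<Longrightarrow> smooth_on S (f i)) \<Longrightarrow> smooth_on S (\<lambda>x. \<Sum>i\<in>I. f i x)"
  by (simp add: smooth_on_def Ck_on_sum)

lemma smooth_on_compose:
  "open S \<Longrightarrow> open T \<Longrightarrow> (\<And>x. x \<in> S \<Longrightarrow> f x \<in> T) \<Longrightarrow> smooth_on S f \<Longrightarrow> smooth_on T g \<Longrightarrow>
    smooth_on S (\<lambda>x. g (f x))"
  by (simp add: smooth_on_def Ck_on_compose image_subset_iff)

lemma smooth_on_inverse:
  fixes f :: "'a::euclidean_space \<Rightarrow> real"
  shows "open S \<Longrightarrow> (\<And>x. x \<in> S \<Longrightarrow> f x \<noteq> 0) \<Longrightarrow> smooth_on S f \<Longrightarrow> smooth_on S (\<lambda>x. inverse (f x))"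
  by (simp add: smooth_on_def Ck_on_inverse)

lemma smooth_on_divide:
  fixes f g :: "'a::euclidean_space \<Rightarrow> real"
  shows "open S \<Longrightarrow> (\<And>x. x \<in> S \<Longrightarrow> g x \<noteq> 0) \<Longrightarrow> smooth_on S f \<Longrightarrow> smooth_on S g \<Longrightarrow>
    smooth_on S (\<lambda>x. f x / g x)"
  by (simp add: divide_inverse smooth_on_inverse smooth_on_mult)

lemma smooth_on_sin:
  fixes f :: "'a::euclidean_space \<Rightarrow> real"
  shows "open S \<Longrightarrow> smooth_on S f \<Longrightarrow> smooth_on S (\<lambda>x. sin (f x))"
  by (rule smooth_on_compose[where T = UNIV]) (auto simp: smooth_on_def Ck_on_sin_cos)

lemma smooth_on_cos:
  fixes f :: "'a::euclidean_space \<Rightarrow> real"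
  shows "open S \<Longrightarrow> smooth_on S f \<Longrightarrow> smooth_on S (\<lambda>x. cos (f x))"
  by (rule smooth_on_compose[where T = UNIV]) (auto simp: smooth_on_def Ck_on_sin_cos)

lemma smooth_on_power:
  fixes f :: "'a::euclidean_space \<Rightarrow> real"
  shows "open S \<Longrightarrow> smooth_on S f \<Longrightarrow> smooth_on S (\<lambda>x. f x ^ n)"
  by (induction n) (auto intro: smooth_on_const smooth_on_mult)

lemma smooth_on_vec_nth: "open S \<Longrightarrow> smooth_on S f \<Longrightarrow> smooth_on S (\<lambda>x. f x $ i)"
  by (rule smooth_on_bounded_linear_comp[OF bounded_linear_vec_nth])

lemma smooth_on_coord: "open S \<Longrightarrow> smooth_on S (\<lambda>x::real^'n. x $ i)"
  by (rule smooth_on_bounded_linear[OF bounded_linear_vec_nth])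

lemmas smooth_intros = smooth_on_const smooth_on_add smooth_on_minus smooth_on_diff smooth_on_mult
  smooth_on_scaleR smooth_on_inner smooth_on_sum smooth_on_sin smooth_on_cos smooth_on_power
  smooth_on_coord smooth_on_inverse smooth_on_divide

text \<open>The open sets \<open>S\<close> and \<open>- K\<close> cover the space, and the product
  is zero on the second. Thus coefficients such as 1/sin or 1/h, which may be singular elsewhere,
  can multiply test functions.\<close>

lemma smooth_on_mult_extend:
  fixes c \<psi> :: "'a::euclidean_space \<Rightarrow> real"
  assumes "open S" "closed K" "K \<subseteq> S" "smooth_on S c" "smooth_on UNIV \<psi>"
    and "\<And>x. x \<notin> K \<Longrightarrow> \<psi> x = 0"
  shows "smooth_on UNIV (\<lambda>x. c x * \<psi> x)"
proof -
  have "smooth_on S (\<lambda>x. c x * \<psi> x)"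
    using assms by (intro smooth_on_mult) (auto intro: smooth_on_subset)
  moreover have "smooth_on (- K) (\<lambda>x. c x * \<psi> x)"
    by (rule smooth_on_cong[OF _ _ smooth_on_const[of _ 0]]) (use assms in auto)
  ultimately have "smooth_on (S \<union> - K) (\<lambda>x. c x * \<psi> x)"
    using assms by (intro smooth_on_Un) auto
  moreover have "S \<union> - K = UNIV" using assms by auto
  ultimately show ?thesis by simp
qed


section \<open>A smooth step\<close>

text \<open>The classical x^(-k) exp(-1/x), extended by 0. The powers are included because the
  derivatives of \<open>bump 0\<close> are combinations of such functions.\<close>

definition bump :: "nat \<Rightarrow> real \<Rightarrow> real" where
  "bump k x = (if x > 0 then (1 / x) ^ k * exp (- (1 / x)) else 0)"

text \<open>Comparison of e^y with (1 + y/n)^n for y = 1/x and n = k + 2. The two powers beyond k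
  make the bound quadratic, so the difference quotient at 0 tends to 0.\<close>

lemma bump_bound: "\<bar>bump k x\<bar> \<le> real (k + 2) ^ (k + 2) * x\<^sup>2"
proof (cases "x > 0")
  case True
  define y where "y = 1 / x"
  have y: "y > 0" using True by (simp add: y_def)
  have "(1 + y / real (k + 2)) ^ (k + 2) \<le> exp y"
    by (rule exp_ge_one_plus_x_over_n_power_n) (use y in auto)
  moreover have "(y / real (k + 2)) ^ (k + 2) \<le> (1 + y / real (k + 2)) ^ (k + 2)"
    by (rule power_mono) (use y in auto)
  ultimately have "y ^ (k + 2) \<le> real (k + 2) ^ (k + 2) * exp y"
    by (simp add: power_divide field_simps del: of_nat_add power_Suc)
  then have "y ^ k * exp (- y) \<le> real (k + 2) ^ (k + 2) / y\<^sup>2"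
    using y by (simp add: field_simps power_add exp_minus power2_eq_square del: of_nat_add)
  moreover have "bump k x = y ^ k * exp (- y)" "y ^ k * exp (- y) \<ge> 0" "1 / y\<^sup>2 = x\<^sup>2"
    using True y by (auto simp: bump_def y_def power_divide)
  ultimately show ?thesis
    by (metis abs_of_nonneg divide_inverse mult.left_neutral)
qed (auto simp: bump_def)

lemma bump_deriv: "(bump k has_real_derivative (bump (k + 2) x - real k * bump (k + 1) x)) (at x)"
proof -
  consider "x > 0" | "x < 0" | "x = 0" by linarith
  then show ?thesis
  proof cases
    case 1
    define y where "y = 1 / x"
    have d: "((\<lambda>x. 1 / x) has_real_derivative - (y\<^sup>2)) (at x)"
      using 1 by (auto intro!: derivative_eq_intros simp: y_def power2_eq_square)
    have "real k * y ^ (k - Suc 0) * y\<^sup>2 = real k * y ^ (k + 1)"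
      by (cases k) (auto simp: power2_eq_square)
    moreover have "bump (k + 2) x = y ^ k * (exp (- y) * y\<^sup>2)" "bump (k + 1) x = y ^ (k + 1) * exp (- y)"
      using 1 by (auto simp: bump_def y_def power2_eq_square)
    ultimately have e: "(real k * y ^ (k - Suc 0) * - (y\<^sup>2)) * exp (- y) + y ^ k * (exp (- y) * y\<^sup>2)
        = bump (k + 2) x - real k * bump (k + 1) x"
      by (simp only: mult_minus_right mult_minus_left)
    have "((\<lambda>x. (1 / x) ^ k * exp (- (1 / x))) has_real_derivative
        (real k * y ^ (k - Suc 0) * - (y\<^sup>2)) * exp (- y) + y ^ k * (exp (- y) * y\<^sup>2)) (at x)"
      by (rule derivative_eq_intros d refl | simp add: y_def[symmetric])+
    then have "((\<lambda>x. (1 / x) ^ k * exp (- (1 / x))) has_real_derivative (bump (k + 2) x - real k * bump (k + 1) x)) (at x)"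
      unfolding e .
    then show ?thesis
      by (rule has_field_derivative_transform_within_open[of _ _ _ "{0<..}"]) (use 1 in \<open>auto simp: bump_def\<close>)
  next
    case 2
    have "((\<lambda>x. 0) has_real_derivative (bump (k + 2) x - real k * bump (k + 1) x)) (at x)"
      using 2 by (simp add: bump_def)
    then show ?thesis
      by (rule has_field_derivative_transform_within_open[of _ _ _ "{..<0}"]) (use 2 in \<open>auto simp: bump_def\<close>)
  next
    case 3
    define C where "C = real (k + 2) ^ (k + 2)"
    have "\<bar>bump k h / h\<bar> \<le> C * \<bar>h\<bar>" for h
      using bump_bound[of k h] unfolding C_def[symmetric]
      by (cases "h = 0") (auto simp: abs_divide divide_simps power2_eq_square simp flip: abs_mult)
    moreover have "((\<lambda>h. C * \<bar>h\<bar>) \<longlongrightarrow> 0) (at 0)"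
      by (auto intro!: tendsto_eq_intros)
    ultimately have "((\<lambda>h. bump k h / h) \<longlongrightarrow> 0) (at 0)"
      by (intro Lim_null_comparison[of "\<lambda>h. bump k h / h" "\<lambda>h. C * \<bar>h\<bar>"]) auto
    then show ?thesis using 3 by (simp add: DERIV_def bump_def)
  qed
qed

lemma Ck_on_bump: "Ck_on n UNIV (bump k)"
proof (induction n arbitrary: k)
  case 0
  show ?case using bump_deriv DERIV_isCont by (simp add: continuous_on_eq_continuous_within) blast
next
  case (Suc n)
  show ?case
  proof (rule Ck_on_real_Suc[where g = "\<lambda>x. bump (k + 2) x + (- real k) * bump (k + 1) x"])
    show "Ck_on n UNIV (\<lambda>x. bump (k + 2) x + (- real k) * bump (k + 1) x)"
      by (intro Ck_on_add Ck_on_bilinear[OF bounded_bilinear_mult] Ck_on_const Suc open_UNIV)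
  qed (use bump_deriv in \<open>auto simp flip: has_real_derivative_iff_has_vector_derivative\<close>)
qed

definition smooth_step :: "real \<Rightarrow> real" where
  "smooth_step x = bump 0 x / (bump 0 x + bump 0 (1 - x))"

lemma smooth_step_denom: "bump 0 x + bump 0 (1 - x) > 0"
  by (auto simp: bump_def add_pos_pos)

lemma smooth_on_smooth_step: "smooth_on UNIV smooth_step"
proof -
  have b: "smooth_on UNIV (bump 0)" by (simp add: smooth_on_def Ck_on_bump)
  have "smooth_on UNIV (\<lambda>x. bump 0 x / (bump 0 x + bump 0 (1 - x)))"
    using smooth_step_denom
    by (intro smooth_intros b smooth_on_compose[of UNIV UNIV "\<lambda>x. 1 - x" "bump 0"] smooth_on_bounded_linear bounded_linear_ident)
       (auto simp: less_imp_neq[symmetric])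
  then show ?thesis by (simp add: smooth_step_def[abs_def])
qed

lemma smooth_step_bounds: "0 \<le> smooth_step x" "smooth_step x \<le> 1"
  using smooth_step_denom[of x] by (auto simp: smooth_step_def bump_def divide_simps)

lemma smooth_step_eq_0: "x \<le> 0 \<Longrightarrow> smooth_step x = 0"
  by (simp add: smooth_step_def bump_def)

lemma smooth_step_eq_1: "x \<ge> 1 \<Longrightarrow> smooth_step x = 1"
  using smooth_step_denom[of x] by (simp add: smooth_step_def bump_def)

lemma eventually_scaled_ge:
  assumes "x > 0"
  shows "\<forall>\<^sub>F n in sequentially. real n * x > c"
proof -
  obtain N where N: "real N * x > c" using reals_Archimedean3[OF assms] by blast
  have "real n * x > c" if "n \<ge> N" for n
    using that assms by (intro less_le_trans[OF N]) (auto intro!: mult_right_mono)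
  then show ?thesis by (rule eventually_sequentiallyI)
qed

text \<open>The shift by 1 makes the n-th function vanish where n x <= 1, so the indicator of x > 0
  is approximated by functions supported at a positive distance from 0.\<close>

lemma smooth_step_scaled_limit:
  "(\<lambda>n. smooth_step (real n * x - 1)) \<longlonglongrightarrow> (if x > 0 then 1 else 0)"
proof (cases "x > 0")
  case True
  from eventually_scaled_ge[OF this, of 2]
  have "\<forall>\<^sub>F n in sequentially. smooth_step (real n * x - 1) = 1"
    by eventually_elim (auto intro: smooth_step_eq_1)
  then show ?thesis using True by (simp add: tendsto_eventually)
next
  case False
  then have "real n * x - 1 \<le> 0" for n using mult_nonneg_nonpos[of "real n" x] by simp
  then show ?thesis using False by (simp add: smooth_step_eq_0)
qed

text \<open>\<open>Suc n\<close> instead of n gives a positive distance also for n = 0, where 1/n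
  would be 0.\<close>

lemma smooth_step_scaled_pos:
  assumes "smooth_step (real n * x - 1) \<noteq> 0"
  shows "x > 1 / real (Suc n)"
proof -
  have *: "real n * x > 1" using assms smooth_step_eq_0[of "real n * x - 1"] by linarith
  then have "x > 0" by (smt (verit) mult_nonneg_nonpos of_nat_0_le_iff)
  with * have "real (Suc n) * x > 1" by (simp add: algebra_simps)
  then show ?thesis by (simp add: pos_divide_less_eq mult.commute)
qed

text \<open>Outside [0, 1] the step is locally constant, and on [0, 1] its derivative is continuous;
  hence the global bound. Bound and support together control the cutoffs at the faces.\<close>

lemma smooth_step_deriv:
  obtains s' C where "\<And>x. (smooth_step has_real_derivative s' x) (at x)"
    "\<And>x. \<bar>s' x\<bar> \<le> C" "\<And>x. x < 0 \<or> x > 1 \<Longrightarrow> s' x = 0"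
proof -
  define s' where "s' = dir_deriv 1 smooth_step"
  have der: "(smooth_step has_real_derivative s' x) (at x)" for x
  proof -
    have "(\<lambda>y. y * dir_deriv 1 smooth_step x) = (*) (dir_deriv 1 smooth_step x)"
      by (simp add: fun_eq_iff)
    then show ?thesis
      using differentiable_dir_deriv[OF smooth_on_differentiable[OF smooth_on_smooth_step, of x]]
      by (simp add: s'_def has_field_derivative_def)
  qed
  have z: "s' x = 0" if "x < 0 \<or> x > 1" for x
  proof -
    have "dir_deriv 1 smooth_step x = dir_deriv 1 (\<lambda>_. if x < 0 then 0 else 1) x"
      by (rule dir_deriv_cong_open[of "if x < 0 then {..<0} else {1<..}"])
        (use that in \<open>auto simp: smooth_step_eq_0 smooth_step_eq_1\<close>)
    then show ?thesis by (simp add: s'_def)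
  qed
  have "continuous_on {0..1} s'"
    using smooth_on_continuous_on[OF smooth_on_dir_deriv[OF smooth_on_smooth_step]]
    by (auto simp: s'_def intro: continuous_on_subset)
  then have "bounded (s' ` {0..1})" by (intro compact_imp_bounded compact_continuous_image) auto
  then obtain C where "C > 0" "\<forall>x\<in>s' ` {0..1}. norm x \<le> C"
    unfolding bounded_pos by blast
  then have C: "\<And>x. x \<in> {0..1} \<Longrightarrow> \<bar>s' x\<bar> \<le> C" "C > 0"
    by auto
  have "\<bar>s' x\<bar> \<le> C" for x
    using C z[of x] by (cases "x \<in> {0..1}") auto
  then show ?thesis using that der z by blast
qed


section \<open>Integration over the reference domain\<close>

lemma Basis_vec_axis: "(Basis :: (real^'n) set) = range (\<lambda>i. axis i 1)"
  by (auto simp: Basis_vec_def)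

lemma axis_in_Basis [simp]: "axis i (1::real) \<in> Basis"
  by (auto simp: Basis_vec_def)

lemma Ref_dom_open: "open (Ref_dom a b)"
proof -
  have "Ref_dom a b = box (vector [a, 0, 0]) (vector [b, 2 * pi, 1])"
    by (auto simp: Ref_dom_def mem_box_cart forall_3)
  then show ?thesis by (simp add: open_box)
qed

lemma bounded_Ref_dom: "bounded (Ref_dom a b)"
proof -
  have "Ref_dom a b \<subseteq> cbox (vector [a, 0, 0]) (vector [b, 2 * pi, 1])"
    by (auto simp: Ref_dom_def mem_box_cart forall_3 less_imp_le)
  then show ?thesis using bounded_cbox bounded_subset by blast
qed

lemma Ref_dom_sets [simp]: "Ref_dom a b \<in> sets lebesgue" "Ref_dom a b \<in> sets borel"
  using Ref_dom_open by (auto simp: borel_open)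

lemma continuous_bounded_on:
  fixes f :: "'a::euclidean_space \<Rightarrow> 'b::euclidean_space"
  assumes "continuous_on UNIV f" "bounded S"
  obtains B where "B > 0" "\<And>x. x \<in> S \<Longrightarrow> norm (f x) \<le> B"
proof -
  have "bounded (f ` closure S)"
    using assms by (intro compact_imp_bounded compact_continuous_image) (auto intro: continuous_on_subset)
  then obtain B where "B > 0" "\<forall>x\<in>f ` closure S. norm x \<le> B" unfolding bounded_pos by blast
  then show ?thesis using that closure_subset[of S] by blast
qed

lemma continuous_borel_measurable_lebesgue_on:
  fixes f :: "'a::euclidean_space \<Rightarrow> 'b::euclidean_space"
  shows "continuous_on UNIV f \<Longrightarrow> f \<in> borel_measurable (lebesgue_on S)"
  by (intro measurable_restrict_space1 measurable_completion) (auto simp: borel_measurable_continuous_onI)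

section \<open>Square integrable functions, strong and weak limits\<close>

lemma L2_measurable: "L2 S f \<Longrightarrow> f \<in> borel_measurable (lebesgue_on S)"
  by (simp add: L2_def)

lemma L2_inner_integrable:
  fixes f g :: "'a::euclidean_space \<Rightarrow> 'b::euclidean_space"
  assumes "L2 S f" "L2 S g"
  shows "integrable (lebesgue_on S) (\<lambda>x. f x \<bullet> g x)"
proof (rule Bochner_Integration.integrable_bound)
  show "integrable (lebesgue_on S) (\<lambda>x. (norm (f x))\<^sup>2 + (norm (g x))\<^sup>2)"
    using assms by (auto simp: L2_def)
  show "(\<lambda>x. f x \<bullet> g x) \<in> borel_measurable (lebesgue_on S)"
    using assms by (auto simp: L2_def)
  have "\<bar>f x \<bullet> g x\<bar> \<le> (norm (f x))\<^sup>2 + (norm (g x))\<^sup>2" for x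
  proof -
    have "\<bar>f x \<bullet> g x\<bar> \<le> norm (f x) * norm (g x)" by (rule Cauchy_Schwarz_ineq2)
    also have "\<dots> \<le> (norm (f x))\<^sup>2 + (norm (g x))\<^sup>2"
      using sum_squares_bound[of "norm (f x)" "norm (g x)"] mult_nonneg_nonneg[OF norm_ge_zero[of "f x"] norm_ge_zero[of "g x"]]
      by linarith
    finally show ?thesis .
  qed
  then show "AE x in lebesgue_on S. norm (f x \<bullet> g x) \<le> norm ((norm (f x))\<^sup>2 + (norm (g x))\<^sup>2)"
    by auto
qed

lemma L2_bounded_by:
  fixes f :: "'a::euclidean_space \<Rightarrow> 'b::euclidean_space" and g :: "'a \<Rightarrow> 'c::euclidean_space"
  assumes "L2 S f" "g \<in> borel_measurable (lebesgue_on S)" "S \<in> sets lebesgue"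
    "\<And>x. x \<in> S \<Longrightarrow> norm (g x) \<le> B * norm (f x)"
  shows "L2 S g"
  unfolding L2_def
proof
  show "integrable (lebesgue_on S) (\<lambda>x. (norm (g x))\<^sup>2)"
  proof (rule Bochner_Integration.integrable_bound)
    show "integrable (lebesgue_on S) (\<lambda>x. B\<^sup>2 * (norm (f x))\<^sup>2)"
      using assms by (auto simp: L2_def)
    have "(norm (g x))\<^sup>2 \<le> B\<^sup>2 * (norm (f x))\<^sup>2" if "x \<in> S" for x
      using power_mono[OF assms(4)[OF that], of 2] by (simp add: power_mult_distrib)
    then show "AE x in lebesgue_on S. norm ((norm (g x))\<^sup>2) \<le> norm (B\<^sup>2 * (norm (f x))\<^sup>2)"
      using assms(3) by (auto intro!: AE_I2)
  qed (use assms in measurable)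
qed fact

lemma L2_add:
  fixes f g :: "'a::euclidean_space \<Rightarrow> 'b::euclidean_space"
  assumes "L2 S f" "L2 S g"
  shows "L2 S (\<lambda>x. f x + g x)"
proof -
  have "integrable (lebesgue_on S) (\<lambda>x. (norm (f x))\<^sup>2 + (norm (g x))\<^sup>2 + 2 * (f x \<bullet> g x))"
    using assms L2_inner_integrable[OF assms] by (auto simp: L2_def)
  moreover have "(norm (f x + g x))\<^sup>2 = (norm (f x))\<^sup>2 + (norm (g x))\<^sup>2 + 2 * (f x \<bullet> g x)" for x
    by (simp add: power2_norm_eq_inner inner_add_left inner_add_right inner_commute)
  moreover have "(\<lambda>x. f x + g x) \<in> borel_measurable (lebesgue_on S)"
    using assms by (intro borel_measurable_add L2_measurable)
  ultimately show ?thesis by (simp add: L2_def)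
qed

lemma L2_scaleR: "L2 S f \<Longrightarrow> L2 S (\<lambda>x. c *\<^sub>R f x)"
  by (auto simp: L2_def power_mult_distrib intro!: borel_measurable_scaleR)

lemma L2_minus: "L2 S f \<Longrightarrow> L2 S (\<lambda>x. - f x)"
  using L2_scaleR[of S f "-1"] by simp

lemma L2_diff: "L2 S f \<Longrightarrow> L2 S g \<Longrightarrow> L2 S (\<lambda>x. f x - g x)"
  using L2_add[of S f "\<lambda>x. - g x"] by (simp add: L2_minus)

lemma L2_continuous:
  fixes f :: "'a::euclidean_space \<Rightarrow> 'b::euclidean_space"
  assumes "continuous_on UNIV f" "bounded S" "S \<in> sets lebesgue"
  shows "L2 S f"
proof -
  have "S \<in> lmeasurable" using assms by (simp add: bounded_set_imp_lmeasurable)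
  then interpret finite_measure "lebesgue_on S" by (rule finite_measure_lebesgue_on)
  obtain B where "B > 0" and B: "\<And>x. x \<in> S \<Longrightarrow> norm (f x) \<le> B"
    using continuous_bounded_on[OF assms(1,2)] by blast
  have "L2 S (\<lambda>x. B)" by (simp add: L2_def)
  then show ?thesis
    by (rule L2_bounded_by[of _ _ _ 1])
      (use B \<open>B > 0\<close> continuous_borel_measurable_lebesgue_on[OF assms(1)] assms(3) in auto)
qed

lemma L2_continuous_mult:
  fixes f :: "real^3 \<Rightarrow> 'b::euclidean_space" and c :: "real^3 \<Rightarrow> real"
  assumes "L2 (Ref_dom a b) f" "continuous_on UNIV c"
  shows "L2 (Ref_dom a b) (\<lambda>x. c x *\<^sub>R f x)"
proof -
  obtain B where B: "B > 0" "\<And>x. x \<in> Ref_dom a b \<Longrightarrow> norm (c x) \<le> B"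
    using continuous_bounded_on[OF assms(2) bounded_Ref_dom] by blast
  show ?thesis
  proof (rule L2_bounded_by[OF assms(1)])
    show "(\<lambda>x. c x *\<^sub>R f x) \<in> borel_measurable (lebesgue_on (Ref_dom a b))"
      by (intro borel_measurable_scaleR L2_measurable[OF assms(1)] continuous_borel_measurable_lebesgue_on assms(2))
    show "norm (c x *\<^sub>R f x) \<le> B * norm (f x)" if "x \<in> Ref_dom a b" for x
      using mult_right_mono[OF B(2)[OF that] norm_ge_zero] by simp
  qed simp
qed

lemma L2_continuous_inner:
  fixes f c :: "real^3 \<Rightarrow> 'b::euclidean_space"
  assumes "L2 (Ref_dom a b) f" "continuous_on UNIV c"
  shows "L2 (Ref_dom a b) (\<lambda>x. f x \<bullet> c x)"
proof -
  obtain B where B: "B > 0" "\<And>x. x \<in> Ref_dom a b \<Longrightarrow> norm (c x) \<le> B"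
    using continuous_bounded_on[OF assms(2) bounded_Ref_dom] by blast
  have "norm (f x \<bullet> c x) \<le> B * norm (f x)" if "x \<in> Ref_dom a b" for x
  proof -
    have "\<bar>f x \<bullet> c x\<bar> \<le> norm (f x) * norm (c x)" by (rule Cauchy_Schwarz_ineq2)
    also have "\<dots> \<le> norm (f x) * B" using B(2)[OF that] by (intro mult_left_mono) auto
    finally show ?thesis by (simp add: mult.commute)
  qed
  moreover have "(\<lambda>x. f x \<bullet> c x) \<in> borel_measurable (lebesgue_on (Ref_dom a b))"
    by (intro borel_measurable_inner L2_measurable[OF assms(1)] continuous_borel_measurable_lebesgue_on assms(2))
  ultimately show ?thesis
    by (intro L2_bounded_by[OF assms(1), of _ B]) auto
qed

lemma L2_continuous_integrable:
  fixes f c :: "real^3 \<Rightarrow> 'b::euclidean_space"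
  assumes "L2 (Ref_dom a b) f" "continuous_on UNIV c"
  shows "integrable (lebesgue_on (Ref_dom a b)) (\<lambda>x. f x \<bullet> c x)"
  using L2_inner_integrable[OF assms(1) L2_continuous[OF assms(2) bounded_Ref_dom]] by simp

lemma L2_conv_inner:
  fixes f w :: "'a::euclidean_space \<Rightarrow> 'b::euclidean_space"
  assumes "L2_conv S fn f" "L2 S w"
  shows "(\<lambda>n. LINT x|lebesgue_on S. fn n x \<bullet> w x) \<longlonglongrightarrow> (LINT x|lebesgue_on S. f x \<bullet> w x)"
proof -
  define N where "N = (\<lambda>n. LINT x|lebesgue_on S. (norm (fn n x - f x))\<^sup>2)"
  define W where "W = (LINT x|lebesgue_on S. (norm (w x))\<^sup>2)"
  have fn: "L2 S (fn n)" "L2 S f" and lim: "N \<longlonglongrightarrow> 0" for n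
    using assms(1) by (auto simp: L2_conv_def N_def)
  have N0: "N n \<ge> 0" for n by (simp add: N_def)
  text \<open>A Cauchy--Schwarz inequality up to constants is enough for convergence: weighting AM--GM
    by a fixed \<open>t\<close> gives the bound \<open>N\<^sub>n / t + t W\<close>.\<close>
  have bound: "\<bar>(LINT x|lebesgue_on S. fn n x \<bullet> w x) - (LINT x|lebesgue_on S. f x \<bullet> w x)\<bar> \<le> N n / t + t * W"
    if "t > 0" for n t
  proof -
    let ?d = "\<lambda>x. fn n x - f x"
    have d: "L2 S ?d" using fn by (intro L2_diff)
    have le: "\<bar>?d x \<bullet> w x\<bar> \<le> (norm (?d x))\<^sup>2 / t + t * (norm (w x))\<^sup>2" for x
    proof -
      have "\<bar>?d x \<bullet> w x\<bar> \<le> norm (?d x) * norm (w x)" by (rule Cauchy_Schwarz_ineq2)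
      moreover have "0 \<le> (norm (?d x) - t * norm (w x))\<^sup>2 / t" using that by simp
      then have "2 * (norm (?d x) * norm (w x)) \<le> (norm (?d x))\<^sup>2 / t + t * (norm (w x))\<^sup>2"
        using that by (simp add: power2_diff field_simps power2_eq_square)
      moreover have "0 \<le> norm (?d x) * norm (w x)" by simp
      ultimately show ?thesis by linarith
    qed
    have "(LINT x|lebesgue_on S. fn n x \<bullet> w x) - (LINT x|lebesgue_on S. f x \<bullet> w x) = (LINT x|lebesgue_on S. ?d x \<bullet> w x)"
      using fn assms(2) by (simp add: inner_diff_left L2_inner_integrable Bochner_Integration.integral_diff)
    moreover have "\<bar>LINT x|lebesgue_on S. ?d x \<bullet> w x\<bar> \<le> (LINT x|lebesgue_on S. \<bar>?d x \<bullet> w x\<bar>)"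
      by (rule integral_abs_bound)
    moreover have "(LINT x|lebesgue_on S. \<bar>?d x \<bullet> w x\<bar>) \<le> (LINT x|lebesgue_on S. (norm (?d x))\<^sup>2 / t + t * (norm (w x))\<^sup>2)"
      proof (rule integral_mono)
      show "integrable (lebesgue_on S) (\<lambda>x. \<bar>?d x \<bullet> w x\<bar>)"
        by (intro integrable_abs L2_inner_integrable d assms(2))
      show "integrable (lebesgue_on S) (\<lambda>x. (norm (?d x))\<^sup>2 / t + t * (norm (w x))\<^sup>2)"
        using d assms(2) by (auto simp: L2_def)
    qed (rule le)
    moreover have "(LINT x|lebesgue_on S. (norm (?d x))\<^sup>2 / t + t * (norm (w x))\<^sup>2) = N n / t + t * W"
      using d assms(2) by (simp add: N_def W_def L2_def)
    ultimately show ?thesis by linarith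
  qed
  have W0: "W \<ge> 0" by (simp add: W_def)
  show ?thesis
  proof (rule LIMSEQ_I)
    fix r :: real assume "r > 0"
    \<comment> \<open>W + 1 in place of W keeps t positive when \<open>w\<close> vanishes almost
      everywhere.\<close>
    define t where "t = r / (2 * (W + 1))"
    have t: "t > 0" "t * W < r / 2" using \<open>r > 0\<close> W0 by (auto simp: t_def field_simps)
    have "\<forall>\<^sub>F n in sequentially. N n < t * (r / 2)"
      using lim t \<open>r > 0\<close> by (intro order_tendstoD(2)) auto
    then obtain n0 where "\<And>n. n \<ge> n0 \<Longrightarrow> N n < t * (r / 2)" by (auto simp: eventually_sequentially)
    then have *: "N n / t < r / 2" if "n \<ge> n0" for n
      using t that by (simp add: pos_divide_less_eq mult.commute)
    have "N n / t + t * W < r" if "n \<ge> n0" for n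
      using *[OF that] t(2) by linarith
    then have "norm ((LINT x|lebesgue_on S. fn n x \<bullet> w x) - (LINT x|lebesgue_on S. f x \<bullet> w x)) < r"
      if "n \<ge> n0" for n
      using order_le_less_trans[OF bound[OF t(1), of n]] that by simp
    then show "\<exists>no. \<forall>n\<ge>no. norm ((LINT x|lebesgue_on S. fn n x \<bullet> w x) - (LINT x|lebesgue_on S. f x \<bullet> w x)) < r"
      by blast
  qed
qed

text \<open>Each pairing with a fixed \<open>w k\<close> converges, so the factor
  \<open>e n ^ k\<close> removes all terms but k = 0. For this reason the pulled-back equations are
  arranged as polynomials in \<epsilon> with fixed coefficients.\<close>

lemma L2_weak_conv_polynomial:
  fixes f :: "nat \<Rightarrow> real^3 \<Rightarrow> 'b::euclidean_space"
  assumes "L2_weak_conv S f l" "e \<longlonglongrightarrow> (0::real)" "S \<in> sets lebesgue"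
    "\<And>k. k \<le> N \<Longrightarrow> L2 S (w k)"
  shows "(\<lambda>n. LINT x|lebesgue_on S. f n x \<bullet> (\<Sum>k\<le>N. e n ^ k *\<^sub>R w k x)) \<longlonglongrightarrow> (LINT x|lebesgue_on S. l x \<bullet> w 0 x)"
proof -
  have f: "L2 S (f n)" for n using assms(1) by (auto simp: L2_weak_conv_def)
  have "(\<lambda>n. \<Sum>k\<le>N. e n ^ k * (LINT x|lebesgue_on S. f n x \<bullet> w k x)) \<longlonglongrightarrow>
      (\<Sum>k\<le>N. 0 ^ k * (LINT x|lebesgue_on S. l x \<bullet> w k x))"
    using assms by (intro tendsto_intros) (auto simp: L2_weak_conv_def)
  moreover have "(LINT x|lebesgue_on S. f n x \<bullet> (\<Sum>k\<le>N. e n ^ k *\<^sub>R w k x)) =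
      (\<Sum>k\<le>N. e n ^ k * (LINT x|lebesgue_on S. f n x \<bullet> w k x))" for n
    using assms(4) f by (simp add: inner_sum_right L2_inner_integrable)
  moreover have "(\<Sum>k\<le>N. 0 ^ k * (LINT x|lebesgue_on S. l x \<bullet> w k x)) = (LINT x|lebesgue_on S. l x \<bullet> w 0 x)"
  proof -
    have "(\<Sum>k\<le>N. 0 ^ k * (LINT x|lebesgue_on S. l x \<bullet> w k x)) =
        (\<Sum>k\<le>N. if k = 0 then LINT x|lebesgue_on S. l x \<bullet> w 0 x else 0)"
      by (rule sum.cong) (auto simp: power_0_left)
    then show ?thesis by simp
  qed
  ultimately show ?thesis by simp
qed

section \<open>Fubini and the fundamental theorem of calculus in the third variable\<close>

lemma face3_eq: "face3 c y = fst y *\<^sub>R axis 1 1 + snd y *\<^sub>R axis 2 1 + c *\<^sub>R axis 3 1"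
  by (simp add: vec_eq_iff forall_3 face3_def axis_def)

text \<open>\<open>real^3\<close> is not a product type; this transport makes Fubini available.
  Lebesgue measure is determined by its values on boxes, so only volumes of boxes are
  compared.\<close>

lemma lborel_real3_eq_distr:
  "(lborel :: (real^3) measure) = distr (lborel :: ((real \<times> real) \<times> real) measure) borel
     (\<lambda>z. face3 (snd z) (fst z))" (is "_ = distr _ _ ?X")
proof (rule lborel_eqI)
  have m [measurable]: "?X \<in> borel_measurable borel"
  proof (rule borel_measurable_continuous_onI)
    show "continuous_on UNIV ?X"
      unfolding face3_eq by (intro continuous_intros)
  qed
  fix l u :: "real^3" assume lu: "\<And>b. b \<in> Basis \<Longrightarrow> l \<bullet> b \<le> u \<bullet> b"
  then have lu': "l $ i \<le> u $ i" for i using lu[of "axis i 1"] by (simp add: inner_axis)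
  have "?X -` box l u = box ((l$1, l$2), l$3) ((u$1, u$2), u$3)"
    by (auto simp: face3_def mem_box_cart forall_3 mem_box Basis_prod_def)
  then have "emeasure (distr lborel borel ?X) (box l u) = emeasure lborel (box ((l$1, l$2), l$3) ((u$1, u$2), u$3))"
    by (simp add: emeasure_distr)
  also have "\<dots> = (\<Prod>b\<in>Basis. (((u$1, u$2), u$3) - ((l$1, l$2), l$3)) \<bullet> b)"
    by (rule emeasure_lborel_box) (use lu' in \<open>auto simp: Basis_prod_def\<close>)
  also have "(\<Prod>b\<in>Basis. (((u$1, u$2), u$3) - ((l$1, l$2), l$3)) \<bullet> b) = (u$1 - l$1) * (u$2 - l$2) * (u$3 - l$3)"
  proof -
    have B: "(Basis :: ((real \<times> real) \<times> real) set) = {((1, 0), 0), ((0, 1), 0), ((0, 0), 1)}"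
      by (auto simp: Basis_prod_def zero_prod_def)
    show ?thesis unfolding B by simp
  qed
  also have "\<dots> = (\<Prod>b\<in>Basis. (u - l) \<bullet> b)"
  proof -
    have "inj (\<lambda>i::3. axis i (1::real))" by (auto simp: inj_on_def axis_eq_axis)
    then have "(\<Prod>b\<in>Basis. (u - l) \<bullet> b) = (\<Prod>i\<in>UNIV. u $ i - l $ i)"
      unfolding Basis_vec_axis by (subst prod.reindex) (simp_all add: inner_axis)
    then show ?thesis unfolding UNIV_3 by simp
  qed
  finally show "emeasure (distr lborel borel ?X) (box l u) = (\<Prod>b\<in>Basis. (u - l) \<bullet> b)" .
qed simp


lemma has_vector_derivative_line:
  assumes "f differentiable (at (x + t *\<^sub>R b))"
  shows "((\<lambda>s. f (x + s *\<^sub>R b)) has_vector_derivative dir_deriv b f (x + t *\<^sub>R b)) (at t)"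
proof -
  obtain f' where f': "(f has_derivative f') (at (x + t *\<^sub>R b))"
    using assms by (auto simp: differentiable_def)
  have "((\<lambda>s::real. x + s *\<^sub>R b) has_derivative (\<lambda>s. s *\<^sub>R b)) (at t)"
    by (auto intro!: derivative_eq_intros)
  then have "(f \<circ> (\<lambda>s. x + s *\<^sub>R b) has_derivative f' \<circ> (\<lambda>s. s *\<^sub>R b)) (at t)"
    using f' by (rule diff_chain_at)
  moreover have "f' \<circ> (\<lambda>s. s *\<^sub>R b) = (\<lambda>s. s *\<^sub>R f' b)"
    using has_derivative_linear[OF f'] by (auto simp: linear_scale)
  ultimately show ?thesis
    by (simp add: has_vector_derivative_def o_def has_derivative_dir_deriv[OF f'])
qed

lemma face3_line: "face3 t y = face3 0 y + t *\<^sub>R axis 3 1"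
  by (simp add: face3_eq)

lemma continuous_on_face3 [continuous_intros]:
  "continuous_on S f \<Longrightarrow> continuous_on S g \<Longrightarrow> continuous_on S (\<lambda>x. face3 (f x) (g x))"
  unfolding face3_eq by (intro continuous_intros)

lemma smooth_on_pderiv3: "smooth_on S f \<Longrightarrow> smooth_on S (pderiv3 i f)"
  by (rule smooth_on_dir_deriv) auto

lemma integral_Ref_dom_pderiv3:
  fixes F :: "real^3 \<Rightarrow> real"
  assumes F: "smooth_on UNIV F"
  shows "(LINT x|lebesgue_on (Ref_dom a b). pderiv3 3 F x) =
    (LINT y|lebesgue_on (face3_params a b). F (face3 1 y) - F (face3 0 y))"
proof -
  let ?g = "pderiv3 3 F" and ?Q = "face3_params a b"
  let ?X = "\<lambda>z::(real \<times> real) \<times> real. face3 (snd z) (fst z)"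
  have cont: "continuous_on UNIV ?g"
    using F by (intro smooth_on_continuous_on smooth_on_pderiv3)
  have contF: "continuous_on UNIV F" using F by (rule smooth_on_continuous_on)
  have [measurable]: "?g \<in> borel_measurable borel" "?X \<in> borel_measurable borel" "F \<in> borel_measurable borel"
    "face3 c \<in> borel_measurable borel" for c
    using cont contF by (auto intro!: borel_measurable_continuous_onI continuous_intros)
  have [measurable]: "?Q \<in> sets borel" by (intro borel_open open_Times) auto
  define f where "f = (\<lambda>x. indicator (Ref_dom a b) x *\<^sub>R ?g x)"
  have f_borel [measurable]: "f \<in> borel_measurable borel" 
    unfolding f_def by (intro borel_measurable_scaleR borel_measurable_indicator) auto
  have "integrable (lebesgue_on (Ref_dom a b)) ?g"
    using L2_continuous_integrable[OF L2_continuous[OF cont bounded_Ref_dom Ref_dom_sets(1)] continuous_on_const[of UNIV 1]] by simp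
  then have "integrable lebesgue f"
    by (simp add: integrable_restrict_space f_def)
  then have "integrable lborel f"
    by (simp add: integrable_completion)
  then have int: "integrable (lborel \<Otimes>\<^sub>M lborel) (\<lambda>z. f (?X z))"
    by (simp add: lborel_prod lborel_real3_eq_distr integrable_distr_eq)
  have "(LINT x|lebesgue_on (Ref_dom a b). ?g x) = integral\<^sup>L lebesgue f"
    by (simp add: integral_restrict_space f_def)
  also have "\<dots> = integral\<^sup>L lborel f"
    by (rule integral_completion) simp
  also have "\<dots> = (LINT z|(lborel \<Otimes>\<^sub>M lborel). f (?X z))"
    by (subst lborel_real3_eq_distr) (simp add: integral_distr lborel_prod)
  also have "\<dots> = (LINT y|lborel. LINT t|lborel. f (face3 t y))"
    using lborel_pair.integral_fst'[OF int] by simp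
  also have "\<dots> = (LINT y|lborel. indicator ?Q y *\<^sub>R (F (face3 1 y) - F (face3 0 y)))"
  proof (rule Bochner_Integration.integral_cong[OF refl])
    fix y :: "real \<times> real"
    \<comment> \<open>The reference domain is open while the fundamental theorem is used on the
      closed interval; the two indicators differ only at 0 and 1.\<close>
    have "(LINT t|lborel. f (face3 t y)) = (LINT t|lborel. indicator ?Q y * (?g (face3 t y) * indicator {0..1} t))"
      by (rule integral_discrete_difference[of "{0, 1}"])
        (auto simp: f_def Ref_dom_def face3_def indicator_def mem_Times_iff)
    also have "\<dots> = indicator ?Q y * (LINT t|lborel. ?g (face3 t y) * indicator {0..1} t)"
      by simp
    also have "(LINT t|lborel. ?g (face3 t y) * indicator {0..1} t) = F (face3 1 y) - F (face3 0 y)"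
    proof (rule integral_FTC_Icc_real)
      show "((\<lambda>t. F (face3 t y)) has_real_derivative ?g (face3 t y)) (at t)" for t
        using has_vector_derivative_line[of F "face3 0 y" t "axis 3 1"] smooth_on_differentiable[OF F]
        unfolding face3_line[symmetric] has_real_derivative_iff_has_vector_derivative by simp
      have "continuous_on UNIV (\<lambda>t. ?g (face3 t y))"
        by (rule continuous_on_compose2[OF cont]) (auto intro!: continuous_intros)
      then show "isCont (\<lambda>t. ?g (face3 t y)) t" for t
        by (simp add: continuous_on_eq_continuous_at)
    qed simp
    finally show "(LINT t|lborel. f (face3 t y)) = indicator ?Q y *\<^sub>R (F (face3 1 y) - F (face3 0 y))"
      by simp
  qed
  also have "\<dots> = (LINT y|lebesgue_on ?Q. F (face3 1 y) - F (face3 0 y))"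
    by (simp add: integral_restrict_space integral_completion)
  finally show ?thesis .
qed

section \<open>Test functions on the reference domain\<close>

definition grad3 :: "(real^3 \<Rightarrow> real) \<Rightarrow> real^3 \<Rightarrow> real^3" where
  "grad3 f x = (\<chi> i. pderiv3 i f x)"

lemma differentiable_grad3:
  fixes f :: "real^3 \<Rightarrow> real"
  assumes "f differentiable (at x)"
  shows "(f has_derivative (\<lambda>y. y \<bullet> grad3 f x)) (at x)"
proof -
  have inj: "inj (\<lambda>i::3. axis i (1::real))" by (auto simp: inj_on_def axis_eq_axis)
  have "(\<Sum>b\<in>Basis. (y \<bullet> b) *\<^sub>R dir_deriv b f x) = y \<bullet> grad3 f x" for y
    unfolding Basis_vec_axis using inj
    by (subst sum.reindex) (simp_all add: inner_axis grad3_def, simp add: inner_vec_def)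
  then show ?thesis using differentiable_dir_deriv[OF assms] by simp
qed

lemma axis_component: "axis i x $ j = (if j = i then x else 0)"
  by (simp add: axis_def)

lemma dir_deriv_mult:
  fixes f g :: "'a::euclidean_space \<Rightarrow> real"
  assumes "f differentiable (at x)" "g differentiable (at x)"
  shows "dir_deriv b (\<lambda>x. f x * g x) x = f x * dir_deriv b g x + dir_deriv b f x * g x"
  using has_derivative_dir_deriv[OF has_derivative_mult[OF assms[THEN differentiable_frechet_derivative]]]
    assms[THEN differentiable_frechet_derivative, THEN has_derivative_dir_deriv] by simp

lemma dir_deriv_inner:
  assumes "f differentiable (at x)" "g differentiable (at x)"
  shows "dir_deriv b (\<lambda>x. f x \<bullet> g x) x = f x \<bullet> dir_deriv b g x + dir_deriv b f x \<bullet> g x"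
  using has_derivative_dir_deriv[OF has_derivative_inner[OF assms[THEN differentiable_frechet_derivative]]]
    assms[THEN differentiable_frechet_derivative, THEN has_derivative_dir_deriv] by simp

lemma dir_deriv_add:
  assumes "f differentiable (at x)" "g differentiable (at x)"
  shows "dir_deriv b (\<lambda>x. f x + g x) x = dir_deriv b f x + dir_deriv b g x"
  using has_derivative_dir_deriv[OF has_derivative_add[OF assms[THEN differentiable_frechet_derivative]]]
    assms[THEN differentiable_frechet_derivative, THEN has_derivative_dir_deriv] by simp

lemma dir_deriv_diff:
  assumes "f differentiable (at x)" "g differentiable (at x)"
  shows "dir_deriv b (\<lambda>x. f x - g x) x = dir_deriv b f x - dir_deriv b g x"
  using has_derivative_dir_deriv[OF has_derivative_diff[OF assms[THEN differentiable_frechet_derivative]]]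
    assms[THEN differentiable_frechet_derivative, THEN has_derivative_dir_deriv] by simp

lemma dir_deriv_real_compose:
  fixes f :: "'a::euclidean_space \<Rightarrow> real"
  assumes "f differentiable (at x)" "(g has_real_derivative g') (at (f x))"
  shows "dir_deriv b (\<lambda>x. g (f x)) x = g' * dir_deriv b f x"
proof -
  have "(g \<circ> f has_derivative (*) g' \<circ> frechet_derivative f (at x)) (at x)"
    using assms by (intro diff_chain_at differentiable_frechet_derivative) (auto simp: has_field_derivative_def)
  from has_derivative_dir_deriv[OF this] show ?thesis
    using has_derivative_dir_deriv[OF differentiable_frechet_derivative[OF assms(1)]] by (simp add: o_def)
qed

lemma dir_deriv_coord: "dir_deriv b (\<lambda>x::real^'n. x $ i) x = b $ i"
  by (rule has_derivative_dir_deriv) (rule bounded_linear_imp_has_derivative[OF bounded_linear_vec_nth])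

text \<open>Conditions are imposed on \<open>S\<close> only, because the coefficients contain h and
  quotients by sin \<xi>_1 that are uncontrolled elsewhere. The test function they multiply supplies
  the zero outside.\<close>

definition periodic_coeff :: "(real^3) set \<Rightarrow> (real^3 \<Rightarrow> 'b::real_normed_vector) set" where
  "periodic_coeff S = {c. smooth_on S c \<and> (\<forall>\<xi>\<in>S. c (\<xi> + axis 2 (2 * pi)) = c \<xi>)}"

text \<open>Periodic smooth functions with support in one of the closed sets \<open>K \<delta>\<close> exhausting \<open>U\<close>.
  The two instances below differ in whether the support stays away from the faces \<open>\<xi>\<^sub>3 = 0, 1\<close>.\<close>

locale supported_functions =
  fixes K :: "real \<Rightarrow> (real^3) set" and U :: "(real^3) set"
  assumes closed_K: "closed (K \<delta>)"
    and mono_K: "0 < \<delta> \<Longrightarrow> \<delta> \<le> \<delta>' \<Longrightarrow> K \<delta>' \<subseteq> K \<delta>"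
    and K_subset: "0 < \<delta> \<Longrightarrow> K \<delta> \<subseteq> U"
    and open_U: "open U"
    and shift_U: "\<xi> + axis 2 (2 * pi) \<in> U \<longleftrightarrow> \<xi> \<in> U"
begin

definition tests :: "(real^3 \<Rightarrow> real) set" where
  "tests = {\<psi> \<in> per_smooth. \<exists>\<delta>>0. \<forall>\<xi>. \<psi> \<xi> \<noteq> 0 \<longrightarrow> \<xi> \<in> K \<delta>}"

lemma tests_smooth: "\<psi> \<in> tests \<Longrightarrow> smooth_on UNIV \<psi>"
  by (simp add: tests_def per_smooth_def)

lemma tests_differentiable: "\<psi> \<in> tests \<Longrightarrow> \<psi> differentiable (at x)"
  using tests_smooth smooth_on_differentiable by blast

lemma tests_periodic: "\<psi> \<in> tests \<Longrightarrow> \<psi> (\<xi> + axis 2 (2 * pi)) = \<psi> \<xi>"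
  by (simp add: tests_def per_smooth_def periodic2_def)

lemma tests_zero_outside: "\<psi> \<in> tests \<Longrightarrow> \<xi> \<notin> U \<Longrightarrow> \<psi> \<xi> = 0"
  using K_subset by (auto simp: tests_def)

text \<open>The complement of the closed set \<open>K \<delta>\<close> is open, so derivatives
  vanish there too and the same \<delta> serves.\<close>

lemma tests_pderiv3:
  assumes "\<psi> \<in> tests"
  shows "pderiv3 i \<psi> \<in> tests"
proof -
  obtain \<delta> where \<delta>: "\<delta> > 0" "\<And>\<xi>. \<psi> \<xi> \<noteq> 0 \<Longrightarrow> \<xi> \<in> K \<delta>" using assms by (auto simp: tests_def)
  have "pderiv3 i \<psi> \<xi> = 0" if "\<xi> \<notin> K \<delta>" for \<xi>
    using dir_deriv_cong_open[of "- K \<delta>" \<xi> \<psi> "\<lambda>x. 0" "axis i 1"] closed_K that \<delta>(2) by fastforce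
  moreover have "pderiv3 i \<psi> (\<xi> + axis 2 (2 * pi)) = pderiv3 i \<psi> \<xi>" for \<xi>
  proof -
    have "\<psi> (\<xi> + axis 2 (2 * pi) + t *\<^sub>R axis i 1) = \<psi> (\<xi> + t *\<^sub>R axis i 1)" for t
      using tests_periodic[OF assms, of "\<xi> + t *\<^sub>R axis i 1"] by (simp add: add_ac)
    then show ?thesis by (simp add: dir_deriv_def)
  qed
  ultimately show ?thesis
    using \<delta>(1) smooth_on_pderiv3[OF tests_smooth[OF assms]]
    by (auto simp: tests_def per_smooth_def periodic2_def)
qed

lemma tests_coeff_mult:
  assumes "c \<in> periodic_coeff U" "\<psi> \<in> tests"
  shows "(\<lambda>\<xi>. c \<xi> * \<psi> \<xi>) \<in> tests"
proof -
  obtain \<delta> where \<delta>: "\<delta> > 0" "\<And>\<xi>. \<psi> \<xi> \<noteq> 0 \<Longrightarrow> \<xi> \<in> K \<delta>" using assms by (auto simp: tests_def)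
  have "smooth_on UNIV (\<lambda>\<xi>. c \<xi> * \<psi> \<xi>)"
    using open_U closed_K K_subset[OF \<delta>(1)] assms \<delta>(2)
    by (intro smooth_on_mult_extend[of U "K \<delta>"]) (auto simp: periodic_coeff_def tests_smooth)
  moreover have "c (\<xi> + axis 2 (2 * pi)) * \<psi> (\<xi> + axis 2 (2 * pi)) = c \<xi> * \<psi> \<xi>" for \<xi>
    using assms tests_periodic[OF assms(2)] tests_zero_outside[OF assms(2)]
    by (cases "\<xi> \<in> U") (auto simp: periodic_coeff_def)
  ultimately show ?thesis
    using \<delta> by (auto simp: tests_def per_smooth_def periodic2_def intro!: exI[of _ \<delta>])
qed

lemma tests_add:
  assumes "\<psi> \<in> tests" "\<eta> \<in> tests"
  shows "(\<lambda>\<xi>. \<psi> \<xi> + \<eta> \<xi>) \<in> tests"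
proof -
  obtain \<delta> where \<delta>: "\<delta> > 0" "\<And>\<xi>. \<psi> \<xi> \<noteq> 0 \<Longrightarrow> \<xi> \<in> K \<delta>" using assms by (auto simp: tests_def)
  obtain \<delta>' where \<delta>': "\<delta>' > 0" "\<And>\<xi>. \<eta> \<xi> \<noteq> 0 \<Longrightarrow> \<xi> \<in> K \<delta>'" using assms by (auto simp: tests_def)
  have "K \<delta> \<subseteq> K (min \<delta> \<delta>')" "K \<delta>' \<subseteq> K (min \<delta> \<delta>')"
    using \<delta>(1) \<delta>'(1) by (intro mono_K; simp)+
  then have "\<forall>\<xi>. \<psi> \<xi> + \<eta> \<xi> \<noteq> 0 \<longrightarrow> \<xi> \<in> K (min \<delta> \<delta>')"
    using \<delta>(2) \<delta>'(2) by (metis add_0 subsetD)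
  moreover have "min \<delta> \<delta>' > 0" using \<delta> \<delta>' by simp
  ultimately show ?thesis
    using smooth_on_add[OF open_UNIV assms[THEN tests_smooth]] assms[THEN tests_periodic]
    unfolding tests_def per_smooth_def periodic2_def
    by (intro CollectI conjI exI[of _ "min \<delta> \<delta>'"]) auto
qed

lemma tests_per_smooth_mult:
  assumes "c \<in> per_smooth" "\<psi> \<in> tests"
  shows "(\<lambda>\<xi>. c \<xi> * \<psi> \<xi>) \<in> tests"
  using assms smooth_on_subset[of UNIV c U]
  by (intro tests_coeff_mult) (auto simp: periodic_coeff_def per_smooth_def periodic2_def)

lemma tests_scale: "\<psi> \<in> tests \<Longrightarrow> (\<lambda>\<xi>. a * \<psi> \<xi>) \<in> tests"
  by (rule tests_per_smooth_mult) (auto simp: per_smooth_def periodic2_def smooth_on_const)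

lemma tests_diff: "\<psi> \<in> tests \<Longrightarrow> \<eta> \<in> tests \<Longrightarrow> (\<lambda>\<xi>. \<psi> \<xi> - \<eta> \<xi>) \<in> tests"
  using tests_add[of \<psi> "\<lambda>\<xi>. -1 * \<eta> \<xi>"] tests_scale[of \<eta> "-1"] by simp

lemma tests_zero: "(\<lambda>\<xi>. 0) \<in> tests"
  by (auto simp: tests_def per_smooth_def periodic2_def smooth_on_const intro: exI[of _ 1])

lemma tests_sum: "(\<And>i. i \<in> I \<Longrightarrow> \<psi> i \<in> tests) \<Longrightarrow> (\<lambda>\<xi>. \<Sum>i\<in>I. \<psi> i \<xi>) \<in> tests"
  by (induction I rule: infinite_finite_induct) (auto intro: tests_add tests_zero)

end

definition slab :: "real \<Rightarrow> real \<Rightarrow> (real^3) set" where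
  "slab a b = {\<xi>. a < \<xi>$1 \<and> \<xi>$1 < b}"

definition layer :: "real \<Rightarrow> real \<Rightarrow> (real^3) set" where
  "layer a b = {\<xi>. a < \<xi>$1 \<and> \<xi>$1 < b \<and> 0 < \<xi>$3 \<and> \<xi>$3 < 1}"

definition slab_core :: "real \<Rightarrow> real \<Rightarrow> real \<Rightarrow> (real^3) set" where
  "slab_core a b \<delta> = {\<xi>. a + \<delta> \<le> \<xi>$1 \<and> \<xi>$1 \<le> b - \<delta>}"

definition layer_core :: "real \<Rightarrow> real \<Rightarrow> real \<Rightarrow> (real^3) set" where
  "layer_core a b \<delta> = {\<xi>. a + \<delta> \<le> \<xi>$1 \<and> \<xi>$1 \<le> b - \<delta> \<and> \<delta> \<le> \<xi>$3 \<and> \<xi>$3 \<le> 1 - \<delta>}"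

lemma open_slab: "open (slab a b)"
  unfolding slab_def by (intro open_Collect_conj open_Collect_less continuous_intros)

lemma open_layer: "open (layer a b)"
  unfolding layer_def by (intro open_Collect_conj open_Collect_less continuous_intros)

interpretation lat: supported_functions "slab_core a b" "slab a b" for a b
proof
  show "closed (slab_core a b \<delta>)" for \<delta>
    unfolding slab_core_def by (intro closed_Collect_conj closed_Collect_le continuous_intros)
qed (auto simp: slab_core_def slab_def axis_component open_slab[unfolded slab_def])

interpretation per: supported_functions "layer_core a b" "layer a b" for a b
proof
  show "closed (layer_core a b \<delta>)" for \<delta>
    unfolding layer_core_def by (intro closed_Collect_conj closed_Collect_le continuous_intros)
qed (auto simp: layer_core_def layer_def axis_component open_layer[unfolded layer_def])

lemma per_tests_eq: "per.tests a b = per_test a b"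
  by (auto simp: per.tests_def per_test_def layer_core_def)

lemma per_test_subset_lat: "per_test a b \<subseteq> lat.tests a b"
  by (fastforce simp: lat.tests_def per_test_def slab_core_def)

lemma periodic_coeff_slab_layer: "periodic_coeff (slab a b) \<subseteq> periodic_coeff (layer a b)"
  by (auto simp: periodic_coeff_def layer_def slab_def intro: smooth_on_subset)

section \<open>Primitives in the third variable\<close>

text \<open>Multiplies the third coordinate by s: s = 1 is the identity, s = 0 the projection to the
  lower face.\<close>

definition shrink3 :: "real \<Rightarrow> real^3 \<Rightarrow> real^3" where
  "shrink3 s \<xi> = \<xi> + ((s - 1) * \<xi>$3) *\<^sub>R axis 3 1"

text \<open>With t = s \<xi>_3, the primitive of \<open>f\<close> from 0 to \<xi>_3 is \<xi>_3 times
  the case k = 0. The fixed interval permits differentiation under the integral sign, and the weight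
  s^k makes room for the factors that \<partial>_3 produces.\<close>

definition moment3 :: "nat \<Rightarrow> (real^3 \<Rightarrow> real) \<Rightarrow> real^3 \<Rightarrow> real" where
  "moment3 k f \<xi> = integral {0..1} (\<lambda>s. s ^ k * f (shrink3 s \<xi>))"

lemma shrink3_nth: "shrink3 s \<xi> $ i = (if i = 3 then s * \<xi>$3 else \<xi>$i)"
  by (auto simp: shrink3_def axis_component algebra_simps)

lemma continuous_on_shrink3 [continuous_intros]:
  "continuous_on S f \<Longrightarrow> continuous_on S g \<Longrightarrow> continuous_on S (\<lambda>x. shrink3 (f x) (g x))"
  unfolding shrink3_def by (intro continuous_intros)

lemma moment3_integrand_continuous:
  assumes "continuous_on UNIV f"
  shows "continuous_on {0..1} (\<lambda>s. s ^ k * f (shrink3 s \<xi>))"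
  by (intro continuous_intros continuous_on_compose2[OF assms]) auto

text \<open>Leibniz rule over a compact interval. Differentiating \<open>f (shrink3 s \<xi>)\<close>
  in the third direction brings out a factor s, so all derivatives of moments are moments of
  derivatives, and smoothness follows by induction.\<close>

lemma moment3_deriv:
  assumes f: "smooth_on UNIV f"
  shows "moment3 k f differentiable (at \<xi>)"
    "pderiv3 i (moment3 k f) \<xi> = moment3 (if i = 3 then Suc k else k) (pderiv3 i f) \<xi>"
proof -
  define V where "V = (\<lambda>\<xi> s. s ^ k *\<^sub>R (\<chi> i. (if i = 3 then s else 1) * pderiv3 i f (shrink3 s \<xi>)) :: real^3)"
  have cf: "continuous_on UNIV (pderiv3 i f)" for i
    using f by (intro smooth_on_continuous_on smooth_on_pderiv3)
  have contV: "continuous_on (UNIV \<times> cbox 0 1) (\<lambda>(\<xi>, s). blinfun_inner_left (V \<xi> s))"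
  proof -
    have "continuous_on (UNIV \<times> cbox 0 1) (\<lambda>z. (if i = 3 then snd z else 1) * pderiv3 i f (shrink3 (snd z) (fst z)))" for i
    proof -
      have "continuous_on (UNIV \<times> cbox 0 1) (\<lambda>z. pderiv3 i f (shrink3 (snd z) (fst z)))"
        by (rule continuous_on_compose2[OF cf]) (auto intro!: continuous_intros)
      then show ?thesis
        by (cases "i = 3") (auto intro!: continuous_on_mult continuous_on_snd continuous_on_id)
    qed
    then have "continuous_on (UNIV \<times> cbox 0 1) (\<lambda>z. V (fst z) (snd z))"
      unfolding V_def
      by (intro continuous_on_scaleR continuous_on_vec_lambda continuous_on_power continuous_on_snd continuous_on_id)
    from bounded_linear.continuous_on[OF bounded_linear_blinfun_inner_left this]
    show ?thesis by (simp add: case_prod_unfold)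
  qed
  have der: "((\<lambda>\<xi>. s ^ k * f (shrink3 s \<xi>)) has_derivative blinfun_apply (blinfun_inner_left (V \<xi> s))) (at \<xi> within UNIV)" for \<xi> s
  proof -
    have "(shrink3 s has_derivative shrink3 s) (at \<xi>)"
      by (intro bounded_linear_imp_has_derivative linear_conv_bounded_linear[THEN iffD1] linearI)
        (auto simp: vec_eq_iff shrink3_nth algebra_simps)
    then have "(f \<circ> shrink3 s has_derivative (\<lambda>y. y \<bullet> grad3 f (shrink3 s \<xi>)) \<circ> shrink3 s) (at \<xi>)"
      using f by (intro diff_chain_at differentiable_grad3) (auto intro: smooth_on_differentiable)
    then have "((\<lambda>\<xi>. s ^ k * f (shrink3 s \<xi>)) has_derivative (\<lambda>y. s ^ k * (shrink3 s y \<bullet> grad3 f (shrink3 s \<xi>)))) (at \<xi>)"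
      by (intro has_derivative_mult_right) (simp add: o_def)
    moreover have "s ^ k * (shrink3 s y \<bullet> grad3 f (shrink3 s \<xi>)) = y \<bullet> V \<xi> s" for y
      by (auto simp: V_def inner_vec_def grad3_def shrink3_nth sum_distrib_left intro!: sum.cong)
    ultimately show ?thesis by simp
  qed
  have "((\<lambda>\<xi>. integral (cbox 0 1) (\<lambda>s. s ^ k * f (shrink3 s \<xi>))) has_derivative
      blinfun_apply (integral (cbox 0 1) (\<lambda>s. blinfun_inner_left (V \<xi> s)))) (at \<xi> within UNIV)"
  proof (rule leibniz_rule[OF der _ contV])
    show "(\<lambda>s. s ^ k * f (shrink3 s \<xi>)) integrable_on cbox 0 1" for \<xi>
      using moment3_integrand_continuous[OF smooth_on_continuous_on[OF f]]
      by (intro integrable_continuous) simp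
  qed auto
  then have D: "(moment3 k f has_derivative
      blinfun_apply (integral (cbox 0 1) (\<lambda>s. blinfun_inner_left (V \<xi> s)))) (at \<xi>)"
    by (simp add: moment3_def[abs_def])
  then show "moment3 k f differentiable (at \<xi>)" by (auto simp: differentiable_def)
  have "continuous_on (cbox 0 1) (\<lambda>s. case (\<xi>, s) of (\<xi>, s) \<Rightarrow> blinfun_inner_left (V \<xi> s))"
    by (rule continuous_on_compose2[OF contV]) (auto intro!: continuous_on_Pair continuous_on_const continuous_on_id)
  then have "continuous_on (cbox 0 1) (\<lambda>s. blinfun_inner_left (V \<xi> s))" by simp
  then have "(\<lambda>s. blinfun_inner_left (V \<xi> s)) integrable_on cbox 0 1" by (rule integrable_continuous)
  then have "pderiv3 i (moment3 k f) \<xi> = integral (cbox 0 1) (\<lambda>s. axis i 1 \<bullet> V \<xi> s)"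
    by (simp add: has_derivative_dir_deriv[OF D] blinfun_apply_integral)
  also have "\<dots> = moment3 (if i = 3 then Suc k else k) (pderiv3 i f) \<xi>"
    by (auto simp: moment3_def V_def inner_axis' mult_ac)
  finally show "pderiv3 i (moment3 k f) \<xi> = moment3 (if i = 3 then Suc k else k) (pderiv3 i f) \<xi>" .
qed

lemma smooth_on_moment3:
  assumes "smooth_on UNIV f"
  shows "smooth_on UNIV (moment3 k f)"
proof -
  have "Ck_on n UNIV (moment3 k f)" for n
    using assms
  proof (induction n arbitrary: k f)
    case 0
    then show ?case using moment3_deriv(1)
      by (auto intro!: continuous_at_imp_continuous_on differentiable_imp_continuous_within)
  next
    case (Suc n)
    have "pderiv3 i (moment3 k f) = moment3 (if i = 3 then Suc k else k) (pderiv3 i f)" for i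
      using moment3_deriv(2)[OF Suc.prems] by blast
    then have "Ck_on n UNIV (pderiv3 i (moment3 k f))" for i
      using Suc.IH[OF smooth_on_pderiv3[OF Suc.prems]] by simp
    then show ?case
      using moment3_deriv(1)[OF Suc.prems] by (auto simp: Basis_vec_axis)
  qed
  then show ?thesis by (simp add: smooth_on_def)
qed

definition primitive3 :: "(real^3 \<Rightarrow> real) \<Rightarrow> real^3 \<Rightarrow> real" where
  "primitive3 f \<xi> = \<xi>$3 * moment3 0 f \<xi>"

lemma smooth_on_primitive3: "smooth_on UNIV f \<Longrightarrow> smooth_on UNIV (primitive3 f)"
  unfolding primitive3_def[abs_def] by (intro smooth_intros smooth_on_moment3 open_UNIV)

lemma primitive3_at_0: "\<xi>$3 = 0 \<Longrightarrow> primitive3 f \<xi> = 0"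
  by (simp add: primitive3_def)

text \<open>Fundamental theorem along the segment from \<open>shrink3 0 \<xi>\<close> to \<xi>. It
  turns a primitive with an explicitly known antiderivative into a formula, from which its values on
  both faces can be read off.\<close>

lemma primitive3_unique:
  assumes F: "smooth_on UNIV F" and f: "\<And>\<xi>. pderiv3 3 F \<xi> = f \<xi>"
  shows "primitive3 f \<xi> = F \<xi> - F (shrink3 0 \<xi>)"
proof -
  have eq: "shrink3 s \<xi> = shrink3 0 \<xi> + s *\<^sub>R ((\<xi>$3) *\<^sub>R axis 3 1)" for s
    by (simp add: shrink3_def algebra_simps)
  have "((\<lambda>s. F (shrink3 s \<xi>)) has_vector_derivative \<xi>$3 * f (shrink3 s \<xi>)) (at s within {0..1})" for s
  proof -
    have dF: "F differentiable (at (shrink3 s \<xi>))" using F smooth_on_differentiable by blast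
    from has_derivative_dir_deriv[OF differentiable_grad3[OF this], of "(\<xi>$3) *\<^sub>R axis 3 1"]
    have "dir_deriv ((\<xi>$3) *\<^sub>R axis 3 1) F (shrink3 s \<xi>) = \<xi>$3 * f (shrink3 s \<xi>)"
      by (simp add: grad3_def inner_axis' f)
    moreover have "((\<lambda>s. F (shrink3 s \<xi>)) has_vector_derivative dir_deriv ((\<xi>$3) *\<^sub>R axis 3 1) F (shrink3 s \<xi>)) (at s)"
      using has_vector_derivative_line[of F "shrink3 0 \<xi>" s "(\<xi>$3) *\<^sub>R axis 3 1"] dF unfolding eq[symmetric] .
    ultimately show ?thesis by (simp add: has_vector_derivative_at_within)
  qed
  then have "((\<lambda>s. \<xi>$3 * f (shrink3 s \<xi>)) has_integral F (shrink3 1 \<xi>) - F (shrink3 0 \<xi>)) {0..1}"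
    by (intro fundamental_theorem_of_calculus) auto
  then have "integral {0..1} (\<lambda>s. \<xi>$3 * f (shrink3 s \<xi>)) = F (shrink3 1 \<xi>) - F (shrink3 0 \<xi>)"
    by (rule integral_unique)
  then show ?thesis by (simp add: primitive3_def moment3_def shrink3_def)
qed

text \<open>For the third direction, the product rule gives the integral over s of the derivative of
  s f(shrink3 s \<xi>), which telescopes to f(\<xi>). The other directions pass under the
  integral.\<close>

lemma pderiv3_primitive3:
  assumes f: "smooth_on UNIV f"
  shows "pderiv3 3 (primitive3 f) \<xi> = f \<xi>"
    "i \<noteq> 3 \<Longrightarrow> pderiv3 i (primitive3 f) \<xi> = primitive3 (pderiv3 i f) \<xi>"
proof -
  have prod: "pderiv3 i (primitive3 f) \<xi> = \<xi>$3 * pderiv3 i (moment3 0 f) \<xi> + axis i 1 $ 3 * moment3 0 f \<xi>" for i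
    unfolding primitive3_def[abs_def]
    by (subst dir_deriv_mult)
      (auto simp: dir_deriv_coord moment3_deriv[OF f] intro: smooth_on_differentiable smooth_on_coord)
  show "i \<noteq> 3 \<Longrightarrow> pderiv3 i (primitive3 f) \<xi> = primitive3 (pderiv3 i f) \<xi>"
    using prod[of i] by (simp add: moment3_deriv(2)[OF f] primitive3_def axis_component)
  have eq: "shrink3 s \<xi> = shrink3 0 \<xi> + s *\<^sub>R ((\<xi>$3) *\<^sub>R axis 3 1)" for s
    by (simp add: shrink3_def algebra_simps)
  have c: "continuous_on UNIV f" "continuous_on UNIV (pderiv3 3 f)"
    using f smooth_on_continuous_on smooth_on_pderiv3 by blast+
  have "((\<lambda>s. s * f (shrink3 s \<xi>)) has_vector_derivative (s * (\<xi>$3 * pderiv3 3 f (shrink3 s \<xi>)) + f (shrink3 s \<xi>))) (at s within {0..1})" for s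
  proof -
    have df: "f differentiable (at (shrink3 s \<xi>))" using f smooth_on_differentiable by blast
    from has_derivative_dir_deriv[OF differentiable_grad3[OF this], of "(\<xi>$3) *\<^sub>R axis 3 1"]
    have "dir_deriv ((\<xi>$3) *\<^sub>R axis 3 1) f (shrink3 s \<xi>) = \<xi>$3 * pderiv3 3 f (shrink3 s \<xi>)"
      by (simp add: grad3_def inner_axis')
    moreover have "((\<lambda>s. f (shrink3 s \<xi>)) has_vector_derivative dir_deriv ((\<xi>$3) *\<^sub>R axis 3 1) f (shrink3 s \<xi>)) (at s)"
      using has_vector_derivative_line[of f "shrink3 0 \<xi>" s "(\<xi>$3) *\<^sub>R axis 3 1"] df unfolding eq[symmetric] .
    ultimately have "((\<lambda>s. f (shrink3 s \<xi>)) has_real_derivative \<xi>$3 * pderiv3 3 f (shrink3 s \<xi>)) (at s within {0..1})"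
      by (simp add: has_real_derivative_iff_has_vector_derivative has_vector_derivative_at_within)
    from DERIV_mult[OF DERIV_ident this] show ?thesis
      by (simp add: has_real_derivative_iff_has_vector_derivative mult_ac add.commute)
  qed
  then have "((\<lambda>s. s * (\<xi>$3 * pderiv3 3 f (shrink3 s \<xi>)) + f (shrink3 s \<xi>)) has_integral 1 * f (shrink3 1 \<xi>) - 0 * f (shrink3 0 \<xi>)) {0..1}"
    by (intro fundamental_theorem_of_calculus) auto
  then have "integral {0..1} (\<lambda>s. s * (\<xi>$3 * pderiv3 3 f (shrink3 s \<xi>)) + f (shrink3 s \<xi>)) = f \<xi>"
    by (intro integral_unique) (simp add: shrink3_def)
  moreover have "integral {0..1} (\<lambda>s. s * (\<xi>$3 * pderiv3 3 f (shrink3 s \<xi>)) + f (shrink3 s \<xi>)) =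
      integral {0..1} (\<lambda>s. \<xi>$3 * (s * pderiv3 3 f (shrink3 s \<xi>))) + integral {0..1} (\<lambda>s. f (shrink3 s \<xi>))"
    by (subst Henstock_Kurzweil_Integration.integral_add[symmetric])
      (auto simp: mult_ac intro!: integrable_continuous_real continuous_intros continuous_on_compose2[OF c(1)] continuous_on_compose2[OF c(2)])
  ultimately show "pderiv3 3 (primitive3 f) \<xi> = f \<xi>"
    using prod[of 3] by (simp add: moment3_deriv(2)[OF f] moment3_def axis_component)
qed

text \<open>A primitive need not vanish above the support of \<open>f\<close>, hence the larger
  class of test functions that are restricted only in \<xi>_1.\<close>

lemma primitive3_lat_tests:
  assumes "f \<in> lat.tests a b"
  shows "primitive3 f \<in> lat.tests a b"
proof -
  obtain \<delta> where \<delta>: "\<delta> > 0" "\<And>\<xi>. f \<xi> \<noteq> 0 \<Longrightarrow> \<xi> \<in> slab_core a b \<delta>"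
    using assms by (auto simp: lat.tests_def)
  have "primitive3 f \<xi> = 0" if "\<xi> \<notin> slab_core a b \<delta>" for \<xi>
  proof -
    have "f (shrink3 s \<xi>) = 0" for s
      using \<delta>(2)[of "shrink3 s \<xi>"] that by (auto simp: slab_core_def shrink3_nth)
    then show ?thesis by (simp add: primitive3_def moment3_def)
  qed
  moreover have "primitive3 f (\<xi> + axis 2 (2 * pi)) = primitive3 f \<xi>" for \<xi>
  proof -
    have "shrink3 s (\<xi> + axis 2 (2 * pi)) = shrink3 s \<xi> + axis 2 (2 * pi)" for s
      by (simp add: vec_eq_iff shrink3_nth axis_component)
    then show ?thesis
      by (simp add: primitive3_def moment3_def lat.tests_periodic[OF assms] axis_component)
  qed
  ultimately show ?thesis
    using \<delta>(1) smooth_on_primitive3[OF lat.tests_smooth[OF assms]]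
    by (auto simp: lat.tests_def per_smooth_def periodic2_def)
qed


section \<open>Traces and integration by parts\<close>

lemma bounded_face3_params: "bounded (face3_params a b)"
  by (intro bounded_Times) auto

lemma face3_params_sets: "face3_params a b \<in> sets lebesgue"
  by (intro sets_completionI_sets) (simp add: borel_open open_Times)

text \<open>The identity holds for the smooth approximants and passes to L^2 limits;
  \<open>d\<close> is the limit of their \<xi>_3-derivatives. The factor 2 c - 1 is the sign of the
  outward normal at \<xi>_3 = c. \<open>\<Theta>\<close> vanishes on the opposite face because the
  sequence carries no trace information there.\<close>

lemma has_trace_integral_by_parts:
  fixes f :: "real^3 \<Rightarrow> 'b::euclidean_space"
  assumes "has_trace per_smooth (Ref_dom a b) {3} (face3_params a b) (face3 c) f g" "c = 0 \<or> c = 1"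
  obtains d where "L2 (Ref_dom a b) d"
    "\<And>\<Theta>. smooth_on UNIV \<Theta> \<Longrightarrow> (\<And>y. \<Theta> (face3 (1 - c) y) = 0) \<Longrightarrow>
      (LINT x|lebesgue_on (Ref_dom a b). f x \<bullet> pderiv3 3 \<Theta> x) + (LINT x|lebesgue_on (Ref_dom a b). d x \<bullet> \<Theta> x)
        = (2 * c - 1) * (LINT y|lebesgue_on (face3_params a b). g y \<bullet> \<Theta> (face3 c y))"
proof -
  let ?\<Omega> = "Ref_dom a b" and ?Q = "face3_params a b"
  obtain \<psi> d where \<psi>: "\<And>n. \<psi> n \<in> per_smooth" "L2_conv ?\<Omega> \<psi> f"
      "L2_conv ?\<Omega> (\<lambda>n. pderiv3 3 (\<psi> n)) d" "L2_conv ?Q (\<lambda>n y. \<psi> n (face3 c y)) g"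
    using assms(1) unfolding has_trace_def by auto
  show ?thesis
  proof (rule that)
    show "L2 ?\<Omega> d" using \<psi>(3) by (simp add: L2_conv_def)
    fix \<Theta> :: "real^3 \<Rightarrow> 'b" assume \<Theta>: "smooth_on UNIV \<Theta>" and zero: "\<And>y. \<Theta> (face3 (1 - c) y) = 0"
    have c\<Theta>: "continuous_on UNIV \<Theta>" "continuous_on UNIV (pderiv3 3 \<Theta>)"
      using \<Theta> smooth_on_continuous_on smooth_on_pderiv3 by blast+
    have L\<Theta>: "L2 ?\<Omega> \<Theta>" "L2 ?\<Omega> (pderiv3 3 \<Theta>)"
      using c\<Theta> by (auto intro!: L2_continuous bounded_Ref_dom)
    have LQ: "L2 ?Q (\<lambda>y. \<Theta> (face3 c y))"
      by (rule L2_continuous[OF _ bounded_face3_params face3_params_sets])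
        (auto intro!: continuous_on_compose2[OF c\<Theta>(1)] continuous_intros)
    have ibp: "(LINT x|lebesgue_on ?\<Omega>. \<psi> n x \<bullet> pderiv3 3 \<Theta> x) + (LINT x|lebesgue_on ?\<Omega>. pderiv3 3 (\<psi> n) x \<bullet> \<Theta> x)
        = (2 * c - 1) * (LINT y|lebesgue_on ?Q. \<psi> n (face3 c y) \<bullet> \<Theta> (face3 c y))" for n
    proof -
      have s: "smooth_on UNIV (\<psi> n)" using \<psi>(1) by (simp add: per_smooth_def)
      have L: "L2 ?\<Omega> (\<psi> n)" "L2 ?\<Omega> (pderiv3 3 (\<psi> n))"
        using \<psi>(2,3) by (auto simp: L2_conv_def)
      have "pderiv3 3 (\<lambda>x. \<psi> n x \<bullet> \<Theta> x) x = \<psi> n x \<bullet> pderiv3 3 \<Theta> x + pderiv3 3 (\<psi> n) x \<bullet> \<Theta> x" for x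
        using s \<Theta> smooth_on_differentiable by (intro dir_deriv_inner) blast+
      then have "(LINT x|lebesgue_on ?\<Omega>. \<psi> n x \<bullet> pderiv3 3 \<Theta> x) + (LINT x|lebesgue_on ?\<Omega>. pderiv3 3 (\<psi> n) x \<bullet> \<Theta> x)
          = (LINT x|lebesgue_on ?\<Omega>. pderiv3 3 (\<lambda>x. \<psi> n x \<bullet> \<Theta> x) x)"
        using L L\<Theta> by (simp add: L2_inner_integrable)
      also have "\<dots> = (LINT y|lebesgue_on ?Q. \<psi> n (face3 1 y) \<bullet> \<Theta> (face3 1 y) - \<psi> n (face3 0 y) \<bullet> \<Theta> (face3 0 y))"
        by (rule integral_Ref_dom_pderiv3) (intro smooth_on_inner s \<Theta> open_UNIV)
      also have "\<dots> = (2 * c - 1) * (LINT y|lebesgue_on ?Q. \<psi> n (face3 c y) \<bullet> \<Theta> (face3 c y))"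
        using assms(2)
      proof
        assume c: "c = 0"
        have "\<Theta> (face3 1 y) = 0" for y using zero[of y] c by simp
        note this[simp]
        show ?thesis by (simp add: c)
      next
        assume c: "c = 1"
        have "\<Theta> (face3 0 y) = 0" for y using zero[of y] c by simp
        note this[simp]
        show ?thesis by (simp add: c)
      qed
      finally show ?thesis .
    qed
    have "(\<lambda>n. (LINT x|lebesgue_on ?\<Omega>. \<psi> n x \<bullet> pderiv3 3 \<Theta> x) + (LINT x|lebesgue_on ?\<Omega>. pderiv3 3 (\<psi> n) x \<bullet> \<Theta> x))
        \<longlonglongrightarrow> (LINT x|lebesgue_on ?\<Omega>. f x \<bullet> pderiv3 3 \<Theta> x) + (LINT x|lebesgue_on ?\<Omega>. d x \<bullet> \<Theta> x)"
      by (intro tendsto_add L2_conv_inner \<psi> L\<Theta>)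
    moreover have "(\<lambda>n. (2 * c - 1) * (LINT y|lebesgue_on ?Q. \<psi> n (face3 c y) \<bullet> \<Theta> (face3 c y)))
        \<longlonglongrightarrow> (2 * c - 1) * (LINT y|lebesgue_on ?Q. g y \<bullet> \<Theta> (face3 c y))"
      by (intro tendsto_mult_left L2_conv_inner[OF \<psi>(4)] LQ)
    ultimately show "(LINT x|lebesgue_on ?\<Omega>. f x \<bullet> pderiv3 3 \<Theta> x) + (LINT x|lebesgue_on ?\<Omega>. d x \<bullet> \<Theta> x)
        = (2 * c - 1) * (LINT y|lebesgue_on ?Q. g y \<bullet> \<Theta> (face3 c y))"
      unfolding ibp by (rule LIMSEQ_unique)
  qed
qed

text \<open>The two traces come with two approximating sequences; weighting them by \<open>1 - \<xi>\<^sub>3\<close> and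
  \<open>\<xi>\<^sub>3\<close> gives one derivative for which integration by parts sees both faces.\<close>

lemma two_traces_integral_by_parts:
  fixes f :: "real^3 \<Rightarrow> 'b::euclidean_space"
  assumes "has_trace per_smooth (Ref_dom a b) {3} (face3_params a b) (face3 0) f g"
    and "has_trace per_smooth (Ref_dom a b) {3} (face3_params a b) (face3 1) f (\<lambda>y. 0)"
  obtains d where "L2 (Ref_dom a b) d"
    "\<And>\<Theta>. smooth_on UNIV \<Theta> \<Longrightarrow>
      (LINT x|lebesgue_on (Ref_dom a b). f x \<bullet> pderiv3 3 \<Theta> x) + (LINT x|lebesgue_on (Ref_dom a b). d x \<bullet> \<Theta> x)
        = - (LINT y|lebesgue_on (face3_params a b). g y \<bullet> \<Theta> (face3 0 y))"
proof -
  let ?\<Omega> = "Ref_dom a b" and ?Q = "face3_params a b"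
  obtain d0 where d0: "L2 ?\<Omega> d0"
    "\<And>\<Theta>. smooth_on UNIV \<Theta> \<Longrightarrow> (\<And>y. \<Theta> (face3 1 y) = 0) \<Longrightarrow>
      (LINT x|lebesgue_on ?\<Omega>. f x \<bullet> pderiv3 3 \<Theta> x) + (LINT x|lebesgue_on ?\<Omega>. d0 x \<bullet> \<Theta> x)
        = - (LINT y|lebesgue_on ?Q. g y \<bullet> \<Theta> (face3 0 y))"
    using has_trace_integral_by_parts[OF assms(1)] by auto
  obtain d1 where d1: "L2 ?\<Omega> d1"
    "\<And>\<Theta>. smooth_on UNIV \<Theta> \<Longrightarrow> (\<And>y. \<Theta> (face3 0 y) = 0) \<Longrightarrow>
      (LINT x|lebesgue_on ?\<Omega>. f x \<bullet> pderiv3 3 \<Theta> x) + (LINT x|lebesgue_on ?\<Omega>. d1 x \<bullet> \<Theta> x) = 0"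
    using has_trace_integral_by_parts[OF assms(2)] by auto
  have fL: "L2 ?\<Omega> f" using assms(1) by (auto simp: has_trace_def L2_conv_def)
  define d where "d = (\<lambda>x. (1 - x$3) *\<^sub>R d0 x + (x$3) *\<^sub>R d1 x)"
  have dL: "L2 ?\<Omega> (\<lambda>x. (1 - x$3) *\<^sub>R d0 x)" "L2 ?\<Omega> (\<lambda>x. (x$3) *\<^sub>R d1 x)"
    by (intro L2_continuous_mult d0 d1 continuous_intros)+
  show ?thesis
  proof (rule that)
    show "L2 ?\<Omega> d" unfolding d_def by (intro L2_add dL)
    fix \<Theta> :: "real^3 \<Rightarrow> 'b" assume \<Theta>: "smooth_on UNIV \<Theta>"
    have c\<Theta>: "continuous_on UNIV \<Theta>" "continuous_on UNIV (pderiv3 3 \<Theta>)"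
      using \<Theta> smooth_on_continuous_on smooth_on_pderiv3 by blast+
    let ?A = "\<lambda>x. (1 - x$3) *\<^sub>R \<Theta> x" and ?B = "\<lambda>x. (x$3) *\<^sub>R \<Theta> x"
    have s: "smooth_on UNIV ?A" "smooth_on UNIV ?B" by (intro smooth_intros \<Theta> open_UNIV)+
    have LAB: "L2 ?\<Omega> (pderiv3 3 ?A)" "L2 ?\<Omega> (pderiv3 3 ?B)"
      using s by (auto intro!: L2_continuous bounded_Ref_dom smooth_on_continuous_on smooth_on_pderiv3)
    have eq: "pderiv3 3 ?A x + pderiv3 3 ?B x = pderiv3 3 \<Theta> x" for x
      using dir_deriv_add[of ?A x ?B "axis 3 1"] s[THEN smooth_on_differentiable[of UNIV]]
      by (simp flip: scaleR_left.add)
    have "(LINT x|lebesgue_on ?\<Omega>. f x \<bullet> pderiv3 3 \<Theta> x) =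
        (LINT x|lebesgue_on ?\<Omega>. f x \<bullet> pderiv3 3 ?A x) + (LINT x|lebesgue_on ?\<Omega>. f x \<bullet> pderiv3 3 ?B x)"
      using fL LAB by (simp add: L2_inner_integrable inner_add_right flip: eq)
    moreover have "(LINT x|lebesgue_on ?\<Omega>. d x \<bullet> \<Theta> x) =
        (LINT x|lebesgue_on ?\<Omega>. d0 x \<bullet> ?A x) + (LINT x|lebesgue_on ?\<Omega>. d1 x \<bullet> ?B x)"
      using L2_continuous_integrable[OF dL(1) c\<Theta>(1)] L2_continuous_integrable[OF dL(2) c\<Theta>(1)]
      by (simp add: d_def inner_add_left)
    moreover have "(LINT x|lebesgue_on ?\<Omega>. f x \<bullet> pderiv3 3 ?A x) + (LINT x|lebesgue_on ?\<Omega>. d0 x \<bullet> ?A x)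
        = - (LINT y|lebesgue_on ?Q. g y \<bullet> \<Theta> (face3 0 y))"
      using d0(2)[OF s(1)] by (simp add: face3_def)
    moreover have "(LINT x|lebesgue_on ?\<Omega>. f x \<bullet> pderiv3 3 ?B x) + (LINT x|lebesgue_on ?\<Omega>. d1 x \<bullet> ?B x) = 0"
      by (rule d1(2)[OF s(2)]) (simp add: face3_def)
    ultimately show "(LINT x|lebesgue_on ?\<Omega>. f x \<bullet> pderiv3 3 \<Theta> x) + (LINT x|lebesgue_on ?\<Omega>. d x \<bullet> \<Theta> x)
        = - (LINT y|lebesgue_on ?Q. g y \<bullet> \<Theta> (face3 0 y))"
      by linarith
  qed
qed

section \<open>Cutting off at the faces \<open>\<xi>\<^sub>3 = 0, 1\<close>\<close>

text \<open>With t = n \<xi>_3 (1 - \<xi>_3), it is 0 for t <= 1 and 1 for t >= 2. The product of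
  the two distances treats both faces at once.\<close>

definition cutoff3 :: "nat \<Rightarrow> real^3 \<Rightarrow> real" where
  "cutoff3 n \<xi> = smooth_step (real n * (\<xi>$3 * (1 - \<xi>$3)) - 1)"

lemma cutoff3_per_smooth: "cutoff3 n \<in> per_smooth"
proof -
  have "smooth_on UNIV (\<lambda>\<xi>::real^3. smooth_step (real n * (\<xi>$3 * (1 - \<xi>$3)) - 1))"
    by (intro smooth_on_compose[OF _ _ _ _ smooth_on_smooth_step] smooth_intros open_UNIV) auto
  then show ?thesis
    by (simp add: per_smooth_def periodic2_def cutoff3_def[abs_def] axis_component)
qed

lemma smooth_on_cutoff3: "smooth_on UNIV (cutoff3 n)"
  using cutoff3_per_smooth by (simp add: per_smooth_def)

lemma cutoff3_limit:
  assumes "0 < \<xi>$3" "\<xi>$3 < 1"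
  shows "(\<lambda>n. cutoff3 n \<xi>) \<longlonglongrightarrow> 1"
  using smooth_step_scaled_limit[of "\<xi>$3 * (1 - \<xi>$3)"] assms by (simp add: cutoff3_def)

lemma cutoff3_bounds: "\<bar>cutoff3 n \<xi>\<bar> \<le> 1"
  using smooth_step_bounds by (simp add: cutoff3_def)

lemma pderiv3_cutoff3:
  assumes "(smooth_step has_real_derivative D) (at (real n * (\<xi>$3 * (1 - \<xi>$3)) - 1))"
  shows "pderiv3 i (cutoff3 n) \<xi> = (if i = 3 then D * (real n * (1 - 2 * \<xi>$3)) else 0)"
proof -
  let ?f = "\<lambda>\<xi>::real^3. real n * (\<xi>$3 * (1 - \<xi>$3)) - 1"
  have "(?f has_derivative (\<lambda>y. real n * (1 - 2 * \<xi>$3) * y$3)) (at \<xi>)"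
    by (rule derivative_eq_intros bounded_linear_imp_has_derivative[OF bounded_linear_vec_nth] refl
        | simp add: algebra_simps)+
  from has_derivative_dir_deriv[OF this]
  have "pderiv3 i ?f \<xi> = real n * (1 - 2 * \<xi>$3) * axis i 1 $ 3" .
  moreover have "?f differentiable (at \<xi>)"
    by (rule smooth_on_differentiable[of UNIV]) (auto intro!: smooth_intros)
  ultimately show ?thesis
    using dir_deriv_real_compose[of ?f \<xi> smooth_step D "axis i 1"] assms
    by (simp add: cutoff3_def[abs_def] axis_component)
qed

lemma pderiv3_cutoff3_eq_0: "i \<noteq> 3 \<Longrightarrow> pderiv3 i (cutoff3 n) \<xi> = 0"
  using smooth_step_deriv pderiv3_cutoff3 by metis

lemma pderiv3_cutoff3_limit:
  assumes "0 < \<xi>$3" "\<xi>$3 < 1"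
  shows "(\<lambda>n. pderiv3 3 (cutoff3 n) \<xi>) \<longlonglongrightarrow> 0"
proof -
  obtain s' where s': "\<And>x. (smooth_step has_real_derivative s' x) (at x)" "\<And>x. x < 0 \<or> x > 1 \<Longrightarrow> s' x = 0"
    using smooth_step_deriv by metis
  have "\<forall>\<^sub>F n in sequentially. real n * (\<xi>$3 * (1 - \<xi>$3)) > 2"
    using assms by (intro eventually_scaled_ge) simp
  then have "\<forall>\<^sub>F n in sequentially. pderiv3 3 (cutoff3 n) \<xi> = 0"
    by eventually_elim (simp add: pderiv3_cutoff3[OF s'(1)] s'(2))
  then show ?thesis by (rule tendsto_eventually)
qed

text \<open>The derivative is of size n, but it lives where n \<xi>_3 (1 - \<xi>_3) is at most 2.
  Weighted with the distance to the faces it is therefore bounded uniformly in n.\<close>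

lemma pderiv3_cutoff3_bound:
  obtains C where "\<And>n \<xi>. 0 < \<xi>$3 \<Longrightarrow> \<xi>$3 < 1 \<Longrightarrow> \<bar>pderiv3 3 (cutoff3 n) \<xi>\<bar> * (\<xi>$3 * (1 - \<xi>$3)) \<le> C"
proof -
  obtain s' C where s': "\<And>x. (smooth_step has_real_derivative s' x) (at x)" "\<And>x. \<bar>s' x\<bar> \<le> C"
      "\<And>x. x < 0 \<or> x > 1 \<Longrightarrow> s' x = 0"
    using smooth_step_deriv by metis
  have "\<bar>pderiv3 3 (cutoff3 n) \<xi>\<bar> * (\<xi>$3 * (1 - \<xi>$3)) \<le> C * 2" if "0 < \<xi>$3" "\<xi>$3 < 1" for n and \<xi> :: "real^3"
  proof -
    define t where "t = real n * (\<xi>$3 * (1 - \<xi>$3))"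
    have t: "t \<ge> 0" using that by (simp add: t_def)
    have "\<bar>pderiv3 3 (cutoff3 n) \<xi>\<bar> * (\<xi>$3 * (1 - \<xi>$3)) = \<bar>s' (t - 1)\<bar> * \<bar>1 - 2 * \<xi>$3\<bar> * t"
      by (simp add: pderiv3_cutoff3[OF s'(1)] abs_mult t_def)
    also have "\<dots> \<le> \<bar>s' (t - 1)\<bar> * 1 * t"
      using that t by (intro mult_right_mono mult_left_mono) auto
    \<comment> \<open>Either t > 2, where the step is already constant, or t <= 2 bounds the last
      factor.\<close>
    also have "\<dots> \<le> C * 2"
    proof (cases "t > 2")
      case True
      then show ?thesis using s'(3)[of "t - 1"] s'(2)[of 0] by simp
    next
      case False
      then show ?thesis using s'(2) t by (intro mult_mono) (auto intro: order_trans[OF abs_ge_zero s'(2)])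
    qed
    finally show ?thesis .
  qed
  then show ?thesis by (rule that)
qed

lemma cutoff3_mult_per_test:
  assumes "\<eta> \<in> lat.tests a b"
  shows "(\<lambda>\<xi>. cutoff3 n \<xi> * \<eta> \<xi>) \<in> per_test a b"
proof -
  have "(\<lambda>\<xi>. cutoff3 n \<xi> * \<eta> \<xi>) \<in> lat.tests a b"
    by (rule lat.tests_per_smooth_mult[OF cutoff3_per_smooth assms])
  moreover obtain \<delta> where \<delta>: "\<delta> > 0" "\<And>\<xi>. \<eta> \<xi> \<noteq> 0 \<Longrightarrow> \<xi> \<in> slab_core a b \<delta>"
    using assms by (auto simp: lat.tests_def)
  define \<delta>' where "\<delta>' = min \<delta> (1 / real (Suc n))"
  have "a + \<delta>' \<le> \<xi>$1 \<and> \<xi>$1 \<le> b - \<delta>' \<and> \<delta>' \<le> \<xi>$3 \<and> \<xi>$3 \<le> 1 - \<delta>'" if "cutoff3 n \<xi> * \<eta> \<xi> \<noteq> 0" for \<xi>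
  proof -
    \<comment> \<open>For any real x, x (1 - x) exceeds neither x nor 1 - x, so this single lower
      bound keeps \<xi> away from both faces.\<close>
    have *: "\<xi>$3 * (1 - \<xi>$3) > 1 / real (Suc n)"
      using that by (intro smooth_step_scaled_pos) (auto simp: cutoff3_def)
    moreover have "\<xi>$3 * (1 - \<xi>$3) = \<xi>$3 - (\<xi>$3)\<^sup>2" "\<xi>$3 * (1 - \<xi>$3) = (1 - \<xi>$3) - (1 - \<xi>$3)\<^sup>2"
      by (auto simp: power2_eq_square algebra_simps)
    ultimately have "\<xi>$3 > 1 / real (Suc n)" "1 - \<xi>$3 > 1 / real (Suc n)"
      using zero_le_power2[of "\<xi>$3"] zero_le_power2[of "1 - \<xi>$3"] by linarith+
    then show ?thesis using \<delta>(2)[of \<xi>] that by (auto simp: slab_core_def \<delta>'_def)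
  qed
  moreover have "\<delta>' > 0" using \<delta> by (simp add: \<delta>'_def)
  ultimately show ?thesis by (auto simp: lat.tests_def per_test_def)
qed

text \<open>On the bounded reference domain \<open>f\<close> is integrable, so a uniform bound for
  the \<open>gn\<close> already yields a majorant.\<close>

lemma dominated_convergence_L2:
  fixes f g :: "real^3 \<Rightarrow> real" and gn :: "nat \<Rightarrow> real^3 \<Rightarrow> real"
  assumes f: "L2 (Ref_dom a b) f" and g: "continuous_on UNIV g" "\<And>n. continuous_on UNIV (gn n)"
    and bound: "\<And>n \<xi>. \<xi> \<in> Ref_dom a b \<Longrightarrow> \<bar>gn n \<xi>\<bar> \<le> B"
    and lim: "\<And>\<xi>. \<xi> \<in> Ref_dom a b \<Longrightarrow> (\<lambda>n. gn n \<xi>) \<longlonglongrightarrow> g \<xi>"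
  shows "(\<lambda>n. LINT \<xi>|lebesgue_on (Ref_dom a b). f \<xi> * gn n \<xi>) \<longlonglongrightarrow> (LINT \<xi>|lebesgue_on (Ref_dom a b). f \<xi> * g \<xi>)"
proof (rule integral_dominated_convergence)
  have m: "f \<in> borel_measurable (lebesgue_on (Ref_dom a b))" by (rule L2_measurable[OF f])
  show "(\<lambda>\<xi>. f \<xi> * g \<xi>) \<in> borel_measurable (lebesgue_on (Ref_dom a b))"
    "(\<lambda>\<xi>. f \<xi> * gn n \<xi>) \<in> borel_measurable (lebesgue_on (Ref_dom a b))" for n
    by (intro borel_measurable_times m continuous_borel_measurable_lebesgue_on g)+
  show "integrable (lebesgue_on (Ref_dom a b)) (\<lambda>\<xi>. \<bar>f \<xi> * B\<bar>)"
    using L2_continuous_integrable[OF f continuous_on_const[of UNIV B]] by simp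
  show "AE \<xi> in lebesgue_on (Ref_dom a b). (\<lambda>n. f \<xi> * gn n \<xi>) \<longlonglongrightarrow> f \<xi> * g \<xi>"
    by (intro AE_I2 tendsto_mult_left lim) simp
  show "AE \<xi> in lebesgue_on (Ref_dom a b). norm (f \<xi> * gn n \<xi>) \<le> \<bar>f \<xi> * B\<bar>" for n
    by (intro AE_I2) (auto simp: abs_mult intro!: mult_left_mono order_trans[OF bound abs_ge_self])
qed

lemma cutoff3_mult_limit:
  assumes "L2 (Ref_dom a b) f" "continuous_on UNIV g"
  shows "(\<lambda>n. LINT \<xi>|lebesgue_on (Ref_dom a b). f \<xi> * (cutoff3 n \<xi> * g \<xi>))
    \<longlonglongrightarrow> (LINT \<xi>|lebesgue_on (Ref_dom a b). f \<xi> * g \<xi>)"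
proof -
  obtain B where B: "\<And>\<xi>. \<xi> \<in> Ref_dom a b \<Longrightarrow> norm (g \<xi>) \<le> B"
    using continuous_bounded_on[OF assms(2) bounded_Ref_dom] by blast
  show ?thesis
  proof (rule dominated_convergence_L2[OF assms])
    show "continuous_on UNIV (\<lambda>\<xi>. cutoff3 n \<xi> * g \<xi>)" for n
      by (intro continuous_intros assms smooth_on_continuous_on smooth_on_cutoff3)
    show "\<bar>cutoff3 n \<xi> * g \<xi>\<bar> \<le> B" if "\<xi> \<in> Ref_dom a b" for n \<xi>
      using mult_mono[OF cutoff3_bounds[of n \<xi>] B[OF that]] by (simp add: abs_mult)
    show "(\<lambda>n. cutoff3 n \<xi> * g \<xi>) \<longlonglongrightarrow> g \<xi>" if "\<xi> \<in> Ref_dom a b" for \<xi>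
      using tendsto_mult_right[OF cutoff3_limit, of \<xi> "g \<xi>"] that by (simp add: Ref_dom_def)
  qed
qed

text \<open>The mean value theorem, applied from each face, bounds Z by its \<xi>_3-derivative times
  the distance to that face.\<close>

lemma bound_by_distance_to_faces:
  fixes Z :: "real^3 \<Rightarrow> real"
  assumes Z: "smooth_on UNIV Z" and zero: "\<And>\<xi>. \<xi>$3 = 0 \<or> \<xi>$3 = 1 \<Longrightarrow> Z \<xi> = 0"
  obtains L where "\<And>\<xi>. \<xi> \<in> Ref_dom a b \<Longrightarrow> \<bar>Z \<xi>\<bar> \<le> L * (\<xi>$3 * (1 - \<xi>$3))"
proof -
  have "continuous_on UNIV (pderiv3 3 Z)" using Z by (intro smooth_on_continuous_on smooth_on_pderiv3)
  then obtain B where B: "B > 0" "\<And>\<xi>. \<xi> \<in> Ref_dom a b \<Longrightarrow> norm (pderiv3 3 Z \<xi>) \<le> B"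
    using continuous_bounded_on bounded_Ref_dom by blast
  have "\<bar>Z \<xi>\<bar> \<le> 2 * B * (\<xi>$3 * (1 - \<xi>$3))" if \<xi>: "\<xi> \<in> Ref_dom a b" for \<xi>
  proof -
    define \<phi> where "\<phi> = (\<lambda>t. Z (face3 t (\<xi>$1, \<xi>$2)))"
    have der: "(\<phi> has_real_derivative pderiv3 3 Z (face3 t (\<xi>$1, \<xi>$2))) (at t)" for t
      using has_vector_derivative_line[of Z "face3 0 (\<xi>$1, \<xi>$2)" t "axis 3 1"] smooth_on_differentiable[OF Z]
      unfolding face3_line[symmetric] has_real_derivative_iff_has_vector_derivative \<phi>_def by simp
    have bd: "\<bar>pderiv3 3 Z (face3 t (\<xi>$1, \<xi>$2))\<bar> \<le> B" if "0 < t" "t < 1" for t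
      using B(2)[of "face3 t (\<xi>$1, \<xi>$2)"] \<xi> that by (simp add: Ref_dom_def face3_def)
    have t: "0 < \<xi>$3" "\<xi>$3 < 1" using \<xi> by (auto simp: Ref_dom_def)
    have \<phi>: "\<phi> 0 = 0" "\<phi> 1 = 0" "\<phi> (\<xi>$3) = Z \<xi>"
    proof -
      show "\<phi> 0 = 0" "\<phi> 1 = 0" by (auto simp: \<phi>_def zero face3_def)
      have "face3 (\<xi>$3) (\<xi>$1, \<xi>$2) = \<xi>" by (simp add: face3_def vec_eq_iff forall_3)
      then show "\<phi> (\<xi>$3) = Z \<xi>" by (simp add: \<phi>_def)
    qed
    obtain z where z: "0 < z" "z < \<xi>$3" "\<phi> (\<xi>$3) - \<phi> 0 = (\<xi>$3 - 0) * pderiv3 3 Z (face3 z (\<xi>$1, \<xi>$2))"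
      using MVT2[OF t(1) der] by blast
    obtain w where w: "\<xi>$3 < w" "w < 1" "\<phi> 1 - \<phi> (\<xi>$3) = (1 - \<xi>$3) * pderiv3 3 Z (face3 w (\<xi>$1, \<xi>$2))"
      using MVT2[OF t(2) der] by blast
    have "\<bar>Z \<xi>\<bar> \<le> \<xi>$3 * B"
      using z \<phi> t bd[of z] by (simp add: abs_mult)
    moreover have "\<bar>Z \<xi>\<bar> = (1 - \<xi>$3) * \<bar>pderiv3 3 Z (face3 w (\<xi>$1, \<xi>$2))\<bar>"
    proof -
      have "\<bar>Z \<xi>\<bar> = \<bar>(1 - \<xi>$3) * pderiv3 3 Z (face3 w (\<xi>$1, \<xi>$2))\<bar>"
        using w(3) \<phi> by simp
      then show ?thesis using t by (simp add: abs_mult)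
    qed
    then have "\<bar>Z \<xi>\<bar> \<le> (1 - \<xi>$3) * B"
      using w t bd[of w] by (simp add: mult_left_mono)
    \<comment> \<open>Averaging the two bounds with weights 1 - \<xi>_3 and \<xi>_3 turns distances
      to single faces into their product, at the price of the factor 2.\<close>
    ultimately have "(1 - \<xi>$3) * \<bar>Z \<xi>\<bar> + \<xi>$3 * \<bar>Z \<xi>\<bar> \<le> (1 - \<xi>$3) * (\<xi>$3 * B) + \<xi>$3 * ((1 - \<xi>$3) * B)"
      using t by (intro add_mono mult_left_mono) auto
    then show ?thesis by (simp add: algebra_simps)
  qed
  then show ?thesis by (rule that)
qed

text \<open>In the product rule the term with the derivative of the cutoff stays bounded, since Z is
  at most a multiple of the distance to the faces, and it tends to 0 at each interior point. This is
  where vanishing on the faces replaces vanishing near them.\<close>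

lemma cutoff3_pderiv3_limit:
  assumes f: "L2 (Ref_dom a b) f" and Z: "smooth_on UNIV Z" and zero: "\<And>\<xi>. \<xi>$3 = 0 \<or> \<xi>$3 = 1 \<Longrightarrow> Z \<xi> = 0"
  shows "(\<lambda>n. LINT \<xi>|lebesgue_on (Ref_dom a b). f \<xi> * pderiv3 3 (\<lambda>\<xi>. cutoff3 n \<xi> * Z \<xi>) \<xi>)
    \<longlonglongrightarrow> (LINT \<xi>|lebesgue_on (Ref_dom a b). f \<xi> * pderiv3 3 Z \<xi>)"
proof -
  have cZ: "continuous_on UNIV (pderiv3 3 Z)" using Z by (intro smooth_on_continuous_on smooth_on_pderiv3)
  obtain B where B: "\<And>\<xi>. \<xi> \<in> Ref_dom a b \<Longrightarrow> norm (pderiv3 3 Z \<xi>) \<le> B"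
    using continuous_bounded_on[OF cZ bounded_Ref_dom] by blast
  obtain L where L: "\<And>\<xi>. \<xi> \<in> Ref_dom a b \<Longrightarrow> \<bar>Z \<xi>\<bar> \<le> L * (\<xi>$3 * (1 - \<xi>$3))"
    using bound_by_distance_to_faces[OF Z zero] by blast
  obtain C where C: "\<And>n \<xi>. 0 < \<xi>$3 \<Longrightarrow> \<xi>$3 < 1 \<Longrightarrow> \<bar>pderiv3 3 (cutoff3 n) \<xi>\<bar> * (\<xi>$3 * (1 - \<xi>$3)) \<le> C"
    using pderiv3_cutoff3_bound by blast
  have eq: "pderiv3 3 (\<lambda>\<xi>. cutoff3 n \<xi> * Z \<xi>) \<xi> = cutoff3 n \<xi> * pderiv3 3 Z \<xi> + pderiv3 3 (cutoff3 n) \<xi> * Z \<xi>" for n \<xi>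
    using Z smooth_on_cutoff3 smooth_on_differentiable by (intro dir_deriv_mult) blast+
  show ?thesis
  proof (rule dominated_convergence_L2[OF f cZ])
    show "continuous_on UNIV (pderiv3 3 (\<lambda>\<xi>. cutoff3 n \<xi> * Z \<xi>))" for n
      by (intro smooth_on_continuous_on smooth_on_pderiv3 smooth_on_mult smooth_on_cutoff3 Z open_UNIV)
    fix \<xi> assume \<xi>: "\<xi> \<in> Ref_dom a b"
    then have t: "0 < \<xi>$3" "\<xi>$3 < 1" by (auto simp: Ref_dom_def)
    have "\<bar>pderiv3 3 (cutoff3 n) \<xi> * Z \<xi>\<bar> \<le> \<bar>L\<bar> * C" for n
    proof -
      have "\<bar>pderiv3 3 (cutoff3 n) \<xi> * Z \<xi>\<bar> \<le> \<bar>pderiv3 3 (cutoff3 n) \<xi>\<bar> * (\<bar>L\<bar> * (\<xi>$3 * (1 - \<xi>$3)))"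
        using L[OF \<xi>] t unfolding abs_mult
        by (intro mult_left_mono order_trans[OF L[OF \<xi>]] mult_right_mono) auto
      also have "\<dots> = \<bar>L\<bar> * (\<bar>pderiv3 3 (cutoff3 n) \<xi>\<bar> * (\<xi>$3 * (1 - \<xi>$3)))" by simp
      also have "\<dots> \<le> \<bar>L\<bar> * C" by (intro mult_left_mono C t) simp
      finally show ?thesis .
    qed
    moreover have "\<bar>cutoff3 n \<xi> * pderiv3 3 Z \<xi>\<bar> \<le> B" for n
      using mult_mono[OF cutoff3_bounds[of n \<xi>] B[OF \<xi>]] by (simp add: abs_mult)
    ultimately show "\<bar>pderiv3 3 (\<lambda>\<xi>. cutoff3 n \<xi> * Z \<xi>) \<xi>\<bar> \<le> B + \<bar>L\<bar> * C" for n
      unfolding eq by (meson abs_triangle_ineq add_mono order_trans)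
    have "(\<lambda>n. cutoff3 n \<xi> * pderiv3 3 Z \<xi> + pderiv3 3 (cutoff3 n) \<xi> * Z \<xi>) \<longlonglongrightarrow> 1 * pderiv3 3 Z \<xi> + 0 * Z \<xi>"
      by (intro tendsto_intros cutoff3_limit pderiv3_cutoff3_limit t)
    then show "(\<lambda>n. pderiv3 3 (\<lambda>\<xi>. cutoff3 n \<xi> * Z \<xi>) \<xi>) \<longlonglongrightarrow> pderiv3 3 Z \<xi>"
      by (simp add: eq)
  qed
qed


section \<open>The one-dimensional boundary value problem across the layer\<close>

text \<open>\<open>shrink3 0 \<xi> + axis 3 1\<close> is the projection to the upper face: the
  values of \<open>f\<close> there are continued constantly in \<xi>_3.\<close>

lemma top_smooth: "smooth_on UNIV f \<Longrightarrow> smooth_on UNIV (\<lambda>\<xi>. f (shrink3 0 \<xi> + axis 3 1))"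
proof (rule smooth_on_compose[where T = UNIV and g = f])
  have "bounded_linear (shrink3 0)"
    by (intro linear_conv_bounded_linear[THEN iffD1] linearI)
      (auto simp: vec_eq_iff shrink3_nth algebra_simps)
  then show "smooth_on UNIV (\<lambda>\<xi>. shrink3 0 \<xi> + axis 3 1)"
    by (intro smooth_on_add smooth_on_const smooth_on_bounded_linear open_UNIV)
qed auto

text \<open>The double primitive q vanishes for \<xi>_3 = 0. Subtracting \<xi>_3 times its value on
  the upper face makes it vanish there as well, and this correction is affine in \<xi>_3, hence
  invisible to the second derivative.\<close>

lemma dirichlet_primitive:
  assumes \<zeta>: "\<zeta> \<in> lat.tests a b"
  obtains \<eta> where "\<eta> \<in> lat.tests a b" "\<And>\<xi>. pderiv3 3 (pderiv3 3 \<eta>) \<xi> = \<zeta> \<xi>"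
    "\<And>\<xi>. \<xi>$3 = 0 \<or> \<xi>$3 = 1 \<Longrightarrow> \<eta> \<xi> = 0"
proof -
  define q where "q = primitive3 (primitive3 \<zeta>)"
  define e where "e = (\<lambda>\<xi>. q (shrink3 0 \<xi> + axis 3 1))"
  define \<eta> where "\<eta> = (\<lambda>\<xi>. q \<xi> - \<xi>$3 * e \<xi>)"
  have q: "q \<in> lat.tests a b" unfolding q_def by (intro primitive3_lat_tests \<zeta>)
  have se: "smooth_on UNIV e" unfolding e_def by (rule top_smooth[OF lat.tests_smooth[OF q]])
  obtain \<delta> where \<delta>: "\<delta> > 0" "\<And>\<xi>. q \<xi> \<noteq> 0 \<Longrightarrow> \<xi> \<in> slab_core a b \<delta>"
    using q by (auto simp: lat.tests_def)
  have shift: "shrink3 0 (\<xi> + axis 2 (2 * pi)) + axis 3 1 = (shrink3 0 \<xi> + axis 3 1) + axis 2 (2 * pi)" for \<xi>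
    by (simp add: vec_eq_iff shrink3_nth axis_component)
  have "e (\<xi> + axis 2 (2 * pi)) = e \<xi>" for \<xi>
    unfolding e_def shift by (rule lat.tests_periodic[OF q])
  moreover have "\<xi> \<in> slab_core a b \<delta>" if "e \<xi> \<noteq> 0" for \<xi>
    using \<delta>(2)[of "shrink3 0 \<xi> + axis 3 1"] that by (auto simp: e_def slab_core_def shrink3_nth axis_component)
  ultimately have e: "e \<in> lat.tests a b"
    using se \<delta>(1) by (auto simp: lat.tests_def per_smooth_def periodic2_def)
  have "(\<lambda>\<xi>. \<xi>$3) \<in> per_smooth"
    by (simp add: per_smooth_def periodic2_def smooth_on_coord axis_component)
  then have \<eta>: "\<eta> \<in> lat.tests a b"
    unfolding \<eta>_def by (intro lat.tests_diff lat.tests_per_smooth_mult q e)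
  note D = lat.tests_differentiable
  have sz: "smooth_on UNIV \<zeta>" by (rule lat.tests_smooth[OF \<zeta>])
  have e3: "pderiv3 3 e \<xi> = 0" for \<xi>
  proof -
    have "shrink3 0 (\<xi> + t *\<^sub>R axis 3 1) = shrink3 0 \<xi>" for t
      by (simp add: vec_eq_iff shrink3_nth axis_component)
    then show ?thesis by (simp add: dir_deriv_def e_def)
  qed
  have c3: "(\<lambda>\<xi>::real^3. \<xi>$3) differentiable (at \<xi>)" for \<xi>
    by (rule smooth_on_differentiable[of UNIV]) (auto intro: smooth_on_coord)
  have "pderiv3 3 \<eta> \<xi> = primitive3 \<zeta> \<xi> - e \<xi>" for \<xi>
  proof -
    have "pderiv3 3 \<eta> \<xi> = pderiv3 3 q \<xi> - pderiv3 3 (\<lambda>\<xi>. \<xi>$3 * e \<xi>) \<xi>"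
      unfolding \<eta>_def using D[OF q] D[OF e] c3
      by (intro dir_deriv_diff differentiable_mult) auto
    also have "pderiv3 3 (\<lambda>\<xi>. \<xi>$3 * e \<xi>) \<xi> = e \<xi>"
      using dir_deriv_mult[OF c3 D[OF e]] by (simp add: e3 dir_deriv_coord axis_component)
    finally show ?thesis by (simp add: q_def pderiv3_primitive3(1) smooth_on_primitive3[OF sz])
  qed
  then have "pderiv3 3 \<eta> = (\<lambda>\<xi>. primitive3 \<zeta> \<xi> - e \<xi>)" by blast
  then have "pderiv3 3 (pderiv3 3 \<eta>) \<xi> = \<zeta> \<xi>" for \<xi>
    using dir_deriv_diff[of "primitive3 \<zeta>" \<xi> e "axis 3 1"] D[OF e] D[OF primitive3_lat_tests[OF \<zeta>]]
    by (simp add: e3 pderiv3_primitive3(1)[OF sz])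
  moreover have "\<eta> \<xi> = 0" if "\<xi>$3 = 0 \<or> \<xi>$3 = 1" for \<xi>
    using that
  proof
    assume "\<xi>$3 = 0" then show ?thesis by (simp add: \<eta>_def q_def primitive3_at_0)
  next
    assume *: "\<xi>$3 = 1"
    then have "shrink3 0 \<xi> + axis 3 1 = \<xi>" by (simp add: vec_eq_iff shrink3_nth axis_component)
    then show ?thesis using * by (simp add: \<eta>_def e_def)
  qed
  ultimately show ?thesis using that \<eta> by blast
qed

text \<open>Distributionally \<open>\<partial>\<^sub>3\<^sup>2 v = c \<beta> \<partial>\<^sub>i p\<close> with \<open>p\<close> independent of \<open>\<xi>\<^sub>3\<close> and \<open>v = 0\<close> at \<open>\<xi>\<^sub>3 = 0, 1\<close>
  (the latter encoded in the integration by parts with test functions that do not vanish there);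
  hence \<open>v = c \<beta> \<partial>\<^sub>i p \<xi>\<^sub>3 (\<xi>\<^sub>3 - 1) / 2\<close>. The test function \<open>\<eta> - M \<zeta>\<close> below, where \<open>M = \<xi>\<^sub>3 (\<xi>\<^sub>3 - 1) / 2\<close>,
  has vanishing \<open>\<xi>\<^sub>3\<close>-integrals by Green's formula.\<close>

lemma parabolic_profile:
  fixes v d p \<beta> :: "real^3 \<Rightarrow> real"
  assumes L: "L2 (Ref_dom a b) v" "L2 (Ref_dom a b) d" "L2 (Ref_dom a b) p"
    and ibp: "\<And>\<eta>. smooth_on UNIV \<eta> \<Longrightarrow>
      (LINT \<xi>|lebesgue_on (Ref_dom a b). v \<xi> * pderiv3 3 \<eta> \<xi>) = - (LINT \<xi>|lebesgue_on (Ref_dom a b). d \<xi> * \<eta> \<xi>)"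
    and eq: "\<And>\<eta>. \<eta> \<in> per_test a b \<Longrightarrow>
      (LINT \<xi>|lebesgue_on (Ref_dom a b). v \<xi> * pderiv3 3 (pderiv3 3 \<eta>) \<xi>)
        = c * (LINT \<xi>|lebesgue_on (Ref_dom a b). p \<xi> * pderiv3 i (\<lambda>\<xi>. \<beta> \<xi> * \<eta> \<xi>) \<xi>)"
    and p3: "\<And>\<eta>. \<eta> \<in> per_test a b \<Longrightarrow> (LINT \<xi>|lebesgue_on (Ref_dom a b). p \<xi> * pderiv3 3 \<eta> \<xi>) = 0"
    and \<beta>: "\<beta> \<in> periodic_coeff (slab a b)" "\<And>s \<xi>. \<beta> (shrink3 s \<xi>) = \<beta> \<xi>" and "i \<noteq> 3"
    and \<zeta>: "\<zeta> \<in> lat.tests a b"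
  shows "(LINT \<xi>|lebesgue_on (Ref_dom a b). v \<xi> * \<zeta> \<xi>)
    = c * (LINT \<xi>|lebesgue_on (Ref_dom a b). p \<xi> * pderiv3 i (\<lambda>\<xi>. \<beta> \<xi> * (\<xi>$3 * (\<xi>$3 - 1) / 2 * \<zeta> \<xi>)) \<xi>)"
proof -
  let ?I = "\<lambda>f. LINT \<xi>|lebesgue_on (Ref_dom a b). f \<xi>"
  note D = lat.tests_differentiable
  obtain \<eta> where \<eta>: "\<eta> \<in> lat.tests a b" "\<And>\<xi>. pderiv3 3 (pderiv3 3 \<eta>) \<xi> = \<zeta> \<xi>"
    "\<And>\<xi>. \<xi>$3 = 0 \<or> \<xi>$3 = 1 \<Longrightarrow> \<eta> \<xi> = 0"
    using dirichlet_primitive[OF \<zeta>] by blast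
  have s\<eta>: "smooth_on UNIV \<eta>" by (rule lat.tests_smooth[OF \<eta>(1)])
  have \<beta>\<eta>: "(\<lambda>\<xi>. \<beta> \<xi> * \<eta> \<xi>) \<in> lat.tests a b" by (rule lat.tests_coeff_mult[OF \<beta>(1) \<eta>(1)])
  have cont: "continuous_on UNIV (pderiv3 j f)" if "f \<in> lat.tests a b" for f j
    by (intro smooth_on_continuous_on smooth_on_pderiv3 lat.tests_smooth[OF that])
  let ?k = "\<lambda>n \<xi>. cutoff3 n \<xi> * \<eta> \<xi>"
  \<comment> \<open>\<open>ibp\<close> is applied to the derivative of \<eta>, which need not vanish
    on the faces: the zero boundary values of v are used here.\<close>
  have "?I (\<lambda>\<xi>. v \<xi> * \<zeta> \<xi>) = - ?I (\<lambda>\<xi>. d \<xi> * pderiv3 3 \<eta> \<xi>)"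
    using ibp[OF smooth_on_pderiv3[OF s\<eta>, of 3]] by (simp add: \<eta>(2))
  also have "\<dots> = c * ?I (\<lambda>\<xi>. p \<xi> * pderiv3 i (\<lambda>\<xi>. \<beta> \<xi> * \<eta> \<xi>) \<xi>)"
  \<comment> \<open>\<open>eq\<close> needs support away from the faces, so \<eta> is cut off. With
    \<open>d\<close> in place of v only one derivative falls on the cutoff; in the pressure term the
    cutoff commutes with \<partial>_i because i is not 3.\<close>
  proof (rule LIMSEQ_unique)
    show "(\<lambda>n. - ?I (\<lambda>\<xi>. d \<xi> * pderiv3 3 (?k n) \<xi>)) \<longlonglongrightarrow> - ?I (\<lambda>\<xi>. d \<xi> * pderiv3 3 \<eta> \<xi>)"
      by (intro tendsto_minus cutoff3_pderiv3_limit L s\<eta> \<eta>(3))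
    have "- ?I (\<lambda>\<xi>. d \<xi> * pderiv3 3 (?k n) \<xi>) = c * ?I (\<lambda>\<xi>. p \<xi> * (cutoff3 n \<xi> * pderiv3 i (\<lambda>\<xi>. \<beta> \<xi> * \<eta> \<xi>) \<xi>))" for n
    proof -
      have k: "?k n \<in> per_test a b" by (rule cutoff3_mult_per_test[OF \<eta>(1)])
      have "pderiv3 i (\<lambda>\<xi>. \<beta> \<xi> * ?k n \<xi>) \<xi> = cutoff3 n \<xi> * pderiv3 i (\<lambda>\<xi>. \<beta> \<xi> * \<eta> \<xi>) \<xi>" for \<xi>
        using dir_deriv_mult[OF smooth_on_differentiable[OF smooth_on_cutoff3[of n] UNIV_I] D[OF \<beta>\<eta>], of "axis i 1"]
        by (simp add: pderiv3_cutoff3_eq_0[OF \<open>i \<noteq> 3\<close>] mult.left_commute)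
      moreover have "smooth_on UNIV (pderiv3 3 (?k n))"
        using k by (intro smooth_on_pderiv3) (auto simp: per_test_def per_smooth_def)
      ultimately show ?thesis using ibp[of "pderiv3 3 (?k n)"] eq[OF k] by simp
    qed
    then show "(\<lambda>n. - ?I (\<lambda>\<xi>. d \<xi> * pderiv3 3 (?k n) \<xi>)) \<longlonglongrightarrow> c * ?I (\<lambda>\<xi>. p \<xi> * pderiv3 i (\<lambda>\<xi>. \<beta> \<xi> * \<eta> \<xi>) \<xi>)"
      using tendsto_mult_left[OF cutoff3_mult_limit[OF L(3) cont[OF \<beta>\<eta>]]] by simp
  qed
  also have "?I (\<lambda>\<xi>. p \<xi> * pderiv3 i (\<lambda>\<xi>. \<beta> \<xi> * \<eta> \<xi>) \<xi>) =
      ?I (\<lambda>\<xi>. p \<xi> * pderiv3 i (\<lambda>\<xi>. \<beta> \<xi> * (\<xi>$3 * (\<xi>$3 - 1) / 2 * \<zeta> \<xi>)) \<xi>)"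
  proof -
    let ?M = "\<lambda>\<xi>::real^3. \<xi>$3 * (\<xi>$3 - 1) / 2"
    have M: "?M \<in> per_smooth"
      by (auto simp: per_smooth_def periodic2_def axis_component intro!: smooth_intros)
    have dM: "?M differentiable (at \<xi>)" and M3: "pderiv3 3 ?M \<xi> = \<xi>$3 - 1 / 2" for \<xi>
    proof -
      have D: "(?M has_derivative (\<lambda>y. (\<xi>$3 - 1 / 2) * y$3)) (at \<xi>)"
        by (rule derivative_eq_intros bounded_linear_imp_has_derivative[OF bounded_linear_vec_nth] refl
            | simp add: field_simps)+
      show "?M differentiable (at \<xi>)" using D by (auto simp: differentiable_def)
      show "pderiv3 3 ?M \<xi> = \<xi>$3 - 1 / 2" by (simp add: has_derivative_dir_deriv[OF D] axis_component)
    qed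
    have M\<zeta>: "(\<lambda>\<xi>. ?M \<xi> * \<zeta> \<xi>) \<in> lat.tests a b" by (rule lat.tests_per_smooth_mult[OF M \<zeta>])
    define \<omega> where "\<omega> = (\<lambda>\<xi>. \<eta> \<xi> - ?M \<xi> * \<zeta> \<xi>)"
    have \<omega>: "\<omega> \<in> lat.tests a b" unfolding \<omega>_def by (intro lat.tests_diff \<eta> M\<zeta>)
    \<comment> \<open>Q = M' \<eta> - M \<eta>' with derivatives in \<xi>_3. Since M'' = 1 and
      \<eta>'' = \<zeta>, it is an antiderivative of \<omega>, and it vanishes on both faces
      together with \<eta> and M.\<close>
    define Q where "Q = (\<lambda>\<xi>. (\<xi>$3 - 1 / 2) * \<eta> \<xi> - ?M \<xi> * pderiv3 3 \<eta> \<xi>)"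
    have c3: "((\<lambda>\<xi>::real^3. \<xi>$3 - 1 / 2) has_derivative (\<lambda>y. y$3)) (at \<xi>)" for \<xi>
      by (rule derivative_eq_intros bounded_linear_imp_has_derivative[OF bounded_linear_vec_nth] refl | simp)+
    have d3: "(\<lambda>\<xi>::real^3. \<xi>$3 - 1 / 2) differentiable (at \<xi>)" for \<xi> using c3 by (auto simp: differentiable_def)
    have "pderiv3 3 Q \<xi> = \<omega> \<xi>" for \<xi>
    proof -
      have "pderiv3 3 Q \<xi> = pderiv3 3 (\<lambda>\<xi>. (\<xi>$3 - 1 / 2) * \<eta> \<xi>) \<xi> - pderiv3 3 (\<lambda>\<xi>. ?M \<xi> * pderiv3 3 \<eta> \<xi>) \<xi>"
        unfolding Q_def by (intro dir_deriv_diff differentiable_mult dM d3 D[OF \<eta>(1)] D[OF lat.tests_pderiv3[OF \<eta>(1)]])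
      also have "pderiv3 3 (\<lambda>\<xi>. (\<xi>$3 - 1 / 2) * \<eta> \<xi>) \<xi> = (\<xi>$3 - 1 / 2) * pderiv3 3 \<eta> \<xi> + \<eta> \<xi>"
        using dir_deriv_mult[OF d3 D[OF \<eta>(1)]] has_derivative_dir_deriv[OF c3] by (simp add: axis_component)
      also have "pderiv3 3 (\<lambda>\<xi>. ?M \<xi> * pderiv3 3 \<eta> \<xi>) \<xi> = ?M \<xi> * \<zeta> \<xi> + (\<xi>$3 - 1 / 2) * pderiv3 3 \<eta> \<xi>"
        using dir_deriv_mult[OF dM D[OF lat.tests_pderiv3[OF \<eta>(1)]]] by (simp add: M3 \<eta>(2))
      finally show ?thesis by (simp add: \<omega>_def)
    qed
    moreover have "smooth_on UNIV Q"
      unfolding Q_def using M by (intro smooth_intros smooth_on_pderiv3 s\<eta> open_UNIV) auto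
    ultimately have prim: "primitive3 \<omega> \<xi> = Q \<xi> - Q (shrink3 0 \<xi>)" for \<xi>
      by (intro primitive3_unique)
    have prim0: "primitive3 \<omega> \<xi> = 0" if "\<xi>$3 = 0 \<or> \<xi>$3 = 1" for \<xi>
      using that \<eta>(3)[of \<xi>] \<eta>(3)[of "shrink3 0 \<xi>"] by (auto simp: prim Q_def shrink3_nth)
    \<comment> \<open>\<open>\<beta>\<close> is independent of \<xi>_3 and leaves the primitive, so
      N vanishes on both faces like the primitive of \<omega>. Its derivative Z in direction i does
      so too, and \<partial>_3 Z is the function to be paired with the pressure.\<close>
    define N where "N = primitive3 (\<lambda>\<xi>. \<beta> \<xi> * \<omega> \<xi>)"
    have \<beta>\<omega>: "(\<lambda>\<xi>. \<beta> \<xi> * \<omega> \<xi>) \<in> lat.tests a b" by (rule lat.tests_coeff_mult[OF \<beta>(1) \<omega>])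
    have "N \<xi> = \<beta> \<xi> * primitive3 \<omega> \<xi>" for \<xi>
      by (simp add: N_def primitive3_def moment3_def \<beta>(2))
    then have N0: "N \<xi> = 0" if "\<xi>$3 = 0 \<or> \<xi>$3 = 1" for \<xi>
      using prim0[OF that] by simp
    have N: "N \<in> lat.tests a b" unfolding N_def by (rule primitive3_lat_tests[OF \<beta>\<omega>])
    define Z where "Z = pderiv3 i N"
    have Z: "Z \<in> lat.tests a b" unfolding Z_def by (rule lat.tests_pderiv3[OF N])
    have Z0: "Z \<xi> = 0" if "\<xi>$3 = 0 \<or> \<xi>$3 = 1" for \<xi>
    proof -
      have "N (\<xi> + t *\<^sub>R axis i 1) = 0" for t
        using that \<open>i \<noteq> 3\<close> by (intro N0) (auto simp: axis_component)
      then show ?thesis by (simp add: Z_def dir_deriv_def)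
    qed
    have "Z = primitive3 (pderiv3 i (\<lambda>\<xi>. \<beta> \<xi> * \<omega> \<xi>))"
      unfolding Z_def N_def using pderiv3_primitive3(2)[OF lat.tests_smooth[OF \<beta>\<omega>] \<open>i \<noteq> 3\<close>] by blast
    then have Z3: "pderiv3 3 Z \<xi> = pderiv3 i (\<lambda>\<xi>. \<beta> \<xi> * \<omega> \<xi>) \<xi>" for \<xi>
      by (simp add: pderiv3_primitive3(1) smooth_on_pderiv3 lat.tests_smooth[OF \<beta>\<omega>])
    \<comment> \<open>Z vanishes on the faces but perhaps not near them; \<open>p3\<close> is
      therefore used for its cutoffs, followed by the limit.\<close>
    have "?I (\<lambda>\<xi>. p \<xi> * pderiv3 3 (\<lambda>\<xi>. cutoff3 n \<xi> * Z \<xi>) \<xi>) = 0" for n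
      by (rule p3[OF cutoff3_mult_per_test[OF Z]])
    then have "?I (\<lambda>\<xi>. p \<xi> * pderiv3 3 Z \<xi>) = 0"
      using cutoff3_pderiv3_limit[OF L(3) lat.tests_smooth[OF Z] Z0] by (simp add: LIMSEQ_const_iff)
    moreover have \<beta>M: "(\<lambda>\<xi>. \<beta> \<xi> * (?M \<xi> * \<zeta> \<xi>)) \<in> lat.tests a b" by (rule lat.tests_coeff_mult[OF \<beta>(1) M\<zeta>])
    moreover have "pderiv3 i (\<lambda>\<xi>. \<beta> \<xi> * \<omega> \<xi>) \<xi> = pderiv3 i (\<lambda>\<xi>. \<beta> \<xi> * \<eta> \<xi>) \<xi> - pderiv3 i (\<lambda>\<xi>. \<beta> \<xi> * (?M \<xi> * \<zeta> \<xi>)) \<xi>" for \<xi>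
      using dir_deriv_diff[OF D[OF \<beta>\<eta>] D[OF \<beta>M]] by (simp add: \<omega>_def right_diff_distrib)
    moreover have "integrable (lebesgue_on (Ref_dom a b)) (\<lambda>\<xi>. p \<xi> * pderiv3 i f \<xi>)" if "f \<in> lat.tests a b" for f
      using L2_continuous_integrable[OF L(3) cont[OF that]] by simp
    ultimately show ?thesis
      using \<beta>\<eta> by (simp add: Z3 right_diff_distrib)
  qed
  finally show ?thesis .
qed


section \<open>The fundamental lemma for periodic test functions\<close>

text \<open>Cosine is even and decreasing on [0, pi]; beyond pi, reflection to 2 pi - |y| still
  leaves a value above r. This describes an interval by a periodic inequality, as test functions
  periodic in \<xi>_2 require.\<close>

lemma cos_gt_cos_iff:
  assumes "0 \<le> r" "r \<le> pi" "\<bar>y\<bar> < 2 * pi - r"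
  shows "cos y > cos r \<longleftrightarrow> \<bar>y\<bar> < r"
proof
  assume "\<bar>y\<bar> < r"
  then have "cos r < cos \<bar>y\<bar>" using assms by (intro cos_monotone_0_pi) auto
  then show "cos y > cos r" by simp
next
  assume *: "cos y > cos r"
  show "\<bar>y\<bar> < r"
  proof (rule ccontr)
    assume r: "\<not> \<bar>y\<bar> < r"
    have "cos \<bar>y\<bar> \<le> cos r"
    proof (cases "\<bar>y\<bar> \<le> pi")
      case True
      then show ?thesis using assms r by (intro cos_monotone_0_pi_le) auto
    next
      case False
      then have "cos (2 * pi - \<bar>y\<bar>) \<le> cos r" using assms r by (intro cos_monotone_0_pi_le) auto
      then show ?thesis by (simp add: cos_diff)
    qed
    with * show False by simp
  qed
qed

lemma box_test_functions:
  assumes lu: "\<And>i. l $ i \<le> u $ i" "a \<le> l $ 1" "u $ 1 \<le> b" "0 \<le> l $ 2" "u $ 2 \<le> 2 * pi" "0 \<le> l $ 3" "u $ 3 \<le> 1"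
  obtains B where "\<And>n. B n \<in> per_test a b" "\<And>n \<xi>. \<bar>B n \<xi>\<bar> \<le> 1"
    "\<And>\<xi>. \<xi> \<in> Ref_dom a b \<Longrightarrow> (\<lambda>n. B n \<xi>) \<longlonglongrightarrow> indicator (box l u) \<xi>"
proof -
  \<comment> \<open>Midpoint and half length of the \<xi>_2-interval: cos(\<xi>_2 - m) - cos r is
    periodic, and within one period it is positive exactly on that interval. The other four factors
    of the product are distances to the sides of the box in \<xi>_1 and \<xi>_3.\<close>
  define m r where "m = (l$2 + u$2) / 2" and "r = (u$2 - l$2) / 2"
  define X :: "nat \<Rightarrow> real^3 \<Rightarrow> real" where
    "X = (\<lambda>j \<xi>. if j = 0 then \<xi>$1 - l$1 else if j = 1 then u$1 - \<xi>$1 else if j = 2 then \<xi>$3 - l$3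
       else if j = 3 then u$3 - \<xi>$3 else cos (\<xi>$2 - m) - cos r)"
  define B where "B = (\<lambda>n \<xi>. \<Prod>j\<in>{0, 1, 2, 3, 4}. smooth_step (real n * X j \<xi> - 1))"
  have B_eq: "B n \<xi> = smooth_step (real n * X 0 \<xi> - 1) * (smooth_step (real n * X 1 \<xi> - 1) * (smooth_step (real n * X 2 \<xi> - 1)
      * (smooth_step (real n * X 3 \<xi> - 1) * smooth_step (real n * X 4 \<xi> - 1))))" for n \<xi>
    by (simp add: B_def)
  have sX: "smooth_on UNIV (X j)" for j
  proof -
    consider "j = 0" | "j = 1" | "j = 2" | "j = 3" | "j \<notin> {0, 1, 2, 3}" by blast
    then show ?thesis
      by cases (simp_all add: X_def smooth_on_diff smooth_on_coord smooth_on_const smooth_on_cos)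
  qed
  have s: "smooth_on UNIV (\<lambda>\<xi>. smooth_step (real n * X j \<xi> - 1))" for n j
    by (intro smooth_on_compose[OF _ _ _ _ smooth_on_smooth_step] smooth_intros open_UNIV sX) auto
  have "B n \<in> per_test a b" for n
  proof -
    have "smooth_on UNIV (B n)"
      unfolding B_eq[abs_def] by (intro smooth_on_mult s open_UNIV)
    moreover have "periodic2 (B n)"
    proof -
      have "cos (\<xi>$2 + 2 * pi - m) = cos (\<xi>$2 - m)" for \<xi> :: "real^3"
        using cos_periodic[of "\<xi>$2 - m"] by (simp add: algebra_simps)
      then show ?thesis by (simp add: periodic2_def B_def X_def axis_component)
    qed
    moreover have "a + 1 / real (Suc n) \<le> \<xi>$1 \<and> \<xi>$1 \<le> b - 1 / real (Suc n) \<and> 1 / real (Suc n) \<le> \<xi>$3 \<and> \<xi>$3 \<le> 1 - 1 / real (Suc n)"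
      if "B n \<xi> \<noteq> 0" for \<xi>
    proof -
      have "X j \<xi> > 1 / real (Suc n)" if "j \<in> {0, 1, 2, 3}" for j
        using that \<open>B n \<xi> \<noteq> 0\<close> by (intro smooth_step_scaled_pos) (auto simp: B_eq)
      from this[of 0] this[of 1] this[of 2] this[of 3] lu show ?thesis
        by (simp add: X_def)
    qed
    ultimately show ?thesis
      unfolding per_test_def per_smooth_def
      by (intro CollectI conjI exI[of _ "1 / real (Suc n)"]) auto
  qed
  moreover have "\<bar>B n \<xi>\<bar> \<le> 1" for n \<xi>
    unfolding B_eq abs_mult abs_of_nonneg[OF smooth_step_bounds(1)]
    by (intro mult_le_one mult_nonneg_nonneg smooth_step_bounds)
  moreover have "(\<lambda>n. B n \<xi>) \<longlonglongrightarrow> indicator (box l u) \<xi>" if \<xi>: "\<xi> \<in> Ref_dom a b" for \<xi>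
  proof -
    have "(\<lambda>n. B n \<xi>) \<longlonglongrightarrow> (\<Prod>j\<in>{0, 1, 2, 3, 4}. if X j \<xi> > 0 then 1 else 0)"
      unfolding B_def by (intro tendsto_prod smooth_step_scaled_limit)
    moreover have "X 4 \<xi> > 0 \<longleftrightarrow> l$2 < \<xi>$2 \<and> \<xi>$2 < u$2"
    proof -
      \<comment> \<open>0 < \<xi>_2 < 2 pi and the location of the box in one period give |\<xi>_2 -
        m| < 2 pi - r.\<close>
      have "cos (\<xi>$2 - m) > cos r \<longleftrightarrow> \<bar>\<xi>$2 - m\<bar> < r"
        using lu(1)[of 2] lu(4,5) \<xi> by (intro cos_gt_cos_iff) (auto simp: m_def r_def Ref_dom_def abs_if field_simps)
      also have "\<dots> \<longleftrightarrow> l$2 < \<xi>$2 \<and> \<xi>$2 < u$2"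
        by (auto simp: m_def r_def abs_if field_simps)
      finally show ?thesis by (simp add: X_def)
    qed
    then have "(\<Prod>j\<in>{0, 1, 2, 3, 4}. if X j \<xi> > 0 then 1 else 0) = (indicator (box l u) \<xi> :: real)"
      by (auto simp: X_def indicator_def mem_box_cart forall_3)
    ultimately show ?thesis by simp
  qed
  ultimately show ?thesis by (rule that)
qed

text \<open>The positive and the negative part of g are densities of measures that agree on boxes, a
  generating system stable under intersection. So the measures are equal, hence the densities almost
  everywhere, and g is zero where its two parts coincide.\<close>

lemma AE_zero_if_box_integrals_zero:
  fixes g :: "'a::euclidean_space \<Rightarrow> real"
  assumes int: "integrable lborel g" and zero: "\<And>l u. (LINT x|lborel. indicator (box l u) x * g x) = 0"
  shows "AE x in lborel. g x = 0"
proof -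
  have m [measurable]: "g \<in> borel_measurable borel" using int by auto
  let ?p = "\<lambda>x. ennreal (max (g x) 0)" and ?n = "\<lambda>x. ennreal (max (- g x) 0)"
  have fin: "emeasure (density lborel ?p) A \<noteq> \<infinity>" if "A \<in> sets borel" for A
  proof -
    have "integrable lborel (\<lambda>x. max (g x) 0 * indicator A x)"
      using integrable_mult_indicator[of A lborel "\<lambda>x. max (g x) 0"] int that by (simp add: mult.commute)
    then show ?thesis using that
      by (subst emeasure_density)
        (auto simp: nn_integral_eq_integral mult.commute ennreal_mult''[symmetric] ennreal_indicator[symmetric]
          simp del: ennreal_indicator)
  qed
  have emb: "emeasure (density lborel ?p) (box l u) = emeasure (density lborel ?n) (box l u)" for l u
  proof -
    have i: "integrable lborel (\<lambda>x. indicator (box l u) x * g x)"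
      using integrable_mult_indicator[OF _ int, of "box l u"] by simp
    then have ip: "integrable lborel (\<lambda>x. max (indicator (box l u) x * g x) 0)"
      and im: "integrable lborel (\<lambda>x. max (- (indicator (box l u) x * g x)) 0)" by auto
    have "(LINT x|lborel. max (indicator (box l u) x * g x) 0) - (LINT x|lborel. max (- (indicator (box l u) x * g x)) 0)
        = (LINT x|lborel. indicator (box l u) x * g x)"
      by (subst Bochner_Integration.integral_diff[OF ip im, symmetric]) (auto intro!: Bochner_Integration.integral_cong)
    then have e: "(LINT x|lborel. max (indicator (box l u) x * g x) 0) = (LINT x|lborel. max (- (indicator (box l u) x * g x)) 0)"
      using zero by simp
    have "emeasure (density lborel ?p) (box l u) = (\<integral>\<^sup>+x. ennreal (max (indicator (box l u) x * g x) 0) \<partial>lborel)"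
      by (subst emeasure_density) (auto intro!: nn_integral_cong split: split_indicator)
    also have "\<dots> = (\<integral>\<^sup>+x. ennreal (max (- (indicator (box l u) x * g x)) 0) \<partial>lborel)"
      using ip im e by (simp add: nn_integral_eq_integral)
    also have "\<dots> = emeasure (density lborel ?n) (box l u)"
      by (subst emeasure_density) (auto intro!: nn_integral_cong split: split_indicator)
    finally show ?thesis .
  qed
  have "density lborel ?p = density lborel ?n"
  proof (rule measure_eqI_generator_eq)
    let ?E = "range (\<lambda>(a, b). box a b :: 'a set)"
    show "Int_stable ?E" by (auto simp: Int_stable_def box_Int_box)
    show "?E \<subseteq> Pow UNIV" "sets (density lborel ?p) = sigma_sets UNIV ?E" "sets (density lborel ?n) = sigma_sets UNIV ?E"
      by (simp_all add: borel_eq_box)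
    let ?A = "\<lambda>n::nat. box (- (real n *\<^sub>R One)) (real n *\<^sub>R One) :: 'a set"
    show "range ?A \<subseteq> ?E" "(\<Union>i. ?A i) = UNIV"
      unfolding UN_box_eq_UNIV by auto
    show "emeasure (density lborel ?p) (?A i) \<noteq> \<infinity>" for i by (rule fin) simp
    show "emeasure (density lborel ?p) X = emeasure (density lborel ?n) X" if "X \<in> ?E" for X
      using that emb by auto
  qed
  then have "AE x in lborel. ?p x = ?n x"
    by (intro sigma_finite_measure.density_unique[OF sigma_finite_lborel]) auto
  then show ?thesis
    by eventually_elim (auto simp: max_def split: if_splits)
qed

text \<open>Dominated convergence passes from the bounded test functions of
  \<open>box_test_functions\<close> to indicators of boxes inside the reference domain; the previous
  lemma does the rest.\<close>

lemma AE_zero_if_orthogonal_to_per_test: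
  fixes v :: "real^3 \<Rightarrow> real"
  assumes v: "L2 (Ref_dom a b) v"
    and zero: "\<And>\<zeta>. \<zeta> \<in> per_test a b \<Longrightarrow> (LINT \<xi>|lebesgue_on (Ref_dom a b). v \<xi> * \<zeta> \<xi>) = 0"
  shows "AE \<xi> in lebesgue_on (Ref_dom a b). v \<xi> = 0"
proof -
  let ?\<Omega> = "Ref_dom a b"
  have int: "integrable (lebesgue_on ?\<Omega>) v"
    using L2_continuous_integrable[OF v continuous_on_const[of UNIV 1]] by simp
  then have intl: "integrable lebesgue (\<lambda>x. indicator ?\<Omega> x * v x)"
    by (simp add: integrable_restrict_space)
  \<comment> \<open>v is only Lebesgue measurable, while the uniqueness of measures works with Borel
    densities.\<close>
  then obtain g where g: "g \<in> borel_measurable lborel" "AE x in lborel. indicator ?\<Omega> x * v x = g x"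
    using completion_ex_borel_measurable_real[of "\<lambda>x. indicator ?\<Omega> x * v x" lborel] by auto
  have ae: "AE x in lebesgue. indicator ?\<Omega> x * v x = g x"
    using g(2) by (rule AE_completion)
  have gl: "g \<in> borel_measurable lebesgue" using g(1) by (simp add: measurable_completion)
  have "integrable lebesgue g"
    using intl ae gl by (subst integrable_cong_AE[of _ _ "\<lambda>x. indicator ?\<Omega> x * v x"]) auto
  then have gint: "integrable lborel g" using g(1) by (simp add: integrable_completion)
  have box0: "(LINT x|lebesgue_on ?\<Omega>. v x * indicator (box l u) x) = 0"
    if lu: "\<And>i. l $ i \<le> u $ i" "a \<le> l $ 1" "u $ 1 \<le> b" "0 \<le> l $ 2" "u $ 2 \<le> 2 * pi" "0 \<le> l $ 3" "u $ 3 \<le> 1" for l u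
  proof -
    obtain B where B: "\<And>n. B n \<in> per_test a b" "\<And>n \<xi>. \<bar>B n \<xi>\<bar> \<le> 1"
      "\<And>\<xi>. \<xi> \<in> ?\<Omega> \<Longrightarrow> (\<lambda>n. B n \<xi>) \<longlonglongrightarrow> indicator (box l u) \<xi>"
      using box_test_functions[OF lu] by blast
    have "(\<lambda>n. LINT x|lebesgue_on ?\<Omega>. v x * B n x) \<longlonglongrightarrow> (LINT x|lebesgue_on ?\<Omega>. v x * indicator (box l u) x)"
    proof (rule integral_dominated_convergence)
      have m: "v \<in> borel_measurable (lebesgue_on ?\<Omega>)" by (rule L2_measurable[OF v])
      have "(indicator (box l u) :: _ \<Rightarrow> real) \<in> borel_measurable (lebesgue_on ?\<Omega>)"
        by (intro measurable_restrict_space1 measurable_completion) auto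
      then show "(\<lambda>x. v x * indicator (box l u) x) \<in> borel_measurable (lebesgue_on ?\<Omega>)"
        by (intro borel_measurable_times m)
      have "continuous_on UNIV (B n)" for n
        using B(1)[of n] by (auto simp: per_test_def per_smooth_def intro: smooth_on_continuous_on)
      then show "(\<lambda>x. v x * B n x) \<in> borel_measurable (lebesgue_on ?\<Omega>)" for n
        by (intro borel_measurable_times m continuous_borel_measurable_lebesgue_on)
      show "integrable (lebesgue_on ?\<Omega>) (\<lambda>x. \<bar>v x\<bar>)" using int by simp
      show "AE x in lebesgue_on ?\<Omega>. (\<lambda>n. v x * B n x) \<longlonglongrightarrow> v x * indicator (box l u) x"
        by (intro AE_I2 tendsto_mult_left B(3)) simp
      show "AE x in lebesgue_on ?\<Omega>. norm (v x * B n x) \<le> \<bar>v x\<bar>" for n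
        using B(2) by (intro AE_I2) (auto simp: abs_mult mult_left_le)
    qed
    then show ?thesis using zero[OF B(1)] by (simp add: LIMSEQ_const_iff)
  qed
  have "AE x in lborel. g x = 0"
  proof (rule AE_zero_if_box_integrals_zero[OF gint])
    fix l u :: "real^3"
    let ?l = "vector [max (l$1) a, max (l$2) 0, max (l$3) 0] :: real^3"
    let ?u = "vector [min (u$1) b, min (u$2) (2 * pi), min (u$3) 1] :: real^3"
    have \<Omega>l: "box l u \<inter> ?\<Omega> = box ?l ?u"
      by (auto simp: Ref_dom_def mem_box_cart forall_3)
    have "(LINT x|lborel. indicator (box l u) x * g x) = (LINT x|lebesgue. indicator (box l u) x * g x)"
      using g(1) by (intro integral_completion[symmetric]) auto
    also have "\<dots> = (LINT x|lebesgue. indicator (box l u) x * (indicator ?\<Omega> x * v x))"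
    proof (rule integral_cong_AE)
      have b: "(indicator (box l u) :: _ \<Rightarrow> real) \<in> borel_measurable lebesgue"
        by (intro measurable_completion) auto
      show "(\<lambda>x. indicator (box l u) x * g x) \<in> borel_measurable lebesgue"
        "(\<lambda>x. indicator (box l u) x * (indicator ?\<Omega> x * v x)) \<in> borel_measurable lebesgue"
        by (intro borel_measurable_times b gl borel_measurable_integrable[OF intl])+
      show "AE x in lebesgue. indicator (box l u) x * g x = indicator (box l u) x * (indicator ?\<Omega> x * v x)"
        using ae by eventually_elim simp
    qed
    also have "\<dots> = (LINT x|lebesgue_on ?\<Omega>. v x * indicator (box ?l ?u) x)"
      unfolding \<Omega>l[symmetric]
      by (simp add: integral_restrict_space) (auto intro!: Bochner_Integration.integral_cong split: split_indicator)
    also have "\<dots> = 0"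
    \<comment> \<open>The intersection of the box with the domain may be empty, and then its bounds
      can be in the wrong order for \<open>box0\<close>.\<close>
    proof (cases "\<forall>i. ?l $ i \<le> ?u $ i")
      case True
      then show ?thesis by (intro box0) auto
    next
      case False
      then obtain i where "?u $ i < ?l $ i" by (auto simp: not_le)
      then have "x \<notin> box ?l ?u" for x
        unfolding mem_box_cart(1) by (meson less_asym less_trans)
      then have "box ?l ?u = {}" by blast
      then show ?thesis by simp
    qed
    finally show "(LINT x|lborel. indicator (box l u) x * g x) = 0" .
  qed
  then have "AE x in lebesgue. g x = 0" by (rule AE_completion)
  then have "AE x in lebesgue. x \<in> ?\<Omega> \<longrightarrow> v x = 0"
    using ae by eventually_elim (auto split: split_indicator_asm)
  then show ?thesis by (simp add: AE_restrict_space_iff)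
qed


section \<open>The spherical frame\<close>

lemma frame_eq:
  "e_phi \<xi> = (cos (\<xi>$1) * cos (\<xi>$2)) *\<^sub>R axis 1 1 + (cos (\<xi>$1) * sin (\<xi>$2)) *\<^sub>R axis 2 1 + (- sin (\<xi>$1)) *\<^sub>R axis 3 1"
  "e_theta \<xi> = (- sin (\<xi>$2)) *\<^sub>R axis 1 1 + cos (\<xi>$2) *\<^sub>R axis 2 1"
  "e_rho \<xi> = (sin (\<xi>$1) * cos (\<xi>$2)) *\<^sub>R axis 1 1 + (sin (\<xi>$1) * sin (\<xi>$2)) *\<^sub>R axis 2 1 + cos (\<xi>$1) *\<^sub>R axis 3 1"
  by (auto simp: vec_eq_iff forall_3 e_phi_def e_theta_def e_rho_def axis_component)

lemma inner_real3: "(x::real^3) \<bullet> y = x$1 * y$1 + x$2 * y$2 + x$3 * y$3"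
  by (simp add: inner_vec_def sum_3)

lemma frame_orthonormal:
  "e_phi \<xi> \<bullet> e_phi \<xi> = 1" "e_theta \<xi> \<bullet> e_theta \<xi> = 1" "e_rho \<xi> \<bullet> e_rho \<xi> = 1"
  "e_phi \<xi> \<bullet> e_theta \<xi> = 0" "e_phi \<xi> \<bullet> e_rho \<xi> = 0" "e_theta \<xi> \<bullet> e_rho \<xi> = 0"
  "e_theta \<xi> \<bullet> e_phi \<xi> = 0" "e_rho \<xi> \<bullet> e_phi \<xi> = 0" "e_rho \<xi> \<bullet> e_theta \<xi> = 0"
proof -
  have "(sin (\<xi>$1))\<^sup>2 + (cos (\<xi>$1))\<^sup>2 = 1" "(sin (\<xi>$2))\<^sup>2 + (cos (\<xi>$2))\<^sup>2 = 1" by simp_all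
  note sc = this and frame = inner_real3 e_phi_def e_theta_def e_rho_def vector_3
  show "e_phi \<xi> \<bullet> e_phi \<xi> = 1" using sc unfolding frame by (algebra | simp add: algebra_simps)
  show "e_theta \<xi> \<bullet> e_theta \<xi> = 1" using sc unfolding frame by (algebra | simp add: algebra_simps)
  show "e_rho \<xi> \<bullet> e_rho \<xi> = 1" using sc unfolding frame by (algebra | simp add: algebra_simps)
  show "e_phi \<xi> \<bullet> e_theta \<xi> = 0" using sc unfolding frame by (algebra | simp add: algebra_simps)
  show "e_phi \<xi> \<bullet> e_rho \<xi> = 0" using sc unfolding frame by (algebra | simp add: algebra_simps)
  show "e_theta \<xi> \<bullet> e_rho \<xi> = 0" using sc unfolding frame by (algebra | simp add: algebra_simps)
  show "e_theta \<xi> \<bullet> e_phi \<xi> = 0" using sc unfolding frame by (algebra | simp add: algebra_simps)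
  show "e_rho \<xi> \<bullet> e_phi \<xi> = 0" using sc unfolding frame by (algebra | simp add: algebra_simps)
  show "e_rho \<xi> \<bullet> e_theta \<xi> = 0" using sc unfolding frame by (algebra | simp add: algebra_simps)
qed

lemma frame_expansion:
  "(y \<bullet> e_rho \<xi>) *\<^sub>R e_rho \<xi> + ((y \<bullet> e_phi \<xi>) *\<^sub>R e_phi \<xi> + (y \<bullet> e_theta \<xi>) *\<^sub>R e_theta \<xi>) = y"
  (is "?l = y")
proof -
  have "(sin (\<xi>$1))\<^sup>2 + (cos (\<xi>$1))\<^sup>2 = 1" "(sin (\<xi>$2))\<^sup>2 + (cos (\<xi>$2))\<^sup>2 = 1" by simp_all
  note sc = this and frame = inner_real3 e_phi_def e_theta_def e_rho_def vector_3
    vector_add_component vector_scaleR_component real_scaleR_def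
  have "?l $ 1 = y $ 1" using sc unfolding frame by (algebra | simp add: algebra_simps)
  moreover have "?l $ 2 = y $ 2" using sc unfolding frame by (algebra | simp add: algebra_simps)
  moreover have "?l $ 3 = y $ 3" using sc unfolding frame by (algebra | simp add: algebra_simps)
  ultimately show ?thesis by (simp add: vec_eq_iff forall_3)
qed

lemma norm_e_rho [simp]: "norm (e_rho \<xi>) = 1"
  by (simp add: norm_eq_sqrt_inner frame_orthonormal)

text \<open>The equations of the moving frame. The term with cos \<xi>_1 in the derivative of
  \<open>e_phi\<close> produces the cotangent that the factor 1/sin \<xi>_1 in \<open>weight\<close>
  later cancels.\<close>

lemma has_derivative_frame:
  "(e_rho has_derivative (\<lambda>w. w$1 *\<^sub>R e_phi \<xi> + (w$2 * sin (\<xi>$1)) *\<^sub>R e_theta \<xi>)) (at \<xi>)"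
  "(e_phi has_derivative (\<lambda>w. - (w$1 *\<^sub>R e_rho \<xi>) + (w$2 * cos (\<xi>$1)) *\<^sub>R e_theta \<xi>)) (at \<xi>)"
  "(e_theta has_derivative (\<lambda>w. - ((w$2 * sin (\<xi>$1)) *\<^sub>R e_rho \<xi>) - (w$2 * cos (\<xi>$1)) *\<^sub>R e_phi \<xi>)) (at \<xi>)"
proof -
  have sc: "cos (\<xi>$1) * (cos (\<xi>$1) * t) + sin (\<xi>$1) * (sin (\<xi>$1) * t) = t" for t
  proof -
    have "cos (\<xi>$1) * (cos (\<xi>$1) * t) + sin (\<xi>$1) * (sin (\<xi>$1) * t) = ((cos (\<xi>$1))\<^sup>2 + (sin (\<xi>$1))\<^sup>2) * t"
      by (simp only: power2_eq_square distrib_right mult.assoc)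
    then show ?thesis by simp
  qed
  note nth = bounded_linear_imp_has_derivative[OF bounded_linear_vec_nth]
  show "(e_rho has_derivative (\<lambda>w. w$1 *\<^sub>R e_phi \<xi> + (w$2 * sin (\<xi>$1)) *\<^sub>R e_theta \<xi>)) (at \<xi>)"
    unfolding frame_eq(3)[abs_def]
    by (rule has_derivative_eq_rhs, (rule derivative_intros nth)+)
      (auto simp: vec_eq_iff forall_3 fun_eq_iff frame_eq axis_component algebra_simps)
  show "(e_phi has_derivative (\<lambda>w. - (w$1 *\<^sub>R e_rho \<xi>) + (w$2 * cos (\<xi>$1)) *\<^sub>R e_theta \<xi>)) (at \<xi>)"
    unfolding frame_eq(1)[abs_def]
    by (rule has_derivative_eq_rhs, (rule derivative_intros nth)+)
      (auto simp: vec_eq_iff forall_3 fun_eq_iff frame_eq axis_component algebra_simps)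
  show "(e_theta has_derivative (\<lambda>w. - ((w$2 * sin (\<xi>$1)) *\<^sub>R e_rho \<xi>) - (w$2 * cos (\<xi>$1)) *\<^sub>R e_phi \<xi>)) (at \<xi>)"
    unfolding frame_eq(2)[abs_def]
    by (rule has_derivative_eq_rhs, (rule derivative_intros nth)+)
      (auto simp: vec_eq_iff forall_3 fun_eq_iff frame_eq axis_component algebra_simps sc)
qed

lemma smooth_on_frame:
  "smooth_on UNIV e_phi" "smooth_on UNIV e_theta" "smooth_on UNIV e_rho"
  unfolding frame_eq[abs_def] by (intro smooth_intros open_UNIV)+

lemma frame_periodic:
  "e_phi (\<xi> + axis 2 (2 * pi)) = e_phi \<xi>" "e_theta (\<xi> + axis 2 (2 * pi)) = e_theta \<xi>" "e_rho (\<xi> + axis 2 (2 * pi)) = e_rho \<xi>"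
  by (auto simp: e_phi_def e_theta_def e_rho_def axis_component)

lemma frame_per_smooth:
  "e_phi \<in> per_smooth" "e_theta \<in> per_smooth" "e_rho \<in> per_smooth"
  by (auto simp: per_smooth_def periodic2_def smooth_on_frame frame_periodic)

lemma vec_nth_per_smooth: "f \<in> per_smooth \<Longrightarrow> (\<lambda>\<xi>. f \<xi> $ i) \<in> per_smooth"
  by (simp add: per_smooth_def periodic2_def smooth_on_vec_nth)

lemma periodic_int:
  fixes g :: "real \<Rightarrow> 'b"
  assumes "\<And>t. g (t + 2 * pi) = g t"
  shows "g (t + 2 * pi * of_int k) = g t"
proof -
  have nat: "g (t + 2 * pi * real n) = g t" for n t
  proof (induction n)
    case (Suc n)
    have "g (t + 2 * pi * real (Suc n)) = g ((t + 2 * pi * real n) + 2 * pi)" by (simp add: algebra_simps)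
    also have "\<dots> = g t" using assms Suc by simp
    finally show ?case .
  qed simp
  show ?thesis
  proof (cases "k \<ge> 0")
    case True
    then show ?thesis using nat[of t "nat k"] by simp
  next
    case False
    then show ?thesis using nat[of "t + 2 * pi * of_int k" "nat (- k)"] by simp
  qed
qed

section \<open>Geometry of the shell\<close>

text \<open>The smoothness of h is stated in three variables, so that the calculus on the open set
  \<open>slab a b\<close> applies directly.\<close>

locale shell =
  fixes R a b :: real and h :: "real \<times> real \<Rightarrow> real"
  assumes R_pos: "R > 0" and ab: "0 < a" "a < b" "b < pi"
    and h_smooth: "smooth_on (slab a b) (\<lambda>\<xi>. h (\<xi>$1, \<xi>$2))"
    and h_periodic: "\<And>s t. a < s \<Longrightarrow> s < b \<Longrightarrow> h (s, t + 2 * pi) = h (s, t)"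
    and h_pos: "\<And>s t. a < s \<Longrightarrow> s < b \<Longrightarrow> h (s, t) > 0"
begin

definition H :: "real^3 \<Rightarrow> real" where "H \<xi> = h (\<xi>$1, \<xi>$2)"

definition radius :: "real \<Rightarrow> real^3 \<Rightarrow> real" where
  "radius e \<xi> = R + e * \<xi>$3 * H \<xi>"

abbreviation \<Phi> :: "real \<Rightarrow> real^3 \<Rightarrow> real^3" where "\<Phi> \<equiv> Shell_map R h"

lemma \<Phi>_eq: "\<Phi> e \<xi> = radius e \<xi> *\<^sub>R e_rho \<xi>"
  by (simp add: Shell_map_def radius_def H_def)

lemma layer_subset_slab: "\<xi> \<in> layer a b \<Longrightarrow> \<xi> \<in> slab a b"
  by (auto simp: layer_def slab_def)

lemma smooth_H: "smooth_on (slab a b) H"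
  using h_smooth by (simp add: H_def[abs_def])

lemma H_differentiable: "\<xi> \<in> slab a b \<Longrightarrow> H differentiable (at \<xi>)"
  by (rule smooth_on_differentiable[OF smooth_H])

lemma H_pos: "\<xi> \<in> slab a b \<Longrightarrow> H \<xi> > 0"
  by (auto simp: H_def slab_def h_pos)

lemma sin_pos: "\<xi> \<in> slab a b \<Longrightarrow> sin (\<xi>$1) > 0"
  using ab by (auto simp: slab_def intro!: sin_gt_zero)

lemma radius_pos: "\<xi> \<in> layer a b \<Longrightarrow> e > 0 \<Longrightarrow> radius e \<xi> > 0"
  using R_pos H_pos[OF layer_subset_slab, of \<xi>] by (auto simp: radius_def layer_def intro!: add_pos_nonneg)

lemma H_coeff: "H \<in> periodic_coeff (slab a b)"
  using smooth_H h_periodic by (auto simp: periodic_coeff_def H_def slab_def axis_component)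

lemma H_shrink3: "H (shrink3 s \<xi>) = H \<xi>"
  by (simp add: H_def shrink3_nth)

lemma pderiv3_H_3: "pderiv3 3 H \<xi> = 0"
  by (simp add: dir_deriv_def H_def axis_component)

lemma periodic_coeff_pderiv3:
  assumes "c \<in> periodic_coeff (slab a b)"
  shows "pderiv3 i c \<in> periodic_coeff (slab a b)"
proof -
  have "pderiv3 i c (\<xi> + axis 2 (2 * pi)) = pderiv3 i c \<xi>" if "\<xi> \<in> slab a b" for \<xi>
  proof -
    have "pderiv3 i c \<xi> = pderiv3 i (\<lambda>\<xi>. c (\<xi> + axis 2 (2 * pi))) \<xi>"
      by (rule dir_deriv_cong_open[OF open_slab that]) (use assms in \<open>auto simp: periodic_coeff_def\<close>)
    also have "\<dots> = pderiv3 i c (\<xi> + axis 2 (2 * pi))"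
      by (simp add: dir_deriv_def add_ac)
    finally show ?thesis by simp
  qed
  then show ?thesis
    using assms by (auto simp: periodic_coeff_def smooth_on_pderiv3)
qed

lemma periodic_coeff_mult:
  fixes c d :: "real^3 \<Rightarrow> real"
  shows "c \<in> periodic_coeff (slab a b) \<Longrightarrow> d \<in> periodic_coeff (slab a b) \<Longrightarrow> (\<lambda>\<xi>. c \<xi> * d \<xi>) \<in> periodic_coeff (slab a b)"
  by (auto simp: periodic_coeff_def intro!: smooth_on_mult open_slab)

lemma periodic_coeff_divide:
  fixes c d :: "real^3 \<Rightarrow> real"
  shows "c \<in> periodic_coeff (slab a b) \<Longrightarrow> d \<in> periodic_coeff (slab a b) \<Longrightarrow> (\<And>\<xi>. \<xi> \<in> slab a b \<Longrightarrow> d \<xi> \<noteq> 0)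
    \<Longrightarrow> (\<lambda>\<xi>. c \<xi> / d \<xi>) \<in> periodic_coeff (slab a b)"
  by (auto simp: periodic_coeff_def intro!: smooth_on_divide open_slab)

lemma per_smooth_coeff: "c \<in> per_smooth \<Longrightarrow> c \<in> periodic_coeff S"
  by (auto simp: periodic_coeff_def per_smooth_def periodic2_def intro: smooth_on_subset)

lemma coord_per_smooth: "i \<noteq> 2 \<Longrightarrow> (\<lambda>\<xi>::real^3. \<xi>$i) \<in> per_smooth"
  by (simp add: per_smooth_def periodic2_def smooth_on_coord axis_component)

lemma sin_per_smooth: "(\<lambda>\<xi>::real^3. sin (\<xi>$1)) \<in> per_smooth" "(\<lambda>\<xi>::real^3. cos (\<xi>$1)) \<in> per_smooth"
  by (auto simp: per_smooth_def periodic2_def axis_component intro!: smooth_intros)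

lemma const_per_smooth: "(\<lambda>\<xi>. c) \<in> per_smooth"
  by (simp add: per_smooth_def periodic2_def smooth_on_const)

text \<open>In the curvilinear coordinates \<open>\<partial>/\<partial>x\<^sub>i = A\<^sub>i / \<epsilon> + B\<^sub>i / r\<close>, where \<open>r\<close> is the radius and the
  operators \<open>A\<^sub>i\<close> and \<open>B\<^sub>i\<close> do not depend on \<open>\<epsilon>\<close>.\<close>

definition A :: "3 \<Rightarrow> (real^3 \<Rightarrow> real) \<Rightarrow> real^3 \<Rightarrow> real" where
  "A i \<phi> \<xi> = e_rho \<xi> $ i / H \<xi> * pderiv3 3 \<phi> \<xi>"

text \<open>Subtracting \<xi>_3 (\<partial>_j H / H) \<partial>_3 turns the derivative at fixed
  \<xi>_3 into the one at fixed radius. So \<open>B\<close> is the gradient along the unit sphere,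
  in Cartesian components.\<close>

definition B :: "3 \<Rightarrow> (real^3 \<Rightarrow> real) \<Rightarrow> real^3 \<Rightarrow> real" where
  "B i \<phi> \<xi> = e_phi \<xi> $ i * (pderiv3 1 \<phi> \<xi> - \<xi>$3 * pderiv3 1 H \<xi> / H \<xi> * pderiv3 3 \<phi> \<xi>)
     + e_theta \<xi> $ i / sin (\<xi>$1) * (pderiv3 2 \<phi> \<xi> - \<xi>$3 * pderiv3 2 H \<xi> / H \<xi> * pderiv3 3 \<phi> \<xi>)"

definition D :: "real \<Rightarrow> 3 \<Rightarrow> (real^3 \<Rightarrow> real) \<Rightarrow> real^3 \<Rightarrow> real" where
  "D e i \<phi> \<xi> = A i \<phi> \<xi> / e + B i \<phi> \<xi> / radius e \<xi>"

lemma slab_coeff_tests: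
  assumes "c \<in> periodic_coeff (slab a b)" "\<phi> \<in> per_test a b"
  shows "(\<lambda>\<xi>. c \<xi> * \<phi> \<xi>) \<in> per_test a b"
  using per.tests_coeff_mult[of c a b \<phi>] assms periodic_coeff_slab_layer by (auto simp: per_tests_eq)

lemmas per_test_add = per.tests_add[of _ a b, unfolded per_tests_eq]
  and per_test_diff = per.tests_diff[of _ a b, unfolded per_tests_eq]
  and per_test_pderiv3 = per.tests_pderiv3[of _ a b, unfolded per_tests_eq]
  and per_test_mult = per.tests_per_smooth_mult[of _ _ a b, unfolded per_tests_eq]
  and per_test_sum = per.tests_sum[of _ _ a b, unfolded per_tests_eq]
  and per_test_smooth = per.tests_smooth[of _ a b, unfolded per_tests_eq]
  and per_test_differentiable = per.tests_differentiable[of _ a b, unfolded per_tests_eq]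
  and per_test_periodic = per.tests_periodic[of _ a b, unfolded per_tests_eq]
  and per_test_zero_outside = per.tests_zero_outside[of _ a b, unfolded per_tests_eq]

lemma A_per_test: "\<phi> \<in> per_test a b \<Longrightarrow> A i \<phi> \<in> per_test a b"
proof -
  assume \<phi>: "\<phi> \<in> per_test a b"
  have "(\<lambda>\<xi>. e_rho \<xi> $ i / H \<xi>) \<in> periodic_coeff (slab a b)"
    by (intro periodic_coeff_divide H_coeff per_smooth_coeff vec_nth_per_smooth frame_per_smooth)
      (use H_pos in force)
  from slab_coeff_tests[OF this per_test_pderiv3[OF \<phi>]] show ?thesis
    by (simp add: A_def[abs_def])
qed

lemma B_per_test: "\<phi> \<in> per_test a b \<Longrightarrow> B i \<phi> \<in> per_test a b"
proof -
  assume \<phi>: "\<phi> \<in> per_test a b"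
  have "(\<lambda>\<xi>. \<xi>$3 * pderiv3 j H \<xi> / H \<xi>) \<in> periodic_coeff (slab a b)" for j
    by (intro periodic_coeff_divide periodic_coeff_mult H_coeff per_smooth_coeff[OF coord_per_smooth] periodic_coeff_pderiv3)
      (use H_pos in force)+
  from slab_coeff_tests[OF this per_test_pderiv3[OF \<phi>]]
  have "(\<lambda>\<xi>. pderiv3 j \<phi> \<xi> - \<xi>$3 * pderiv3 j H \<xi> / H \<xi> * pderiv3 3 \<phi> \<xi>) \<in> per_test a b" for j
    by (intro per_test_diff per_test_pderiv3 \<phi>) auto
  moreover have "(\<lambda>\<xi>. e_theta \<xi> $ i / sin (\<xi>$1)) \<in> periodic_coeff (slab a b)"
    by (intro periodic_coeff_divide per_smooth_coeff sin_per_smooth vec_nth_per_smooth frame_per_smooth)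
      (use sin_pos in force)
  moreover have "(\<lambda>\<xi>. e_phi \<xi> $ i) \<in> periodic_coeff (slab a b)"
    by (intro per_smooth_coeff vec_nth_per_smooth frame_per_smooth)
  ultimately show ?thesis
    unfolding B_def[abs_def] by (intro per_test_add slab_coeff_tests)
qed

text \<open>The radius can be zero outside the layer, so 1/r is a coefficient for functions
  supported in the layer, not in the whole slab. For fixed e the operator preserves the test class
  and can be iterated.\<close>

lemma D_per_test:
  assumes "\<phi> \<in> per_test a b" "e > 0"
  shows "D e i \<phi> \<in> per_test a b"
proof -
  have "smooth_on (layer a b) H"
    by (rule smooth_on_subset[OF smooth_H]) (auto intro: layer_subset_slab)
  then have "smooth_on (layer a b) (\<lambda>\<xi>. 1 / radius e \<xi>)"
    using radius_pos[OF _ assms(2)] unfolding radius_def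
    by (intro smooth_on_divide smooth_on_add smooth_on_mult smooth_on_const smooth_on_coord open_layer) (auto simp: less_imp_neq[symmetric])
  moreover have "radius e (\<xi> + axis 2 (2 * pi)) = radius e \<xi>" if "\<xi> \<in> layer a b" for \<xi>
    using H_coeff layer_subset_slab[OF that] by (simp add: periodic_coeff_def radius_def axis_component)
  ultimately have "(\<lambda>\<xi>. 1 / radius e \<xi>) \<in> periodic_coeff (layer a b)"
    by (simp add: periodic_coeff_def)
  from per.tests_coeff_mult[OF this] B_per_test[OF assms(1)]
  have "(\<lambda>\<xi>. 1 / radius e \<xi> * B i \<phi> \<xi>) \<in> per_test a b" by (simp add: per_tests_eq)
  moreover have "(\<lambda>\<xi>. 1 / e * A i \<phi> \<xi>) \<in> per_test a b"
    by (intro per_test_mult const_per_smooth A_per_test assms)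
  ultimately have "(\<lambda>\<xi>. 1 / e * A i \<phi> \<xi> + 1 / radius e \<xi> * B i \<phi> \<xi>) \<in> per_test a b"
    by (rule per_test_add[rotated])
  then show ?thesis by (simp add: D_def[abs_def])
qed

definition d\<Phi> :: "real \<Rightarrow> real^3 \<Rightarrow> real^3 \<Rightarrow> real^3" where
  "d\<Phi> e \<xi> w = (e * (w$3 * H \<xi> + \<xi>$3 * (w$1 * pderiv3 1 H \<xi> + w$2 * pderiv3 2 H \<xi>))) *\<^sub>R e_rho \<xi>
     + radius e \<xi> *\<^sub>R (w$1 *\<^sub>R e_phi \<xi> + (w$2 * sin (\<xi>$1)) *\<^sub>R e_theta \<xi>)"

lemma has_derivative_\<Phi>:
  assumes "\<xi> \<in> slab a b"
  shows "(\<Phi> e has_derivative d\<Phi> e \<xi>) (at \<xi>)"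
proof -
  have "(H has_derivative (\<lambda>w. w$1 * pderiv3 1 H \<xi> + w$2 * pderiv3 2 H \<xi>)) (at \<xi>)"
    using differentiable_grad3[OF H_differentiable[OF assms]] by (simp add: inner_real3 grad3_def pderiv3_H_3)
  note [derivative_intros] = this bounded_linear_imp_has_derivative[OF bounded_linear_vec_nth] has_derivative_frame(1)
  show ?thesis
    unfolding \<Phi>_eq[abs_def] radius_def
    by (rule has_derivative_eq_rhs, (rule derivative_intros)+)
      (auto simp: fun_eq_iff d\<Phi>_def radius_def algebra_simps)
qed

text \<open>The system is triangular: the tangential components of y determine the first two
  entries, and the radial component then gives the third.\<close>

definition d\<Phi>_inv :: "real \<Rightarrow> real^3 \<Rightarrow> real^3 \<Rightarrow> real^3" where
  "d\<Phi>_inv e \<xi> y = (let w1 = y \<bullet> e_phi \<xi> / radius e \<xi>; w2 = y \<bullet> e_theta \<xi> / (radius e \<xi> * sin (\<xi>$1))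
     in vector [w1, w2, (y \<bullet> e_rho \<xi> / e - \<xi>$3 * (w1 * pderiv3 1 H \<xi> + w2 * pderiv3 2 H \<xi>)) / H \<xi>])"

text \<open>A right inverse of the derivative is what the inverse function theorem in
  \<open>push_has_derivative\<close> asks for.\<close>

lemma d\<Phi>_d\<Phi>_inv:
  assumes "\<xi> \<in> layer a b" "e > 0"
  shows "d\<Phi> e \<xi> (d\<Phi>_inv e \<xi> y) = y"
proof -
  have nz: "H \<xi> \<noteq> 0" "sin (\<xi>$1) \<noteq> 0" "radius e \<xi> \<noteq> 0" "e \<noteq> 0"
    using assms H_pos sin_pos radius_pos layer_subset_slab by force+
  define w where "w = d\<Phi>_inv e \<xi> y"
  have w: "radius e \<xi> * w$1 = y \<bullet> e_phi \<xi>" "radius e \<xi> * (w$2 * sin (\<xi>$1)) = y \<bullet> e_theta \<xi>"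
    "e * (w$3 * H \<xi> + \<xi>$3 * (w$1 * pderiv3 1 H \<xi> + w$2 * pderiv3 2 H \<xi>)) = y \<bullet> e_rho \<xi>"
    using nz by (simp_all add: w_def d\<Phi>_inv_def Let_def)
  have "d\<Phi> e \<xi> w = (y \<bullet> e_rho \<xi>) *\<^sub>R e_rho \<xi> + ((y \<bullet> e_phi \<xi>) *\<^sub>R e_phi \<xi> + (y \<bullet> e_theta \<xi>) *\<^sub>R e_theta \<xi>)"
    unfolding d\<Phi>_def w(3) scaleR_add_right scaleR_scaleR w(1,2) ..
  then show ?thesis by (simp add: w_def frame_expansion)
qed

lemma inner_grad3: "w \<bullet> grad3 \<phi> \<xi> = w$1 * pderiv3 1 \<phi> \<xi> + w$2 * pderiv3 2 \<phi> \<xi> + w$3 * pderiv3 3 \<phi> \<xi>"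
  by (simp add: inner_real3 grad3_def)

text \<open>Identifies \<open>D\<close> with the Cartesian derivative via the chain rule for the
  inverse of the shell map.\<close>

lemma D_eq: "d\<Phi>_inv e \<xi> (axis i 1) \<bullet> grad3 \<phi> \<xi> = D e i \<phi> \<xi>"
  unfolding inner_grad3 d\<Phi>_inv_def Let_def vector_3 inner_axis' D_def A_def B_def
  by (simp add: divide_inverse algebra_simps)

end


section \<open>Test functions on the shell\<close>

lemma period_shift:
  fixes t :: real
  obtains k :: int where "0 \<le> t + 2 * pi * of_int k" "t + 2 * pi * of_int k < 2 * pi"
proof
  have "2 * pi > 0" by simp
  from floor_divide_lower[OF this, of t] floor_divide_upper[OF this, of t]
  show "0 \<le> t + 2 * pi * of_int (- \<lfloor>t / (2 * pi)\<rfloor>)" "t + 2 * pi * of_int (- \<lfloor>t / (2 * pi)\<rfloor>) < 2 * pi"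
    by (simp_all add: algebra_simps)
qed

context shell
begin

lemma Shell_dom_eq: "Shell_dom R h a b e = \<Phi> e ` layer a b"
  by (simp add: Shell_dom_def layer_def)

lemma H_periodic_int: "\<xi> \<in> slab a b \<Longrightarrow> H (\<xi> + (2 * pi * of_int k) *\<^sub>R axis 2 1) = H \<xi>"
  using periodic_int[of "\<lambda>t. h (\<xi>$1, t)" "\<xi>$2" k] h_periodic
  by (auto simp: H_def slab_def axis_component)

lemma per_test_periodic_int:
  assumes "\<phi> \<in> per_test a b"
  shows "\<phi> (\<xi> + (2 * pi * of_int k) *\<^sub>R axis 2 1) = \<phi> \<xi>"
proof -
  have "\<phi> (\<xi> + (t + 2 * pi) *\<^sub>R axis 2 1) = \<phi> (\<xi> + t *\<^sub>R axis 2 1)" for t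
  proof -
    have "\<xi> + (t + 2 * pi) *\<^sub>R axis 2 1 = (\<xi> + t *\<^sub>R axis 2 1) + axis 2 (2 * pi)"
      by (simp add: vec_eq_iff axis_component)
    then show ?thesis by (simp only: per_test_periodic[OF assms])
  qed
  from periodic_int[of "\<lambda>t. \<phi> (\<xi> + t *\<^sub>R axis 2 1)" 0 k, OF this] show ?thesis by simp
qed

lemma \<Phi>_periodic_int:
  assumes "\<xi> \<in> slab a b"
  shows "\<Phi> e (\<xi> + (2 * pi * of_int k) *\<^sub>R axis 2 1) = \<Phi> e \<xi>"
proof -
  have "cos (\<xi>$2 + 2 * pi * of_int k) = cos (\<xi>$2)" "sin (\<xi>$2 + 2 * pi * of_int k) = sin (\<xi>$2)"
    using sin_cos_eq_iff[of "\<xi>$2 + 2 * pi * of_int k" "\<xi>$2"] by auto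
  then show ?thesis
    unfolding \<Phi>_eq radius_def H_periodic_int[OF assms] by (simp add: e_rho_def axis_component)
qed

text \<open>The norm yields the radius, the direction yields \<xi>_1 in (0, pi) and \<xi>_2 up to
  periods. Then H agrees at both points, and equal radii give equal \<xi>_3.\<close>

lemma \<Phi>_eq_imp_period:
  assumes \<xi>: "\<xi> \<in> layer a b" "\<xi>' \<in> layer a b" and "e > 0" and eq: "\<Phi> e \<xi> = \<Phi> e \<xi>'"
  obtains k :: int where "\<xi>' = \<xi> + (2 * pi * of_int k) *\<^sub>R axis 2 1"
proof -
  have s: "\<xi> \<in> slab a b" "\<xi>' \<in> slab a b" using \<xi> layer_subset_slab by auto
  have r: "radius e \<xi> > 0" "radius e \<xi>' > 0" using radius_pos \<xi> \<open>e > 0\<close> by auto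
  have "norm (\<Phi> e \<xi>) = radius e \<xi>" "norm (\<Phi> e \<xi>') = radius e \<xi>'" using r by (auto simp: \<Phi>_eq)
  then have rr: "radius e \<xi> = radius e \<xi>'" using eq by simp
  then have "e_rho \<xi> = e_rho \<xi>'" using eq r by (simp add: \<Phi>_eq)
  then have c: "sin (\<xi>$1) * cos (\<xi>$2) = sin (\<xi>'$1) * cos (\<xi>'$2)" "sin (\<xi>$1) * sin (\<xi>$2) = sin (\<xi>'$1) * sin (\<xi>'$2)"
    "cos (\<xi>$1) = cos (\<xi>'$1)"
    by (simp_all add: vec_eq_iff forall_3 e_rho_def)
  have 1: "\<xi>'$1 = \<xi>$1"
  proof (rule cos_inj_pi)
    show "0 \<le> \<xi>'$1" "\<xi>'$1 \<le> pi" "0 \<le> \<xi>$1" "\<xi>$1 \<le> pi"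
      using s ab by (auto simp: slab_def)
  qed (simp add: c(3))
  then have "sin (\<xi>'$2) = sin (\<xi>$2) \<and> cos (\<xi>'$2) = cos (\<xi>$2)"
    using c(1,2) sin_pos[OF s(1)] by auto
  then obtain k :: int where k: "\<xi>'$2 = \<xi>$2 + 2 * pi * of_int k"
    using sin_cos_eq_iff by blast
  have "H \<xi>' = h (\<xi>$1, \<xi>$2 + 2 * pi * of_int k)" by (simp add: H_def 1 k)
  also have "\<dots> = H \<xi>" using H_periodic_int[OF s(1), of k] by (simp add: H_def axis_component)
  finally have "\<xi>'$3 = \<xi>$3"
    using rr \<open>e > 0\<close> H_pos[OF s(1)] by (simp add: radius_def)
  then have "\<xi>' = \<xi> + (2 * pi * of_int k) *\<^sub>R axis 2 1"
    using 1 k by (simp add: vec_eq_iff forall_3 axis_component)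
  then show ?thesis by (rule that)
qed

lemma continuous_on_\<Phi>: "continuous_on (slab a b) (\<Phi> e)"
  by (intro continuous_at_imp_continuous_on ballI has_derivative_continuous[OF has_derivative_\<Phi>])

text \<open>The preimage under \<open>\<Phi> e\<close> is unique up to a period in \<open>\<xi>\<^sub>2\<close>, so the choice is immaterial for
  periodic functions.\<close>

definition push :: "real \<Rightarrow> (real^3 \<Rightarrow> real) \<Rightarrow> real^3 \<Rightarrow> real" where
  "push e \<phi> x = (if x \<in> \<Phi> e ` layer a b then \<phi> (SOME \<xi>. \<xi> \<in> layer a b \<and> \<Phi> e \<xi> = x) else 0)"

lemma push_\<Phi>:
  assumes "\<phi> \<in> per_test a b" "\<xi> \<in> layer a b" "e > 0"
  shows "push e \<phi> (\<Phi> e \<xi>) = \<phi> \<xi>"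
proof -
  define \<xi>' where "\<xi>' = (SOME \<xi>'. \<xi>' \<in> layer a b \<and> \<Phi> e \<xi>' = \<Phi> e \<xi>)"
  have "\<xi>' \<in> layer a b \<and> \<Phi> e \<xi>' = \<Phi> e \<xi>"
    unfolding \<xi>'_def by (rule someI[of _ \<xi>]) (use assms in auto)
  then obtain k :: int where "\<xi>' = \<xi> + (2 * pi * of_int k) *\<^sub>R axis 2 1"
    using \<Phi>_eq_imp_period[OF assms(2) _ assms(3), of \<xi>'] by metis
  then have "\<phi> \<xi>' = \<phi> \<xi>" by (simp add: per_test_periodic_int[OF assms(1)])
  then show ?thesis using assms by (simp add: push_def \<xi>'_def)
qed

text \<open>\<open>layer_core\<close> is unbounded in \<xi>_2, but by periodicity one closed period
  covers its image; this part is a compact box.\<close>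

lemma push_support:
  assumes "\<phi> \<in> per_test a b" "e > 0"
  obtains C where "compact C" "C \<subseteq> \<Phi> e ` layer a b" "\<And>x. x \<notin> C \<Longrightarrow> push e \<phi> x = 0"
proof -
  obtain \<delta> where \<delta>: "\<delta> > 0" "\<And>\<xi>. \<phi> \<xi> \<noteq> 0 \<Longrightarrow> \<xi> \<in> layer_core a b \<delta>"
    using assms(1) unfolding per_tests_eq[symmetric] per.tests_def by auto
  define C0 where "C0 = cbox (vector [a + \<delta>, 0, \<delta>]) (vector [b - \<delta>, 2 * pi, 1 - \<delta>] :: real^3)"
  have C0: "C0 \<subseteq> layer a b" using \<delta>(1) by (auto simp: C0_def mem_box_cart forall_3 layer_def)
  show ?thesis
  proof (rule that)
    show "compact (\<Phi> e ` C0)"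
    proof (rule compact_continuous_image)
      show "continuous_on C0 (\<Phi> e)"
        by (rule continuous_on_subset[OF continuous_on_\<Phi>]) (use C0 layer_subset_slab in blast)
    qed (simp add: C0_def)
    show "\<Phi> e ` C0 \<subseteq> \<Phi> e ` layer a b" using C0 by blast
    fix x assume x: "x \<notin> \<Phi> e ` C0"
    show "push e \<phi> x = 0"
    proof (cases "x \<in> \<Phi> e ` layer a b")
      case True
      then obtain \<xi> where \<xi>: "\<xi> \<in> layer a b" "x = \<Phi> e \<xi>" by auto
      obtain k :: int where k: "0 \<le> \<xi>$2 + 2 * pi * of_int k" "\<xi>$2 + 2 * pi * of_int k < 2 * pi"
        using period_shift by blast
      define \<xi>' where "\<xi>' = \<xi> + (2 * pi * of_int k) *\<^sub>R axis 2 1"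
      have "\<phi> \<xi> = 0"
      proof (rule ccontr)
        assume "\<phi> \<xi> \<noteq> 0"
        then have "\<xi> \<in> layer_core a b \<delta>" by (rule \<delta>(2))
        moreover have "0 \<le> \<xi>'$2" "\<xi>'$2 \<le> 2 * pi"
          using k by (simp_all add: \<xi>'_def axis_component)
        ultimately have "\<xi>' \<in> C0"
          by (auto simp: C0_def mem_box_cart forall_3 layer_core_def \<xi>'_def axis_component)
        moreover have "\<Phi> e \<xi>' = x"
          using \<Phi>_periodic_int[OF layer_subset_slab[OF \<xi>(1)]] by (simp add: \<xi>'_def \<xi>(2))
        ultimately show False using x by blast
      qed
      then show ?thesis using push_\<Phi>[OF assms(1) \<xi>(1) assms(2)] \<xi>(2) by simp
    qed (simp add: push_def)
  qed
qed

text \<open>The shell map is injective only within less than a period. A strip around \<xi> gives a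
  local inverse, and periodicity makes \<open>push\<close> coincide with \<phi> composed with
  it.\<close>

lemma push_has_derivative:
  assumes \<phi>: "\<phi> \<in> per_test a b" and \<xi>: "\<xi> \<in> layer a b" and "e > 0"
  shows "(push e \<phi> has_derivative (\<lambda>y. d\<Phi>_inv e \<xi> y \<bullet> grad3 \<phi> \<xi>)) (at (\<Phi> e \<xi>))"
proof -
  \<comment> \<open>Two points of S differ in \<xi>_2 by less than 2 pi, which forces the integer k
    in \<open>\<Phi>_eq_imp_period\<close> to be 0.\<close>
  define S where "S = {\<xi>' \<in> layer a b. \<bar>\<xi>'$2 - \<xi>$2\<bar> < pi}"
  have "S = layer a b \<inter> {\<xi>'. \<bar>\<xi>'$2 - \<xi>$2\<bar> < pi}" by (auto simp: S_def)
  moreover have "open {\<xi>'::real^3. \<bar>\<xi>'$2 - \<xi>$2\<bar> < pi}"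
    by (intro open_Collect_less continuous_intros)
  ultimately have S: "open S" "\<xi> \<in> S" "S \<subseteq> layer a b"
    using \<xi> open_layer by (auto simp: S_def)
  have cont: "continuous_on S (\<Phi> e)"
    by (rule continuous_on_subset[OF continuous_on_\<Phi>]) (use S layer_subset_slab in blast)
  have inj: "inj_on (\<Phi> e) S"
  proof (rule inj_onI)
    fix \<eta> \<eta>' assume \<eta>: "\<eta> \<in> S" "\<eta>' \<in> S" "\<Phi> e \<eta> = \<Phi> e \<eta>'"
    then obtain k :: int where k: "\<eta>' = \<eta> + (2 * pi * of_int k) *\<^sub>R axis 2 1"
      using \<Phi>_eq_imp_period[of \<eta> \<eta>' e] \<open>e > 0\<close> S by blast
    have "\<bar>2 * pi * of_int k\<bar> < 2 * pi"
      using \<eta>(1,2) unfolding k S_def by (auto simp: axis_component)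
    then have "\<bar>of_int k :: real\<bar> < 1" by (simp add: abs_mult)
    then have "k = 0" by linarith
    then show "\<eta> = \<eta>'" using k by simp
  qed
  define g where "g = inv_into S (\<Phi> e)"
  have g: "g (\<Phi> e \<eta>) = \<eta>" if "\<eta> \<in> S" for \<eta> using inj that by (simp add: g_def)
  have "(g has_derivative d\<Phi>_inv e \<xi>) (at (\<Phi> e \<xi>))"
  proof (rule has_derivative_inverse_strong[OF S(1,2) cont g])
    show "(\<Phi> e has_derivative d\<Phi> e \<xi>) (at \<xi>)" by (rule has_derivative_\<Phi>[OF layer_subset_slab[OF \<xi>]])
    show "d\<Phi> e \<xi> \<circ> d\<Phi>_inv e \<xi> = id" using d\<Phi>_d\<Phi>_inv[OF \<xi> \<open>e > 0\<close>] by (auto simp: fun_eq_iff)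
  qed
  moreover have "(\<phi> has_derivative (\<lambda>y. y \<bullet> grad3 \<phi> \<xi>)) (at (g (\<Phi> e \<xi>)))"
    using differentiable_grad3[OF per_test_differentiable[OF \<phi>]] g[OF S(2)] by simp
  ultimately have "(\<phi> \<circ> g has_derivative (\<lambda>y. y \<bullet> grad3 \<phi> \<xi>) \<circ> d\<Phi>_inv e \<xi>) (at (\<Phi> e \<xi>))"
    by (rule diff_chain_at)
  then have "((\<lambda>x. \<phi> (g x)) has_derivative (\<lambda>y. d\<Phi>_inv e \<xi> y \<bullet> grad3 \<phi> \<xi>)) (at (\<Phi> e \<xi>))"
    by (simp add: o_def)
  then show ?thesis
  proof (rule has_derivative_transform_within_open)
    show "open (\<Phi> e ` S)" by (rule invariance_of_domain[OF cont S(1) inj])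
    show "\<Phi> e \<xi> \<in> \<Phi> e ` S" using S(2) by blast
    show "\<phi> (g x) = push e \<phi> x" if "x \<in> \<Phi> e ` S" for x
      using that push_\<Phi>[OF \<phi> _ \<open>e > 0\<close>] S(3) g by auto
  qed
qed

text \<open>\<open>push\<close> intertwines Cartesian derivatives with \<open>D\<close>, which
  preserves test functions. Smoothness of the push-forward is then an induction over the order that
  never returns to the local inverse.\<close>

lemma push_deriv:
  assumes \<phi>: "\<phi> \<in> per_test a b" and "e > 0"
  shows "push e \<phi> differentiable (at x)" "pderiv3 i (push e \<phi>) x = push e (D e i \<phi>) x"
proof -
  have "push e \<phi> differentiable (at x) \<and> pderiv3 i (push e \<phi>) x = push e (D e i \<phi>) x"
  proof (cases "x \<in> \<Phi> e ` layer a b")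
    case True
    then obtain \<xi> where \<xi>: "\<xi> \<in> layer a b" "x = \<Phi> e \<xi>" by auto
    note der = push_has_derivative[OF \<phi> \<xi>(1) \<open>e > 0\<close>]
    have "pderiv3 i (push e \<phi>) x = D e i \<phi> \<xi>"
      using has_derivative_dir_deriv[OF der] by (simp add: \<xi>(2) D_eq)
    also have "\<dots> = push e (D e i \<phi>) x"
      using push_\<Phi>[OF D_per_test[OF assms] \<xi>(1) \<open>e > 0\<close>] by (simp add: \<xi>(2))
    finally show ?thesis using der \<xi>(2) by (auto simp: differentiable_def)
  next
    case False
    obtain C where C: "compact C" "C \<subseteq> \<Phi> e ` layer a b" "\<And>x. x \<notin> C \<Longrightarrow> push e \<phi> x = 0"
      using push_support[OF assms] by blast
    \<comment> \<open>The support is compact inside the shell, so every other point, boundary points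
      included, has a neighbourhood where the push-forward is 0.\<close>
    have o: "open (- C)" "x \<in> - C" using C(2) False compact_imp_closed[OF C(1)] by auto
    have "push e \<phi> differentiable (at x)"
      by (rule differentiable_cong_open[OF o, of "\<lambda>x. 0"]) (use C(3) in auto)
    moreover have "pderiv3 i (push e \<phi>) x = pderiv3 i (\<lambda>x. 0) x"
      by (rule dir_deriv_cong_open[OF o]) (use C(3) in auto)
    ultimately show ?thesis using False by (simp add: push_def)
  qed
  then show "push e \<phi> differentiable (at x)" "pderiv3 i (push e \<phi>) x = push e (D e i \<phi>) x" by auto
qed

lemma smooth_on_push:
  assumes "\<phi> \<in> per_test a b" "e > 0"
  shows "smooth_on UNIV (push e \<phi>)"
proof -
  have "Ck_on n UNIV (push e \<phi>)" for n
    using assms(1)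
  proof (induction n arbitrary: \<phi>)
    case 0
    then show ?case using push_deriv(1)[OF _ assms(2)]
      by (auto intro!: continuous_at_imp_continuous_on differentiable_imp_continuous_within)
  next
    case (Suc n)
    have "pderiv3 i (push e \<phi>) = push e (D e i \<phi>)" for i
      using push_deriv(2)[OF Suc.prems assms(2)] by blast
    then have "Ck_on n UNIV (pderiv3 i (push e \<phi>))" for i
      using Suc.IH[OF D_per_test[OF Suc.prems assms(2)]] by simp
    then show ?case
      using push_deriv(1)[OF Suc.prems assms(2)] by (auto simp: Basis_vec_axis)
  qed
  then show ?thesis by (simp add: smooth_on_def)
qed

lemma push_test_function:
  assumes "\<phi> \<in> per_test a b" "e > 0"
  shows "push e \<phi> \<in> test_functions (Shell_dom R h a b e)"
proof -
  obtain C where C: "compact C" "C \<subseteq> \<Phi> e ` layer a b" "\<And>x. x \<notin> C \<Longrightarrow> push e \<phi> x = 0"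
    using push_support[OF assms] by blast
  have sub: "closure {x. push e \<phi> x \<noteq> 0} \<subseteq> C"
    using C by (intro closure_minimal compact_imp_closed) auto
  then have "C \<inter> closure {x. push e \<phi> x \<noteq> 0} = closure {x. push e \<phi> x \<noteq> 0}" by blast
  then have "compact (closure {x. push e \<phi> x \<noteq> 0})"
    using compact_Int_closed[OF C(1) closed_closure] by metis
  then show ?thesis
    using sub C(2) smooth_on_push[OF assms] by (auto simp: test_functions_def Shell_dom_eq)
qed

section \<open>Change of variables\<close>

definition jacobian :: "real \<Rightarrow> real^3 \<Rightarrow> real" where
  "jacobian e \<xi> = e * H \<xi> * (radius e \<xi>)\<^sup>2 * sin (\<xi>$1)"

lemma Ref_dom_subset_layer: "\<xi> \<in> Ref_dom a b \<Longrightarrow> \<xi> \<in> layer a b"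
  by (auto simp: Ref_dom_def layer_def)

text \<open>The slopes of h only add multiples of the third column to the first two, so they cancel,
  and the volume factor of spherical coordinates times \<epsilon> H remains.\<close>

lemma det_d\<Phi>: "det (matrix (d\<Phi> e \<xi>)) = jacobian e \<xi>"
proof -
  have "(sin (\<xi>$1))\<^sup>2 + (cos (\<xi>$1))\<^sup>2 = 1" "(sin (\<xi>$2))\<^sup>2 + (cos (\<xi>$2))\<^sup>2 = 1" by simp_all
  note sc = this
  define c1 s1 c2 s2 where trig: "c1 = cos (\<xi>$1)" "s1 = sin (\<xi>$1)" "c2 = cos (\<xi>$2)" "s2 = sin (\<xi>$2)"
  define r p1 p2 p3 where p: "r = radius e \<xi>" "p1 = e * (\<xi>$3 * pderiv3 1 H \<xi>)" "p2 = e * (\<xi>$3 * pderiv3 2 H \<xi>)" "p3 = e * H \<xi>"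
  have col: "matrix (d\<Phi> e \<xi>) $ i $ j = d\<Phi> e \<xi> (axis j 1) $ i" for i j by (simp add: matrix_def)
  have "d\<Phi> e \<xi> (axis 1 1) = vector [p1 * (s1 * c2) + r * (c1 * c2), p1 * (s1 * s2) + r * (c1 * s2), p1 * c1 - r * s1]"
    "d\<Phi> e \<xi> (axis 2 1) = vector [p2 * (s1 * c2) - r * s1 * s2, p2 * (s1 * s2) + r * s1 * c2, p2 * c1]"
    "d\<Phi> e \<xi> (axis 3 1) = vector [p3 * (s1 * c2), p3 * (s1 * s2), p3 * c1]"
    by (simp_all add: d\<Phi>_def vec_eq_iff forall_3 axis_component e_rho_def e_phi_def e_theta_def trig p)
  then have "det (matrix (d\<Phi> e \<xi>)) =
      (p1 * (s1 * c2) + r * (c1 * c2)) * (p2 * (s1 * s2) + r * s1 * c2) * (p3 * c1) +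
      (p2 * (s1 * c2) - r * s1 * s2) * (p3 * (s1 * s2)) * (p1 * c1 - r * s1) +
      (p3 * (s1 * c2)) * (p1 * (s1 * s2) + r * (c1 * s2)) * (p2 * c1) -
      (p1 * (s1 * c2) + r * (c1 * c2)) * (p3 * (s1 * s2)) * (p2 * c1) -
      (p2 * (s1 * c2) - r * s1 * s2) * (p1 * (s1 * s2) + r * (c1 * s2)) * (p3 * c1) -
      (p3 * (s1 * c2)) * (p2 * (s1 * s2) + r * s1 * c2) * (p1 * c1 - r * s1)"
    unfolding det_3 col by simp
  also have "\<dots> = p3 * r\<^sup>2 * s1 * ((s1\<^sup>2 + c1\<^sup>2) * (s2\<^sup>2 + c2\<^sup>2))"
    by (simp add: algebra_simps power2_eq_square)
  also have "\<dots> = jacobian e \<xi>"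
    unfolding trig sc by (simp add: jacobian_def p)
  finally show ?thesis .
qed

text \<open>Integrability is not assumed: for c different from 0 both integrands fail to be
  integrable together, and then both integrals are 0 by convention.\<close>

lemma integral_scaleR_left_nonzero:
  fixes f :: "'a \<Rightarrow> real" and c :: "'b::euclidean_space"
  assumes "c \<noteq> 0"
  shows "(LINT x|M. f x *\<^sub>R c) = (LINT x|M. f x) *\<^sub>R c"
proof (cases "integrable M f")
  case False
  have "\<not> integrable M (\<lambda>x. f x *\<^sub>R c)"
  proof
    assume "integrable M (\<lambda>x. f x *\<^sub>R c)"
    then have "integrable M (\<lambda>x. (f x *\<^sub>R c) \<bullet> c / (c \<bullet> c))" by (intro integrable_divide integrable_inner_left)
    then show False using False assms by simp
  qed
  with False show ?thesis by (simp add: not_integrable_integral_eq)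
qed simp

text \<open>The open reference domain misses only the seam \<xi>_2 = 0 modulo periods, whose image
  is negligible as a differentiable image of part of a hyperplane. On the reference domain itself
  the map is injective.\<close>

lemma \<Phi>_image_AE:
  assumes "e > 0"
  shows "\<Phi> e ` Ref_dom a b \<in> sets lebesgue" "\<Phi> e ` layer a b \<in> sets lebesgue"
    "\<Phi> e ` Ref_dom a b \<subseteq> \<Phi> e ` layer a b"
    "inj_on (\<Phi> e) (Ref_dom a b)" "negligible (\<Phi> e ` layer a b - \<Phi> e ` Ref_dom a b)"
proof -
  show sub: "\<Phi> e ` Ref_dom a b \<subseteq> \<Phi> e ` layer a b" using Ref_dom_subset_layer by blast
  show inj: "inj_on (\<Phi> e) (Ref_dom a b)"
  proof (rule inj_onI)
    fix \<eta> \<eta>' assume \<eta>: "\<eta> \<in> Ref_dom a b" "\<eta>' \<in> Ref_dom a b" "\<Phi> e \<eta> = \<Phi> e \<eta>'"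
    then obtain k :: int where k: "\<eta>' = \<eta> + (2 * pi * of_int k) *\<^sub>R axis 2 1"
      using \<Phi>_eq_imp_period[of \<eta> \<eta>' e] \<open>e > 0\<close> Ref_dom_subset_layer by blast
    have "\<bar>2 * pi * of_int k\<bar> < 2 * pi"
      using \<eta>(1,2) unfolding k Ref_dom_def by (auto simp: axis_component)
    then have "\<bar>of_int k :: real\<bar> < 1" by (simp add: abs_mult)
    then have "k = 0" by linarith
    then show "\<eta> = \<eta>'" using k by simp
  qed
  have "continuous_on (Ref_dom a b) (\<Phi> e)"
    by (rule continuous_on_subset[OF continuous_on_\<Phi>]) (use Ref_dom_subset_layer layer_subset_slab in blast)
  from invariance_of_domain[OF this Ref_dom_open inj]
  show meas: "\<Phi> e ` Ref_dom a b \<in> sets lebesgue" by (simp add: borel_open)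
  define N where "N = layer a b \<inter> {\<xi>. \<xi>$2 = 0}"
  have "\<Phi> e ` layer a b - \<Phi> e ` Ref_dom a b \<subseteq> \<Phi> e ` N"
  proof
    fix x assume x: "x \<in> \<Phi> e ` layer a b - \<Phi> e ` Ref_dom a b"
    then obtain \<xi> where \<xi>: "\<xi> \<in> layer a b" "x = \<Phi> e \<xi>" by auto
    obtain k :: int where k: "0 \<le> \<xi>$2 + 2 * pi * of_int k" "\<xi>$2 + 2 * pi * of_int k < 2 * pi"
      using period_shift by blast
    define \<xi>' where "\<xi>' = \<xi> + (2 * pi * of_int k) *\<^sub>R axis 2 1"
    have 2: "0 \<le> \<xi>'$2" "\<xi>'$2 < 2 * pi" using k by (simp_all add: \<xi>'_def axis_component)
    have l: "\<xi>' \<in> layer a b" using \<xi>(1) by (simp add: layer_def \<xi>'_def axis_component)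
    have x': "x = \<Phi> e \<xi>'"
      using \<Phi>_periodic_int[OF layer_subset_slab[OF \<xi>(1)]] by (simp add: \<xi>'_def \<xi>(2))
    have "\<xi>'$2 = 0"
    proof (rule ccontr)
      assume "\<xi>'$2 \<noteq> 0"
      then have "\<xi>' \<in> Ref_dom a b" using l 2 by (auto simp: Ref_dom_def layer_def)
      then show False using x x' by blast
    qed
    then show "x \<in> \<Phi> e ` N" using l x' by (auto simp: N_def)
  qed
  moreover have "negligible (\<Phi> e ` N)"
  proof (rule negligible_differentiable_image_negligible)
    have "{\<xi>::real^3. \<xi>$2 = 0} = {\<xi>. axis 2 1 \<bullet> \<xi> = 0}" by (simp add: inner_axis')
    moreover have "negligible {\<xi>::real^3. axis 2 1 \<bullet> \<xi> = 0}"
      by (rule negligible_hyperplane) (auto simp: axis_eq_0_iff)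
    ultimately have "negligible {\<xi>::real^3. \<xi>$2 = 0}" by simp
    then show "negligible N" by (rule negligible_subset) (auto simp: N_def)
    show "\<Phi> e differentiable_on N"
      unfolding differentiable_on_def differentiable_def
      by (auto simp: N_def intro!: exI has_derivative_at_withinI[OF has_derivative_\<Phi>] layer_subset_slab)
  qed simp
  ultimately show neg: "negligible (\<Phi> e ` layer a b - \<Phi> e ` Ref_dom a b)"
    by (rule negligible_subset[rotated])
  have "\<Phi> e ` Ref_dom a b \<union> (\<Phi> e ` layer a b - \<Phi> e ` Ref_dom a b) = \<Phi> e ` layer a b"
    using sub by blast
  then show "\<Phi> e ` layer a b \<in> sets lebesgue"
    using sets.Un[OF meas negligible_imp_sets[OF neg]] by simp
qed

text \<open>Both sides are absolutely integrable or neither is. In the second case both integrals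
  have the default value 0, so the formula needs no integrability.\<close>

lemma change_of_variables_image:
  fixes f :: "real^3 \<Rightarrow> real^3"
  assumes "e > 0"
  shows "(LINT x|lebesgue_on (\<Phi> e ` Ref_dom a b). f x) = (LINT \<xi>|lebesgue_on (Ref_dom a b). jacobian e \<xi> *\<^sub>R f (\<Phi> e \<xi>))"
proof -
  let ?\<Omega> = "Ref_dom a b"
  let ?g = "\<lambda>\<xi>. \<bar>det (matrix (d\<Phi> e \<xi>))\<bar> *\<^sub>R f (\<Phi> e \<xi>)"
  have cov: "?g absolutely_integrable_on ?\<Omega> \<and> integral ?\<Omega> ?g = b' \<longleftrightarrow>
      f absolutely_integrable_on (\<Phi> e ` ?\<Omega>) \<and> integral (\<Phi> e ` ?\<Omega>) f = b'" for b'
  proof (rule has_absolute_integral_change_of_variables)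
    show "(\<Phi> e has_derivative d\<Phi> e \<xi>) (at \<xi> within ?\<Omega>)" if "\<xi> \<in> ?\<Omega>" for \<xi>
      using has_derivative_\<Phi>[OF layer_subset_slab[OF Ref_dom_subset_layer[OF that]]] has_derivative_at_withinI by blast
  qed (use \<Phi>_image_AE[OF assms] in auto)
  have J: "jacobian e \<xi> \<ge> 0" if "\<xi> \<in> ?\<Omega>" for \<xi>
    using layer_subset_slab[OF Ref_dom_subset_layer[OF that]] assms H_pos sin_pos
    by (simp add: jacobian_def less_imp_le)
  have L: "(LINT x|lebesgue_on S. k x) = integral S k" if "k absolutely_integrable_on S" "S \<in> sets lebesgue"
    for S and k :: "real^3 \<Rightarrow> real^3"
    using set_lebesgue_integral_eq_integral(2)[OF that(1)] that(2)
    by (simp add: integral_restrict_space set_lebesgue_integral_def)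
  have N: "(LINT x|lebesgue_on S. k x) = 0" if "\<not> k absolutely_integrable_on S" "S \<in> sets lebesgue"
    for S and k :: "real^3 \<Rightarrow> real^3"
    using that by (intro not_integrable_integral_eq) (simp add: integrable_restrict_space set_integrable_def)
  have "(LINT x|lebesgue_on (\<Phi> e ` ?\<Omega>). f x) = (LINT \<xi>|lebesgue_on ?\<Omega>. ?g \<xi>)"
  proof (cases "f absolutely_integrable_on (\<Phi> e ` ?\<Omega>)")
    case True
    then have "?g absolutely_integrable_on ?\<Omega> \<and> integral ?\<Omega> ?g = integral (\<Phi> e ` ?\<Omega>) f"
      using cov by blast
    then show ?thesis using True by (simp add: L \<Phi>_image_AE[OF assms])
  next
    case False
    then have "\<not> ?g absolutely_integrable_on ?\<Omega>" using cov by blast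
    then show ?thesis using False by (simp add: N \<Phi>_image_AE[OF assms])
  qed
  also have "\<dots> = (LINT \<xi>|lebesgue_on ?\<Omega>. jacobian e \<xi> *\<^sub>R f (\<Phi> e \<xi>))"
    using J by (intro Bochner_Integration.integral_cong) (auto simp: det_d\<Phi>)
  finally show ?thesis .
qed

text \<open>Measurability on the shell is used to discard the image of the seam by an almost
  everywhere argument.\<close>

lemma change_of_variables:
  fixes f :: "real^3 \<Rightarrow> real^3"
  assumes "e > 0" "f \<in> borel_measurable (lebesgue_on (Shell_dom R h a b e))"
  shows "(LINT x|lebesgue_on (Shell_dom R h a b e). f x) = (LINT \<xi>|lebesgue_on (Ref_dom a b). jacobian e \<xi> *\<^sub>R f (\<Phi> e \<xi>))"
proof -
  let ?S = "\<Phi> e ` layer a b" and ?T = "\<Phi> e ` Ref_dom a b"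
  note im = \<Phi>_image_AE[OF assms(1)]
  have m: "(\<lambda>x. indicator ?S x *\<^sub>R f x) \<in> borel_measurable lebesgue"
    using assms(2) im(2) by (simp add: borel_measurable_restrict_space_iff Shell_dom_eq)
  have T: "(indicator ?T :: _ \<Rightarrow> real) \<in> borel_measurable lebesgue" using im(1) by simp
  have eq: "indicator ?T x *\<^sub>R f x = indicator ?T x *\<^sub>R (indicator ?S x *\<^sub>R f x)" for x
    using im(3) by (auto split: split_indicator)
  have "(LINT x|lebesgue_on ?S. f x) = (LINT x|lebesgue. indicator ?S x *\<^sub>R f x)"
    using im(2) by (simp add: integral_restrict_space)
  also have "\<dots> = (LINT x|lebesgue. indicator ?T x *\<^sub>R f x)"
  proof (rule integral_cong_AE[OF m])
    show "(\<lambda>x. indicator ?T x *\<^sub>R f x) \<in> borel_measurable lebesgue"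
      unfolding eq by (intro borel_measurable_scaleR T m)
    have "AE x in lebesgue. x \<notin> ?S - ?T"
      using im(5) unfolding negligible_iff_null_sets by (rule AE_not_in)
    then show "AE x in lebesgue. indicator ?S x *\<^sub>R f x = indicator ?T x *\<^sub>R f x"
      by eventually_elim (use im(3) in \<open>auto split: split_indicator\<close>)
  qed
  also have "\<dots> = (LINT x|lebesgue_on ?T. f x)"
    using im(1) by (simp add: integral_restrict_space)
  finally show ?thesis
    unfolding Shell_dom_eq by (simp add: change_of_variables_image[OF assms(1)])
qed

lemma change_of_variables_real:
  fixes f :: "real^3 \<Rightarrow> real"
  assumes "e > 0" "f \<in> borel_measurable (lebesgue_on (Shell_dom R h a b e))"
  shows "(LINT x|lebesgue_on (Shell_dom R h a b e). f x) = (LINT \<xi>|lebesgue_on (Ref_dom a b). jacobian e \<xi> * f (\<Phi> e \<xi>))"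
proof -
  have ax: "axis 1 1 \<noteq> (0 :: real^3)" by (simp add: axis_eq_0_iff)
  \<comment> \<open>The scalar case is embedded into the vector-valued one along a fixed nonzero
    vector.\<close>
  have "(LINT x|lebesgue_on (Shell_dom R h a b e). f x) *\<^sub>R (axis 1 1 :: real^3)
      = (LINT x|lebesgue_on (Shell_dom R h a b e). f x *\<^sub>R axis 1 1)"
    by (rule integral_scaleR_left_nonzero[OF ax, symmetric])
  also have "\<dots> = (LINT \<xi>|lebesgue_on (Ref_dom a b). (jacobian e \<xi> * f (\<Phi> e \<xi>)) *\<^sub>R axis 1 1)"
    using assms by (subst change_of_variables) (auto intro!: borel_measurable_scaleR)
  also have "\<dots> = (LINT \<xi>|lebesgue_on (Ref_dom a b). jacobian e \<xi> * f (\<Phi> e \<xi>)) *\<^sub>R axis 1 1"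
    by (rule integral_scaleR_left_nonzero[OF ax])
  finally show ?thesis using ax by simp
qed

end


section \<open>The limit of the Stokes equations\<close>

context shell
begin

lemma per_test_continuous: "\<phi> \<in> per_test a b \<Longrightarrow> continuous_on UNIV \<phi>"
  by (intro smooth_on_continuous_on per_test_smooth)

lemma per_test_integrable:
  assumes "L2 (Ref_dom a b) f" "\<phi> \<in> per_test a b"
  shows "integrable (lebesgue_on (Ref_dom a b)) (\<lambda>\<xi>. \<phi> \<xi> * f \<xi>)"
  using L2_continuous_integrable[OF assms(1) per_test_continuous[OF assms(2)]] by (simp add: mult.commute)

lemma jacobian_per_test:
  assumes "\<phi> \<in> per_test a b"
  shows "(\<lambda>\<xi>. jacobian e \<xi> * \<phi> \<xi>) \<in> per_test a b"
proof -
  have "smooth_on (slab a b) (jacobian e)"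
    unfolding jacobian_def[abs_def] radius_def by (intro smooth_intros smooth_H open_slab)
  moreover have "jacobian e (\<xi> + axis 2 (2 * pi)) = jacobian e \<xi>" if "\<xi> \<in> slab a b" for \<xi>
    using H_coeff that by (simp add: periodic_coeff_def jacobian_def radius_def axis_component)
  ultimately show ?thesis
    by (intro slab_coeff_tests assms) (auto simp: periodic_coeff_def)
qed

text \<open>The push-forward of \<phi> is an admissible test function, \<open>push_deriv\<close>
  replaces derivatives by \<open>D\<close>, and the change of variables adds the Jacobian. The
  distributional derivatives carry sign +1 on the velocity and -1 on the pressure, which gives the
  momentum identity after an overall change of sign.\<close>

lemma stokes_pulled_back:
  assumes st: "stokes_equations \<mu> (Shell_dom R h a b e) u p" and "e > 0"
    and U: "L2 (Ref_dom a b) (\<lambda>\<xi>. u (\<Phi> e \<xi>))" and \<phi>: "\<phi> \<in> per_test a b"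
  shows "\<mu> * (\<Sum>j\<in>UNIV. LINT \<xi>|lebesgue_on (Ref_dom a b). jacobian e \<xi> * D e j (D e j \<phi>) \<xi> * u (\<Phi> e \<xi>) $ i)
      + (LINT \<xi>|lebesgue_on (Ref_dom a b). jacobian e \<xi> * D e i \<phi> \<xi> * p (\<Phi> e \<xi>)) = 0" (is ?momentum)
    and "(\<Sum>i\<in>UNIV. LINT \<xi>|lebesgue_on (Ref_dom a b). jacobian e \<xi> * D e i \<phi> \<xi> * u (\<Phi> e \<xi>) $ i) = 0" (is ?mass)
proof -
  let ?S = "Shell_dom R h a b e" and ?\<Omega> = "Ref_dom a b"
  have um: "u \<in> borel_measurable (lebesgue_on ?S)" and pm: "p \<in> borel_measurable (lebesgue_on ?S)"
    using st by (auto simp: stokes_equations_def H1_def L2_def)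
  have uim: "(\<lambda>x. u x $ i) \<in> borel_measurable (lebesgue_on ?S)" for i
    using borel_measurable_inner[OF um borel_measurable_const[of "axis i 1"]] by (simp add: inner_axis)
  have pushm: "push e \<psi> \<in> borel_measurable (lebesgue_on ?S)" if "\<psi> \<in> per_test a b" for \<psi>
    by (intro continuous_borel_measurable_lebesgue_on smooth_on_continuous_on smooth_on_push that \<open>e > 0\<close>)
  have push\<Phi>: "push e \<psi> (\<Phi> e \<xi>) = \<psi> \<xi>" if "\<psi> \<in> per_test a b" "\<xi> \<in> ?\<Omega>" for \<psi> \<xi>
    by (rule push_\<Phi>[OF that(1) Ref_dom_subset_layer[OF that(2)] \<open>e > 0\<close>])
  have pd: "pderiv3 j (push e \<psi>) = push e (D e j \<psi>)" if "\<psi> \<in> per_test a b" for \<psi> j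
    using push_deriv(2)[OF that \<open>e > 0\<close>] by blast
  have D: "D e j \<psi> \<in> per_test a b" if "\<psi> \<in> per_test a b" for \<psi> j
    by (rule D_per_test[OF that \<open>e > 0\<close>])
  have du: "dist_fun ?S u (push e \<psi>) $ i = (LINT \<xi>|lebesgue_on ?\<Omega>. jacobian e \<xi> * \<psi> \<xi> * u (\<Phi> e \<xi>) $ i)"
    if "\<psi> \<in> per_test a b" for \<psi> i
  proof -
    have J: "continuous_on UNIV (\<lambda>\<xi>. jacobian e \<xi> * \<psi> \<xi>)"
      by (rule per_test_continuous[OF jacobian_per_test[OF that]])
    have L: "L2 ?\<Omega> (\<lambda>\<xi>. (jacobian e \<xi> * \<psi> \<xi>) *\<^sub>R u (\<Phi> e \<xi>))" by (rule L2_continuous_mult[OF U J])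
    \<comment> \<open>Needed to exchange the integral with taking a component; on the bounded domain
      it follows from square integrability through x <= 1 + x^2.\<close>
    have int: "integrable (lebesgue_on ?\<Omega>) (\<lambda>\<xi>. (jacobian e \<xi> * \<psi> \<xi>) *\<^sub>R u (\<Phi> e \<xi>))"
    proof (rule Bochner_Integration.integrable_bound)
      show "integrable (lebesgue_on ?\<Omega>) (\<lambda>\<xi>. 1 + (norm ((jacobian e \<xi> * \<psi> \<xi>) *\<^sub>R u (\<Phi> e \<xi>)))\<^sup>2)"
        using L L2_continuous[OF continuous_on_const[of UNIV "1::real"] bounded_Ref_dom[of a b]]
        by (intro Bochner_Integration.integrable_add) (simp_all add: L2_def)
      have "x \<le> 1 + x\<^sup>2" for x :: real
        using sum_squares_bound[of x 1] zero_le_power2[of x] by (simp add: power2_eq_square) (smt (verit) zero_le_square)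
      then show "AE \<xi> in lebesgue_on ?\<Omega>. norm ((jacobian e \<xi> * \<psi> \<xi>) *\<^sub>R u (\<Phi> e \<xi>))
          \<le> norm (1 + (norm ((jacobian e \<xi> * \<psi> \<xi>) *\<^sub>R u (\<Phi> e \<xi>)))\<^sup>2)" by (intro AE_I2) simp
    qed (rule L2_measurable[OF L])
    have "dist_fun ?S u (push e \<psi>) = (LINT \<xi>|lebesgue_on ?\<Omega>. jacobian e \<xi> *\<^sub>R (push e \<psi> (\<Phi> e \<xi>) *\<^sub>R u (\<Phi> e \<xi>)))"
      unfolding dist_fun_def
      by (rule change_of_variables[OF \<open>e > 0\<close> borel_measurable_scaleR[OF pushm[OF that] um]])
    also have "\<dots> = (LINT \<xi>|lebesgue_on ?\<Omega>. (jacobian e \<xi> * \<psi> \<xi>) *\<^sub>R u (\<Phi> e \<xi>))"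
      by (intro Bochner_Integration.integral_cong) (auto simp: push\<Phi>[OF that])
    also have "\<dots> $ i = (LINT \<xi>|lebesgue_on ?\<Omega>. ((jacobian e \<xi> * \<psi> \<xi>) *\<^sub>R u (\<Phi> e \<xi>)) $ i)"
      using integral_bounded_linear[OF bounded_linear_vec_nth int] by simp
    finally show ?thesis by (simp add: mult_ac)
  qed
  have dr: "dist_fun ?S f (push e \<psi>) = (LINT \<xi>|lebesgue_on ?\<Omega>. jacobian e \<xi> * \<psi> \<xi> * f (\<Phi> e \<xi>))"
    if "\<psi> \<in> per_test a b" "f \<in> borel_measurable (lebesgue_on ?S)" for \<psi> and f :: "real^3 \<Rightarrow> real"
  proof -
    have "dist_fun ?S f (push e \<psi>) = (LINT \<xi>|lebesgue_on ?\<Omega>. jacobian e \<xi> * (push e \<psi> (\<Phi> e \<xi>) * f (\<Phi> e \<xi>)))"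
      using change_of_variables_real[OF \<open>e > 0\<close> borel_measurable_times[OF pushm[OF that(1)] that(2)]]
      by (simp add: dist_fun_def)
    also have "\<dots> = (LINT \<xi>|lebesgue_on ?\<Omega>. jacobian e \<xi> * \<psi> \<xi> * f (\<Phi> e \<xi>))"
      by (intro Bochner_Integration.integral_cong) (auto simp: push\<Phi>[OF that(1)])
    finally show ?thesis .
  qed
  have "- \<mu> *\<^sub>R (\<Sum>j\<in>UNIV. dist_deriv j (dist_deriv j (dist_fun ?S u)) (push e \<phi>))
      + (\<chi> i. dist_deriv i (dist_fun ?S p) (push e \<phi>)) = 0"
    "(\<Sum>i\<in>UNIV. dist_deriv i (dist_fun ?S (\<lambda>x. u x $ i)) (push e \<phi>)) = 0"
    using st push_test_function[OF \<phi> \<open>e > 0\<close>] by (auto simp: stokes_equations_def)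
  note eqs = this
  have "(- \<mu> *\<^sub>R (\<Sum>j\<in>UNIV. dist_deriv j (dist_deriv j (dist_fun ?S u)) (push e \<phi>))
      + (\<chi> i. dist_deriv i (dist_fun ?S p) (push e \<phi>))) $ i = 0"
    unfolding eqs(1) by simp
  then have "\<mu> * (\<Sum>j\<in>UNIV. dist_fun ?S u (push e (D e j (D e j \<phi>))) $ i) + dist_fun ?S p (push e (D e i \<phi>)) = 0"
    by (simp add: dist_deriv_def pd \<phi> D sum_component)
  then show ?momentum by (simp add: du dr[OF _ pm] \<phi> D)
  show ?mass
    using eqs(2) by (simp add: dist_deriv_def pd \<phi> D dr[OF _ uim] sum_negf)
qed

text \<open>\<open>A\<close> and \<open>B\<close> see a function only through its gradient. The
  three summands match the gradient of \<open>D e j \<phi>\<close>, which combines those of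
  \<open>A j \<phi>\<close>, \<open>B j \<phi>\<close> and the radius.\<close>

lemma A_linear:
  assumes "\<And>i. pderiv3 i f \<xi> = \<alpha> * pderiv3 i f1 \<xi> + \<beta> * pderiv3 i f2 \<xi> + \<gamma> * pderiv3 i f3 \<xi>"
  shows "A j f \<xi> = \<alpha> * A j f1 \<xi> + \<beta> * A j f2 \<xi> + \<gamma> * A j f3 \<xi>"
  by (simp add: A_def assms algebra_simps)

lemma B_linear:
  assumes "\<And>i. pderiv3 i f \<xi> = \<alpha> * pderiv3 i f1 \<xi> + \<beta> * pderiv3 i f2 \<xi> + \<gamma> * pderiv3 i f3 \<xi>"
  shows "B j f \<xi> = \<alpha> * B j f1 \<xi> + \<beta> * B j f2 \<xi> + \<gamma> * B j f3 \<xi>"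
  unfolding B_def assms by (simp add: divide_inverse algebra_simps)

lemma pderiv3_radius:
  assumes "\<xi> \<in> slab a b"
  shows "radius e differentiable (at \<xi>)"
    "pderiv3 i (radius e) \<xi> = e * (axis i 1 $ 3 * H \<xi> + \<xi>$3 * pderiv3 i H \<xi>)"
proof -
  have "(radius e has_derivative (\<lambda>w. e * (w$3 * H \<xi> + \<xi>$3 * frechet_derivative H (at \<xi>) w))) (at \<xi>)"
    unfolding radius_def[abs_def]
    by (rule has_derivative_eq_rhs,
        (rule derivative_intros bounded_linear_imp_has_derivative[OF bounded_linear_vec_nth]
          differentiable_frechet_derivative[OF H_differentiable[OF assms]])+)
      (auto simp: algebra_simps)
  then show "radius e differentiable (at \<xi>)"
    "pderiv3 i (radius e) \<xi> = e * (axis i 1 $ 3 * H \<xi> + \<xi>$3 * pderiv3 i H \<xi>)"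
    using has_derivative_dir_deriv[of "radius e"]
      has_derivative_dir_deriv[OF differentiable_frechet_derivative[OF H_differentiable[OF assms]]]
    by (auto simp: differentiable_def)
qed

lemma A_radius: "\<xi> \<in> slab a b \<Longrightarrow> A j (radius e) \<xi> = e * e_rho \<xi> $ j"
  using H_pos[of \<xi>] by (simp add: A_def pderiv3_radius pderiv3_H_3 axis_component)

text \<open>\<open>B\<close> differentiates along spheres of fixed radius; only \<open>A\<close> can
  hit the factor 1/r in \<open>D\<close>.\<close>

lemma B_radius: "\<xi> \<in> slab a b \<Longrightarrow> B j (radius e) \<xi> = 0"
  using H_pos[of \<xi>] by (simp add: B_def pderiv3_radius pderiv3_H_3 axis_component)

text \<open>The last term comes from \<open>A\<close> acting on 1/r: this yields a factor e, which
  cancels the 1/e in front of \<open>A\<close>.\<close>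

lemma D_D:
  assumes \<phi>: "\<phi> \<in> per_test a b" and \<xi>: "\<xi> \<in> layer a b" and "e > 0"
  shows "D e j (D e j \<phi>) \<xi> = A j (A j \<phi>) \<xi> / e\<^sup>2 + (A j (B j \<phi>) \<xi> + B j (A j \<phi>) \<xi>) / (e * radius e \<xi>)
    + (B j (B j \<phi>) \<xi> - e_rho \<xi> $ j * B j \<phi> \<xi>) / (radius e \<xi>)\<^sup>2"
proof -
  have s: "\<xi> \<in> slab a b" by (rule layer_subset_slab[OF \<xi>])
  have r: "radius e \<xi> \<noteq> 0" using radius_pos[OF \<xi> \<open>e > 0\<close>] by simp
  have dA: "A j \<phi> differentiable (at \<xi>)" and dB: "B j \<phi> differentiable (at \<xi>)"
    using per_test_differentiable A_per_test[OF \<phi>] B_per_test[OF \<phi>] by blast+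
  note fd = dA[THEN differentiable_frechet_derivative] dB[THEN differentiable_frechet_derivative]
    pderiv3_radius(1)[OF s, THEN differentiable_frechet_derivative]
  have lin: "pderiv3 i (D e j \<phi>) \<xi> = (1 / e) * pderiv3 i (A j \<phi>) \<xi> + (1 / radius e \<xi>) * pderiv3 i (B j \<phi>) \<xi>
      + (- B j \<phi> \<xi> / (radius e \<xi>)\<^sup>2) * pderiv3 i (radius e) \<xi>" for i
  proof -
    have "(D e j \<phi> has_derivative (\<lambda>w. (1 / e) * frechet_derivative (A j \<phi>) (at \<xi>) w
        + (1 / radius e \<xi>) * frechet_derivative (B j \<phi>) (at \<xi>) w
        + (- B j \<phi> \<xi> / (radius e \<xi>)\<^sup>2) * frechet_derivative (radius e) (at \<xi>) w)) (at \<xi>)"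
    proof (rule has_derivative_eq_rhs)
      have E: "D e j \<phi> = (\<lambda>\<xi>. (1 / e) * A j \<phi> \<xi> + B j \<phi> \<xi> * inverse (radius e \<xi>))"
        by (simp add: fun_eq_iff D_def divide_inverse)
      show "(D e j \<phi> has_derivative (\<lambda>w. (1 / e) * frechet_derivative (A j \<phi>) (at \<xi>) w
          + (B j \<phi> \<xi> * - (inverse (radius e \<xi>) * frechet_derivative (radius e) (at \<xi>) w * inverse (radius e \<xi>))
            + frechet_derivative (B j \<phi>) (at \<xi>) w * inverse (radius e \<xi>)))) (at \<xi>)"
        unfolding E by (rule has_derivative_add[OF has_derivative_mult_right[OF fd(1)]
          has_derivative_mult[OF fd(2) Deriv.has_derivative_inverse[OF r fd(3)]]])
    qed (simp add: fun_eq_iff divide_inverse power2_eq_square)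
    from has_derivative_dir_deriv[OF this] show ?thesis
      by (simp add: has_derivative_dir_deriv[OF fd(1)] has_derivative_dir_deriv[OF fd(2)] has_derivative_dir_deriv[OF fd(3)])
  qed
  have 1: "A j (D e j \<phi>) \<xi> = (1 / e) * A j (A j \<phi>) \<xi> + (1 / radius e \<xi>) * A j (B j \<phi>) \<xi> + (- B j \<phi> \<xi> / (radius e \<xi>)\<^sup>2) * (e * e_rho \<xi> $ j)"
    using A_linear[OF lin] by (simp add: A_radius[OF s])
  have 2: "B j (D e j \<phi>) \<xi> = (1 / e) * B j (A j \<phi>) \<xi> + (1 / radius e \<xi>) * B j (B j \<phi>) \<xi>"
    using B_linear[OF lin] by (simp add: B_radius[OF s])
  show ?thesis
    unfolding D_def[of e j "D e j \<phi>"] 1 2 using r \<open>e > 0\<close>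
    by (simp add: field_simps power2_eq_square)
qed

text \<open>The coefficients of the powers of \<open>\<epsilon>\<close> in \<open>\<epsilon> J \<partial>\<^sup>2/\<partial>x\<^sub>j\<^sup>2\<close>, with \<open>J\<close> the Jacobian.\<close>

definition T :: "nat \<Rightarrow> 3 \<Rightarrow> (real^3 \<Rightarrow> real) \<Rightarrow> real^3 \<Rightarrow> real" where
  "T k j \<phi> \<xi> = H \<xi> * sin (\<xi>$1) *
    (if k = 0 then R\<^sup>2 * A j (A j \<phi>) \<xi>
     else if k = 1 then 2 * R * (\<xi>$3 * H \<xi>) * A j (A j \<phi>) \<xi> + R * (A j (B j \<phi>) \<xi> + B j (A j \<phi>) \<xi>)
     else (\<xi>$3 * H \<xi>)\<^sup>2 * A j (A j \<phi>) \<xi> + (\<xi>$3 * H \<xi>) * (A j (B j \<phi>) \<xi> + B j (A j \<phi>) \<xi>)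
       + (B j (B j \<phi>) \<xi> - e_rho \<xi> $ j * B j \<phi> \<xi>))"

lemma T_per_test:
  assumes \<phi>: "\<phi> \<in> per_test a b"
  shows "T k j \<phi> \<in> per_test a b"
proof -
  have c: "(\<lambda>\<xi>. H \<xi> * sin (\<xi>$1)) \<in> periodic_coeff (slab a b)"
    "(\<lambda>\<xi>. \<xi>$3 * H \<xi>) \<in> periodic_coeff (slab a b)" "(\<lambda>\<xi>. (\<xi>$3 * H \<xi>)\<^sup>2) \<in> periodic_coeff (slab a b)"
    "(\<lambda>\<xi>. 2 * R * (\<xi>$3 * H \<xi>)) \<in> periodic_coeff (slab a b)"
    "(\<lambda>\<xi>. e_rho \<xi> $ j) \<in> periodic_coeff (slab a b)" "(\<lambda>\<xi>. x) \<in> periodic_coeff (slab a b)" for x :: real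
    unfolding power2_eq_square
    by (intro periodic_coeff_mult H_coeff per_smooth_coeff sin_per_smooth coord_per_smooth const_per_smooth
        vec_nth_per_smooth frame_per_smooth; simp)+
  note P = slab_coeff_tests[OF c(1)] slab_coeff_tests[OF c(2)] slab_coeff_tests[OF c(3)] slab_coeff_tests[OF c(4)]
    slab_coeff_tests[OF c(5)] slab_coeff_tests[OF c(6)]
  consider "k = 0" | "k = 1" | "k \<noteq> 0" "k \<noteq> 1" by blast
  then show ?thesis
    by cases (auto simp: T_def[abs_def] intro!: P per_test_add per_test_diff A_per_test B_per_test \<phi>)
qed

text \<open>e times the Jacobian contains e^2 r^2, exactly the common denominator in
  \<open>D_D\<close>. The rest is quadratic in e because r is affine in e.\<close>

lemma jacobian_D_D:
  assumes \<phi>: "\<phi> \<in> per_test a b" and \<xi>: "\<xi> \<in> layer a b" and "e > 0"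
  shows "e * (jacobian e \<xi> * D e j (D e j \<phi>) \<xi>) = (\<Sum>k\<le>2. e ^ k * T k j \<phi> \<xi>)"
proof -
  have r: "radius e \<xi> \<noteq> 0" using radius_pos[OF \<xi> \<open>e > 0\<close>] by simp
  have "e * (jacobian e \<xi> * D e j (D e j \<phi>) \<xi>) = H \<xi> * sin (\<xi>$1) *
     ((radius e \<xi>)\<^sup>2 * A j (A j \<phi>) \<xi> + e * radius e \<xi> * (A j (B j \<phi>) \<xi> + B j (A j \<phi>) \<xi>)
      + e\<^sup>2 * (B j (B j \<phi>) \<xi> - e_rho \<xi> $ j * B j \<phi> \<xi>))"
    unfolding D_D[OF assms] jacobian_def using r \<open>e > 0\<close> by (simp add: field_simps power2_eq_square)
  also have "\<dots> = T 0 j \<phi> \<xi> + e * T 1 j \<phi> \<xi> + e\<^sup>2 * T 2 j \<phi> \<xi>"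
    unfolding radius_def T_def by (simp add: algebra_simps power2_eq_square)
  also have "\<dots> = (\<Sum>k\<le>2. e ^ k * T k j \<phi> \<xi>)"
    by (simp add: numeral_2_eq_2)
  finally show ?thesis .
qed

end


section \<open>Passage to the limit in momentum and mass balance\<close>

context shell
begin

lemma L2_vec_nth:
  fixes f :: "real^3 \<Rightarrow> real^3"
  shows "L2 (Ref_dom a b) f \<Longrightarrow> L2 (Ref_dom a b) (\<lambda>\<xi>. f \<xi> $ i)"
  using L2_continuous_inner[of a b f "\<lambda>_. axis i 1"] by (simp add: inner_axis)

lemma L2_per_test_vec:
  assumes "\<And>i. \<phi> i \<in> per_test a b"
  shows "L2 (Ref_dom a b) (\<lambda>\<xi>. (\<chi> i. \<phi> i \<xi>) :: real^3)"
  by (intro L2_continuous bounded_Ref_dom continuous_on_vec_lambda per_test_continuous assms) simp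

lemma per_test_polynomial:
  "(\<And>k. \<phi> k \<in> per_test a b) \<Longrightarrow> (\<lambda>\<xi>. \<Sum>k\<le>(N::nat). e ^ k * \<phi> k \<xi>) \<in> per_test a b"
  by (intro per_test_sum per_test_mult const_per_smooth)

text \<open>A whole test field is used because the pressure condition couples its components:
  \<open>tangential\<close> is the vanishing of the transverse part of the divergence. Every
  remaining term is a power of \<epsilon> times a fixed test function, paired with a weakly
  convergent sequence.\<close>

lemma momentum_limit:
  fixes u :: "nat \<Rightarrow> real^3 \<Rightarrow> real^3" and p :: "nat \<Rightarrow> real^3 \<Rightarrow> real" and \<phi> :: "3 \<Rightarrow> real^3 \<Rightarrow> real"
  assumes eps: "\<And>n. \<epsilon> n > 0" "\<epsilon> \<longlonglongrightarrow> 0"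
    and st: "\<And>n. stokes_equations \<mu> (Shell_dom R h a b (\<epsilon> n)) (u n) (p n)"
    and u: "L2_weak_conv (Ref_dom a b) (\<lambda>n \<xi>. u n (\<Phi> (\<epsilon> n) \<xi>)) us"
    and p: "L2_weak_conv (Ref_dom a b) (\<lambda>n \<xi>. (\<epsilon> n)\<^sup>2 * p n (\<Phi> (\<epsilon> n) \<xi>)) ps"
    and \<phi>: "\<And>i. \<phi> i \<in> per_test a b" and tangential: "\<And>\<xi>. \<xi> \<in> layer a b \<Longrightarrow> (\<Sum>i\<in>UNIV. A i (\<phi> i) \<xi>) = 0"
  shows "\<mu> * (LINT \<xi>|lebesgue_on (Ref_dom a b). us \<xi> \<bullet> (\<chi> i. \<Sum>j\<in>UNIV. T 0 j (\<phi> i) \<xi>))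
    + (LINT \<xi>|lebesgue_on (Ref_dom a b). ps \<xi> * (R * (H \<xi> * sin (\<xi>$1) * (\<Sum>i\<in>UNIV. B i (\<phi> i) \<xi>)))) = 0"
proof -
  let ?\<Omega> = "Ref_dom a b"
  define w :: "nat \<Rightarrow> real^3 \<Rightarrow> real^3" where "w = (\<lambda>k \<xi>. \<chi> i. \<Sum>j\<in>UNIV. T k j (\<phi> i) \<xi>)"
  \<comment> \<open>The two coefficients of r = R + \<epsilon> \<xi>_3 H, times what remains of the
    Jacobian and the \<open>B\<close> part of the divergence.\<close>
  define z where "z = (\<lambda>k \<xi>. if k = (0::nat) then R * (H \<xi> * sin (\<xi>$1) * (\<Sum>i\<in>UNIV. B i (\<phi> i) \<xi>))
      else \<xi>$3 * H \<xi> * (H \<xi> * sin (\<xi>$1) * (\<Sum>i\<in>UNIV. B i (\<phi> i) \<xi>)))"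
  have c: "(\<lambda>\<xi>. H \<xi> * sin (\<xi>$1)) \<in> periodic_coeff (slab a b)" "(\<lambda>\<xi>. \<xi>$3 * H \<xi>) \<in> periodic_coeff (slab a b)"
    by (intro periodic_coeff_mult H_coeff per_smooth_coeff sin_per_smooth coord_per_smooth; simp)+
  have q: "(\<lambda>\<xi>. H \<xi> * sin (\<xi>$1) * (\<Sum>i\<in>UNIV. B i (\<phi> i) \<xi>)) \<in> per_test a b"
    by (intro slab_coeff_tests[OF c(1)] per_test_sum B_per_test \<phi>)
  have z: "z k \<in> per_test a b" for k
    using per_test_mult[OF const_per_smooth q, of R] slab_coeff_tests[OF c(2) q] by (cases "k = 0") (simp_all add: z_def)
  have wL: "L2 ?\<Omega> (w k)" for k
    unfolding w_def by (intro L2_per_test_vec per_test_sum T_per_test \<phi>)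
  have zL: "L2 ?\<Omega> (z k)" for k
    using per_test_continuous[OF z] by (intro L2_continuous bounded_Ref_dom) auto
  have eq: "\<mu> * (LINT \<xi>|lebesgue_on ?\<Omega>. u n (\<Phi> (\<epsilon> n) \<xi>) \<bullet> (\<Sum>k\<le>2. \<epsilon> n ^ k *\<^sub>R w k \<xi>))
      + (LINT \<xi>|lebesgue_on ?\<Omega>. ((\<epsilon> n)\<^sup>2 * p n (\<Phi> (\<epsilon> n) \<xi>)) \<bullet> (\<Sum>k\<le>1. \<epsilon> n ^ k *\<^sub>R z k \<xi>)) = 0" for n
  proof -
    define e where "e = \<epsilon> n"
    define U where "U = (\<lambda>\<xi>. u n (\<Phi> e \<xi>))"
    define P where "P = (\<lambda>\<xi>. p n (\<Phi> e \<xi>))"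
    have e: "e > 0" using eps by (simp add: e_def)
    have UL: "L2 ?\<Omega> U" using u by (simp add: L2_weak_conv_def U_def e_def)
    have UiL: "L2 ?\<Omega> (\<lambda>\<xi>. U \<xi> $ i)" for i by (rule L2_vec_nth[OF UL])
    have "L2 ?\<Omega> (\<lambda>\<xi>. e\<^sup>2 * P \<xi>)" using p by (simp add: L2_weak_conv_def P_def e_def)
    from L2_scaleR[OF this, of "1 / e\<^sup>2"] e have PL: "L2 ?\<Omega> P" by simp
    let ?q = "\<lambda>i j \<xi>. \<Sum>k\<le>2. e ^ k * T k j (\<phi> i) \<xi>"
    have qt: "?q i j \<in> per_test a b" for i j by (intro per_test_polynomial T_per_test \<phi>)
    have JD: "(\<lambda>\<xi>. jacobian e \<xi> * D e i (\<phi> i) \<xi>) \<in> per_test a b" for i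
      by (intro jacobian_per_test D_per_test \<phi> e)
    have "(\<Sum>i\<in>UNIV. \<mu> * (\<Sum>j\<in>UNIV. LINT \<xi>|lebesgue_on ?\<Omega>. jacobian e \<xi> * D e j (D e j (\<phi> i)) \<xi> * U \<xi> $ i)
        + (LINT \<xi>|lebesgue_on ?\<Omega>. jacobian e \<xi> * D e i (\<phi> i) \<xi> * P \<xi>)) = 0"
      using stokes_pulled_back(1)[OF st[of n] eps(1) _ \<phi>] UL by (simp add: U_def P_def e_def)
    then have "e * (\<mu> * (\<Sum>i\<in>UNIV. \<Sum>j\<in>UNIV. LINT \<xi>|lebesgue_on ?\<Omega>. jacobian e \<xi> * D e j (D e j (\<phi> i)) \<xi> * U \<xi> $ i)
        + (\<Sum>i\<in>UNIV. LINT \<xi>|lebesgue_on ?\<Omega>. jacobian e \<xi> * D e i (\<phi> i) \<xi> * P \<xi>)) = 0"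
      by (simp add: sum.distrib sum_distrib_left)
    then have main: "\<mu> * (\<Sum>i\<in>UNIV. \<Sum>j\<in>UNIV. LINT \<xi>|lebesgue_on ?\<Omega>. e * (jacobian e \<xi> * D e j (D e j (\<phi> i)) \<xi> * U \<xi> $ i))
        + e * (\<Sum>i\<in>UNIV. LINT \<xi>|lebesgue_on ?\<Omega>. jacobian e \<xi> * D e i (\<phi> i) \<xi> * P \<xi>) = 0"
      by (simp add: distrib_left sum_distrib_left mult.left_commute)
    have "(LINT \<xi>|lebesgue_on ?\<Omega>. e * (jacobian e \<xi> * D e j (D e j (\<phi> i)) \<xi> * U \<xi> $ i)) = (LINT \<xi>|lebesgue_on ?\<Omega>. ?q i j \<xi> * U \<xi> $ i)" for i j
      using jacobian_D_D[OF \<phi> Ref_dom_subset_layer e]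
      by (intro Bochner_Integration.integral_cong) (auto simp flip: mult.assoc)
    then have "(\<Sum>i\<in>UNIV. \<Sum>j\<in>UNIV. LINT \<xi>|lebesgue_on ?\<Omega>. e * (jacobian e \<xi> * D e j (D e j (\<phi> i)) \<xi> * U \<xi> $ i))
        = (\<Sum>i\<in>UNIV. \<Sum>j\<in>UNIV. LINT \<xi>|lebesgue_on ?\<Omega>. ?q i j \<xi> * U \<xi> $ i)"
      by simp
    also have "\<dots> = (LINT \<xi>|lebesgue_on ?\<Omega>. (\<Sum>i\<in>UNIV. \<Sum>j\<in>UNIV. ?q i j \<xi> * U \<xi> $ i))"
      using per_test_integrable[OF UiL qt] by simp
    also have "\<dots> = (LINT \<xi>|lebesgue_on ?\<Omega>. U \<xi> \<bullet> (\<Sum>k\<le>2. e ^ k *\<^sub>R w k \<xi>))"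
    proof (rule Bochner_Integration.integral_cong[OF refl])
      fix \<xi>
      have "(\<Sum>k\<le>2. e ^ k *\<^sub>R w k \<xi>) $ i = (\<Sum>j\<in>UNIV. ?q i j \<xi>)" for i
        unfolding sum_component w_def by (simp add: sum_distrib_left sum.swap[of _ UNIV])
      then show "(\<Sum>i\<in>UNIV. \<Sum>j\<in>UNIV. ?q i j \<xi> * U \<xi> $ i) = U \<xi> \<bullet> (\<Sum>k\<le>2. e ^ k *\<^sub>R w k \<xi>)"
        unfolding inner_vec_def by (simp add: sum_distrib_left mult.commute)
    qed
    finally have m: "(\<Sum>i\<in>UNIV. \<Sum>j\<in>UNIV. LINT \<xi>|lebesgue_on ?\<Omega>. e * (jacobian e \<xi> * D e j (D e j (\<phi> i)) \<xi> * U \<xi> $ i))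
        = (LINT \<xi>|lebesgue_on ?\<Omega>. U \<xi> \<bullet> (\<Sum>k\<le>2. e ^ k *\<^sub>R w k \<xi>))" .
    have "e * (\<Sum>i\<in>UNIV. LINT \<xi>|lebesgue_on ?\<Omega>. jacobian e \<xi> * D e i (\<phi> i) \<xi> * P \<xi>)
        = (LINT \<xi>|lebesgue_on ?\<Omega>. e * (\<Sum>i\<in>UNIV. jacobian e \<xi> * D e i (\<phi> i) \<xi> * P \<xi>))"
      using per_test_integrable[OF PL JD] by simp
    also have "\<dots> = (LINT \<xi>|lebesgue_on ?\<Omega>. (e\<^sup>2 * P \<xi>) \<bullet> (\<Sum>k\<le>1. e ^ k *\<^sub>R z k \<xi>))"
    proof (rule Bochner_Integration.integral_cong[OF refl])
      fix \<xi> assume "\<xi> \<in> space (lebesgue_on ?\<Omega>)"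
      then have \<xi>: "\<xi> \<in> layer a b" by (simp add: Ref_dom_subset_layer)
      have r: "radius e \<xi> \<noteq> 0" using radius_pos[OF \<xi> e] by simp
      have "(\<Sum>i\<in>UNIV. D e i (\<phi> i) \<xi>) = (\<Sum>i\<in>UNIV. A i (\<phi> i) \<xi>) / e + (\<Sum>i\<in>UNIV. B i (\<phi> i) \<xi>) / radius e \<xi>"
        by (simp add: D_def sum.distrib sum_divide_distrib)
      \<comment> \<open>The \<open>A\<close> sum would leave only one factor e in front of the
        pressure, and it is zero; the \<open>B\<close> sum comes with the e^2 that makes the
        pressure converge.\<close>
      then have "e * (jacobian e \<xi> * (\<Sum>i\<in>UNIV. D e i (\<phi> i) \<xi>)) = e\<^sup>2 * (radius e \<xi> * (H \<xi> * sin (\<xi>$1) * (\<Sum>i\<in>UNIV. B i (\<phi> i) \<xi>)))"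
        using r e by (simp add: tangential[OF \<xi>] jacobian_def field_simps power2_eq_square)
      also have "\<dots> = e\<^sup>2 * (\<Sum>k\<le>1. e ^ k *\<^sub>R z k \<xi>)"
        by (simp add: z_def radius_def algebra_simps)
      finally have "e * (jacobian e \<xi> * (\<Sum>i\<in>UNIV. D e i (\<phi> i) \<xi>)) * P \<xi> = e\<^sup>2 * (\<Sum>k\<le>1. e ^ k *\<^sub>R z k \<xi>) * P \<xi>"
        by simp
      then show "e * (\<Sum>i\<in>UNIV. jacobian e \<xi> * D e i (\<phi> i) \<xi> * P \<xi>) = (e\<^sup>2 * P \<xi>) \<bullet> (\<Sum>k\<le>1. e ^ k *\<^sub>R z k \<xi>)"
        by (simp only: sum_distrib_left sum_distrib_right inner_real_def mult_ac)
    qed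
    finally have pr: "e * (\<Sum>i\<in>UNIV. LINT \<xi>|lebesgue_on ?\<Omega>. jacobian e \<xi> * D e i (\<phi> i) \<xi> * P \<xi>)
        = (LINT \<xi>|lebesgue_on ?\<Omega>. (e\<^sup>2 * P \<xi>) \<bullet> (\<Sum>k\<le>1. e ^ k *\<^sub>R z k \<xi>))" .
    from main[unfolded m pr] show ?thesis unfolding U_def P_def e_def .
  qed
  have "(\<lambda>n. \<mu> * (LINT \<xi>|lebesgue_on ?\<Omega>. u n (\<Phi> (\<epsilon> n) \<xi>) \<bullet> (\<Sum>k\<le>2. \<epsilon> n ^ k *\<^sub>R w k \<xi>))
      + (LINT \<xi>|lebesgue_on ?\<Omega>. ((\<epsilon> n)\<^sup>2 * p n (\<Phi> (\<epsilon> n) \<xi>)) \<bullet> (\<Sum>k\<le>1. \<epsilon> n ^ k *\<^sub>R z k \<xi>)))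
    \<longlonglongrightarrow> \<mu> * (LINT \<xi>|lebesgue_on ?\<Omega>. us \<xi> \<bullet> w 0 \<xi>) + (LINT \<xi>|lebesgue_on ?\<Omega>. ps \<xi> \<bullet> z 0 \<xi>)"
    by (intro tendsto_add tendsto_mult_left L2_weak_conv_polynomial u p eps wL zL) auto
  then show ?thesis unfolding eq by (simp add: LIMSEQ_const_iff w_def z_def)
qed

text \<open>With a single derivative the Jacobian alone clears the denominators: \<open>A\<close>
  carries r^2 and \<open>B\<close> carries \<epsilon> r, so only the transverse part, with R^2,
  survives.\<close>

lemma mass_limit:
  fixes u :: "nat \<Rightarrow> real^3 \<Rightarrow> real^3" and p :: "nat \<Rightarrow> real^3 \<Rightarrow> real"
  assumes eps: "\<And>n. \<epsilon> n > 0" "\<epsilon> \<longlonglongrightarrow> 0"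
    and st: "\<And>n. stokes_equations \<mu> (Shell_dom R h a b (\<epsilon> n)) (u n) (p n)"
    and u: "L2_weak_conv (Ref_dom a b) (\<lambda>n \<xi>. u n (\<Phi> (\<epsilon> n) \<xi>)) us"
    and \<phi>: "\<phi> \<in> per_test a b"
  shows "(LINT \<xi>|lebesgue_on (Ref_dom a b). us \<xi> \<bullet> (\<chi> i. H \<xi> * sin (\<xi>$1) * (R\<^sup>2 * A i \<phi> \<xi>))) = 0"
proof -
  let ?\<Omega> = "Ref_dom a b"
  define s where "s = (\<lambda>k i \<xi>. H \<xi> * sin (\<xi>$1) * (if k = 0 then R\<^sup>2 * A i \<phi> \<xi>
      else if k = (1::nat) then 2 * R * (\<xi>$3 * H \<xi>) * A i \<phi> \<xi> + R * B i \<phi> \<xi>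
      else \<xi>$3 * H \<xi> * (\<xi>$3 * H \<xi> * A i \<phi> \<xi>) + \<xi>$3 * H \<xi> * B i \<phi> \<xi>))"
  define w :: "nat \<Rightarrow> real^3 \<Rightarrow> real^3" where "w = (\<lambda>k \<xi>. \<chi> i. s k i \<xi>)"
  have c: "(\<lambda>\<xi>. H \<xi> * sin (\<xi>$1)) \<in> periodic_coeff (slab a b)" "(\<lambda>\<xi>. \<xi>$3 * H \<xi>) \<in> periodic_coeff (slab a b)"
    "(\<lambda>\<xi>. 2 * R * (\<xi>$3 * H \<xi>)) \<in> periodic_coeff (slab a b)" "(\<lambda>\<xi>. x) \<in> periodic_coeff (slab a b)" for x :: real
    by (intro periodic_coeff_mult H_coeff per_smooth_coeff sin_per_smooth coord_per_smooth const_per_smooth; simp)+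
  note P = slab_coeff_tests[OF c(1)] slab_coeff_tests[OF c(2)] slab_coeff_tests[OF c(3)] slab_coeff_tests[OF c(4)]
  have st': "s k i \<in> per_test a b" for k i
  proof -
    consider "k = 0" | "k = 1" | "k \<noteq> 0" "k \<noteq> 1" by blast
    then show ?thesis
      by cases (auto simp: s_def intro!: P per_test_add A_per_test B_per_test \<phi>)
  qed
  have wL: "L2 ?\<Omega> (w k)" for k unfolding w_def by (intro L2_per_test_vec st')
  have eq: "(LINT \<xi>|lebesgue_on ?\<Omega>. u n (\<Phi> (\<epsilon> n) \<xi>) \<bullet> (\<Sum>k\<le>2. \<epsilon> n ^ k *\<^sub>R w k \<xi>)) = 0" for n
  proof -
    define e where "e = \<epsilon> n"
    define U where "U = (\<lambda>\<xi>. u n (\<Phi> e \<xi>))"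
    have e: "e > 0" using eps by (simp add: e_def)
    have UL: "L2 ?\<Omega> U" using u by (simp add: L2_weak_conv_def U_def e_def)
    have UiL: "L2 ?\<Omega> (\<lambda>\<xi>. U \<xi> $ i)" for i by (rule L2_vec_nth[OF UL])
    have JD: "(\<lambda>\<xi>. jacobian e \<xi> * D e i \<phi> \<xi>) \<in> per_test a b" for i
      by (intro jacobian_per_test D_per_test \<phi> e)
    have "0 = (\<Sum>i\<in>UNIV. LINT \<xi>|lebesgue_on ?\<Omega>. jacobian e \<xi> * D e i \<phi> \<xi> * U \<xi> $ i)"
      using stokes_pulled_back(2)[OF st[of n] eps(1) _ \<phi>] UL by (simp add: U_def e_def)
    also have "\<dots> = (LINT \<xi>|lebesgue_on ?\<Omega>. (\<Sum>i\<in>UNIV. jacobian e \<xi> * D e i \<phi> \<xi> * U \<xi> $ i))"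
      using per_test_integrable[OF UiL JD] by simp
    also have "\<dots> = (LINT \<xi>|lebesgue_on ?\<Omega>. U \<xi> \<bullet> (\<Sum>k\<le>2. e ^ k *\<^sub>R w k \<xi>))"
    proof (rule Bochner_Integration.integral_cong[OF refl])
      fix \<xi> assume "\<xi> \<in> space (lebesgue_on ?\<Omega>)"
      then have \<xi>: "\<xi> \<in> layer a b" by (simp add: Ref_dom_subset_layer)
      have r: "radius e \<xi> \<noteq> 0" using radius_pos[OF \<xi> e] by simp
      have "jacobian e \<xi> * D e i \<phi> \<xi> = (\<Sum>k\<le>2. e ^ k *\<^sub>R w k \<xi>) $ i" for i
      proof -
        have "jacobian e \<xi> * D e i \<phi> \<xi> = H \<xi> * sin (\<xi>$1) * ((radius e \<xi>)\<^sup>2 * A i \<phi> \<xi> + e * radius e \<xi> * B i \<phi> \<xi>)"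
          using r e by (simp add: D_def jacobian_def field_simps power2_eq_square)
        also have "\<dots> = s 0 i \<xi> + e * s 1 i \<xi> + e\<^sup>2 * s 2 i \<xi>"
          unfolding radius_def s_def by (simp add: algebra_simps power2_eq_square)
        also have "\<dots> = (\<Sum>k\<le>2. e ^ k *\<^sub>R w k \<xi>) $ i"
          by (simp add: w_def numeral_2_eq_2)
        finally show ?thesis .
      qed
      then show "(\<Sum>i\<in>UNIV. jacobian e \<xi> * D e i \<phi> \<xi> * U \<xi> $ i) = U \<xi> \<bullet> (\<Sum>k\<le>2. e ^ k *\<^sub>R w k \<xi>)"
        unfolding inner_vec_def by (simp add: mult.commute)
    qed
    finally show ?thesis by (simp add: U_def e_def)
  qed
  have "(\<lambda>n. LINT \<xi>|lebesgue_on ?\<Omega>. u n (\<Phi> (\<epsilon> n) \<xi>) \<bullet> (\<Sum>k\<le>2. \<epsilon> n ^ k *\<^sub>R w k \<xi>))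
    \<longlonglongrightarrow> (LINT \<xi>|lebesgue_on ?\<Omega>. us \<xi> \<bullet> w 0 \<xi>)"
    by (intro L2_weak_conv_polynomial u eps wL) auto
  then show ?thesis unfolding eq by (simp add: LIMSEQ_const_iff w_def s_def)
qed

section \<open>The Reynolds system in the limit\<close>

text \<open>Only the restriction to a line matters, on which c is constant; so c may fail to be
  differentiable in the other directions, as H can outside the slab.\<close>

lemma pderiv3_3_mult:
  fixes f :: "real^3 \<Rightarrow> real"
  assumes "\<And>t. c (\<xi> + t *\<^sub>R axis 3 1) = c \<xi>" "f differentiable (at \<xi>)"
  shows "pderiv3 3 (\<lambda>\<xi>. c \<xi> * f \<xi>) \<xi> = c \<xi> * pderiv3 3 f \<xi>"
proof -
  have "((\<lambda>t. f (\<xi> + t *\<^sub>R axis 3 1)) has_real_derivative pderiv3 3 f \<xi>) (at 0)"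
    using has_vector_derivative_line[of f \<xi> 0 "axis 3 1"] assms(2)
    by (simp add: has_real_derivative_iff_has_vector_derivative)
  from DERIV_cmult[OF this, of "c \<xi>"] show ?thesis
    unfolding dir_deriv_def assms(1)
    by (intro vector_derivative_at) (simp add: has_real_derivative_iff_has_vector_derivative dir_deriv_def)
qed

lemma frame_H_shift3:
  "e_phi (\<xi> + t *\<^sub>R axis 3 1) = e_phi \<xi>" "e_theta (\<xi> + t *\<^sub>R axis 3 1) = e_theta \<xi>"
  "e_rho (\<xi> + t *\<^sub>R axis 3 1) = e_rho \<xi>" "H (\<xi> + t *\<^sub>R axis 3 1) = H \<xi>"
  "sin ((\<xi> + t *\<^sub>R axis 3 1) $ 1) = sin (\<xi>$1)"
  by (auto simp: e_phi_def e_theta_def e_rho_def H_def axis_component)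

text \<open>The two transverse derivatives give 1/H^2 and the rescaled Jacobian gives H sin \<xi>_1.
  This factor compensates both, so the viscous term becomes \<partial>_3^2 \<eta> without variable
  coefficients.\<close>

definition weight :: "(real^3 \<Rightarrow> real) \<Rightarrow> real^3 \<Rightarrow> real" where
  "weight \<eta> \<xi> = H \<xi> / sin (\<xi>$1) * \<eta> \<xi>"

lemma weight_per_test: "\<eta> \<in> per_test a b \<Longrightarrow> weight \<eta> \<in> per_test a b"
  unfolding weight_def[abs_def]
  by (intro slab_coeff_tests periodic_coeff_divide H_coeff per_smooth_coeff sin_per_smooth) (use sin_pos in force)+

lemma pderiv3_3_weight: "\<eta> differentiable (at \<xi>) \<Longrightarrow> pderiv3 3 (weight \<eta>) \<xi> = H \<xi> / sin (\<xi>$1) * pderiv3 3 \<eta> \<xi>"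
  unfolding weight_def[abs_def] by (rule pderiv3_3_mult) (simp_all add: frame_H_shift3 axis_component)

text \<open>The limit mass balance, tested with \<eta>/sin \<xi>_1 to cancel the remaining
  coefficient: H is already cancelled by the 1/H in \<open>A\<close>.\<close>

lemma radial_limit:
  fixes u :: "nat \<Rightarrow> real^3 \<Rightarrow> real^3" and p :: "nat \<Rightarrow> real^3 \<Rightarrow> real"
  assumes eps: "\<And>n. \<epsilon> n > 0" "\<epsilon> \<longlonglongrightarrow> 0"
    and st: "\<And>n. stokes_equations \<mu> (Shell_dom R h a b (\<epsilon> n)) (u n) (p n)"
    and u: "L2_weak_conv (Ref_dom a b) (\<lambda>n \<xi>. u n (\<Phi> (\<epsilon> n) \<xi>)) us"
    and \<eta>: "\<eta> \<in> per_test a b"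
  shows "(LINT \<xi>|lebesgue_on (Ref_dom a b). (us \<xi> \<bullet> e_rho \<xi>) * pderiv3 3 \<eta> \<xi>) = 0"
proof -
  define \<phi> where "\<phi> = (\<lambda>\<xi>. 1 / sin (\<xi>$1) * \<eta> \<xi>)"
  have \<phi>: "\<phi> \<in> per_test a b" unfolding \<phi>_def
    by (intro slab_coeff_tests periodic_coeff_divide per_smooth_coeff sin_per_smooth const_per_smooth \<eta>) (use sin_pos in force)
  have \<phi>3: "pderiv3 3 \<phi> \<xi> = 1 / sin (\<xi>$1) * pderiv3 3 \<eta> \<xi>" for \<xi>
    unfolding \<phi>_def by (rule pderiv3_3_mult) (simp_all add: axis_component per_test_differentiable[OF \<eta>])
  have "0 = (LINT \<xi>|lebesgue_on (Ref_dom a b). us \<xi> \<bullet> (\<chi> i. H \<xi> * sin (\<xi>$1) * (R\<^sup>2 * A i \<phi> \<xi>)))"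
    using mass_limit[OF eps st u \<phi>] by simp
  also have "\<dots> = (LINT \<xi>|lebesgue_on (Ref_dom a b). R\<^sup>2 * ((us \<xi> \<bullet> e_rho \<xi>) * pderiv3 3 \<eta> \<xi>))"
  proof (rule Bochner_Integration.integral_cong[OF refl])
    fix \<xi> assume "\<xi> \<in> space (lebesgue_on (Ref_dom a b))"
    then have s: "\<xi> \<in> slab a b" by (simp add: Ref_dom_subset_layer layer_subset_slab)
    have "(\<chi> i. H \<xi> * sin (\<xi>$1) * (R\<^sup>2 * A i \<phi> \<xi>)) = (R\<^sup>2 * pderiv3 3 \<eta> \<xi>) *\<^sub>R e_rho \<xi>"
      using H_pos[OF s] sin_pos[OF s] by (simp add: vec_eq_iff A_def \<phi>3)
    then show "us \<xi> \<bullet> (\<chi> i. H \<xi> * sin (\<xi>$1) * (R\<^sup>2 * A i \<phi> \<xi>)) = R\<^sup>2 * ((us \<xi> \<bullet> e_rho \<xi>) * pderiv3 3 \<eta> \<xi>)"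
      by simp
  qed
  finally show ?thesis using R_pos by simp
qed

text \<open>The field c times \<open>weight \<eta>\<close> is orthogonal to \<open>e_rho\<close>, so
  the transverse divergence vanishes. The Laplacian reduces to the sum over j of the squared
  components of \<open>e_rho\<close>, which is 1, times \<partial>_3^2.\<close>

lemma tangential_limit:
  fixes u :: "nat \<Rightarrow> real^3 \<Rightarrow> real^3" and p :: "nat \<Rightarrow> real^3 \<Rightarrow> real" and c :: "real^3 \<Rightarrow> real^3"
  assumes eps: "\<And>n. \<epsilon> n > 0" "\<epsilon> \<longlonglongrightarrow> 0"
    and st: "\<And>n. stokes_equations \<mu> (Shell_dom R h a b (\<epsilon> n)) (u n) (p n)"
    and u: "L2_weak_conv (Ref_dom a b) (\<lambda>n \<xi>. u n (\<Phi> (\<epsilon> n) \<xi>)) us"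
    and p: "L2_weak_conv (Ref_dom a b) (\<lambda>n \<xi>. (\<epsilon> n)\<^sup>2 * p n (\<Phi> (\<epsilon> n) \<xi>)) ps"
    and c: "c \<in> per_smooth" "\<And>\<xi> t. c (\<xi> + t *\<^sub>R axis 3 1) = c \<xi>" "\<And>\<xi>. e_rho \<xi> \<bullet> c \<xi> = 0"
    and \<eta>: "\<eta> \<in> per_test a b"
  shows "\<mu> * R * (LINT \<xi>|lebesgue_on (Ref_dom a b). (us \<xi> \<bullet> c \<xi>) * pderiv3 3 (pderiv3 3 \<eta>) \<xi>)
    + (LINT \<xi>|lebesgue_on (Ref_dom a b). ps \<xi> * (H \<xi> * sin (\<xi>$1) * (\<Sum>i\<in>UNIV. B i (\<lambda>\<xi>. c \<xi> $ i * weight \<eta> \<xi>) \<xi>))) = 0"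
proof -
  define \<phi> where "\<phi> = (\<lambda>i \<xi>. c \<xi> $ i * weight \<eta> \<xi>)"
  have g: "weight \<eta> \<in> per_test a b" by (rule weight_per_test[OF \<eta>])
  have \<phi>: "\<phi> i \<in> per_test a b" for i
    unfolding \<phi>_def by (intro per_test_mult vec_nth_per_smooth c g)
  have \<phi>3: "pderiv3 3 (\<phi> i) \<xi> = (c \<xi> $ i * (H \<xi> / sin (\<xi>$1))) * pderiv3 3 \<eta> \<xi>" for i \<xi>
    unfolding \<phi>_def using pderiv3_3_mult[of "\<lambda>\<xi>. c \<xi> $ i" \<xi> "weight \<eta>"]
    by (simp add: c(2) per_test_differentiable[OF g] pderiv3_3_weight per_test_differentiable[OF \<eta>])
  have A: "A j (\<phi> i) \<xi> = (e_rho \<xi> $ j * c \<xi> $ i * (1 / sin (\<xi>$1))) * pderiv3 3 \<eta> \<xi>" for i j \<xi>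
  \<comment> \<open>The identity is needed at every point, since it is differentiated again. H may
    be zero only outside the layer, where \<eta> and its derivatives vanish.\<close>
  proof (cases "H \<xi> = 0")
    case False
    then show ?thesis by (simp add: A_def \<phi>3)
  next
    case True
    then have "\<xi> \<notin> layer a b" using H_pos layer_subset_slab by force
    then have "pderiv3 3 \<eta> \<xi> = 0" using per_test_zero_outside[OF per_test_pderiv3[OF \<eta>]] by blast
    then show ?thesis by (simp add: A_def \<phi>3)
  qed
  have AA: "A j (A j (\<phi> i)) \<xi> = e_rho \<xi> $ j / H \<xi> * ((e_rho \<xi> $ j * c \<xi> $ i * (1 / sin (\<xi>$1))) * pderiv3 3 (pderiv3 3 \<eta>) \<xi>)" for i j \<xi>
  proof -
    have "A j (\<phi> i) = (\<lambda>\<xi>. (e_rho \<xi> $ j * c \<xi> $ i * (1 / sin (\<xi>$1))) * pderiv3 3 \<eta> \<xi>)" using A by blast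
    then have "pderiv3 3 (A j (\<phi> i)) \<xi> = (e_rho \<xi> $ j * c \<xi> $ i * (1 / sin (\<xi>$1))) * pderiv3 3 (pderiv3 3 \<eta>) \<xi>"
      using pderiv3_3_mult[of "\<lambda>\<xi>. e_rho \<xi> $ j * c \<xi> $ i * (1 / sin (\<xi>$1))" \<xi> "pderiv3 3 \<eta>"]
        per_test_differentiable[OF per_test_pderiv3[OF \<eta>]]
      by (simp only: frame_H_shift3 c(2))
    then show ?thesis by (simp add: A_def[of j "A j (\<phi> i)"])
  qed
  have "(\<Sum>i\<in>UNIV. A i (\<phi> i) \<xi>) = (e_rho \<xi> \<bullet> c \<xi>) * ((1 / sin (\<xi>$1)) * pderiv3 3 \<eta> \<xi>)" for \<xi>
  proof -
    have "A i (\<phi> i) \<xi> = e_rho \<xi> $ i \<bullet> c \<xi> $ i * ((1 / sin (\<xi>$1)) * pderiv3 3 \<eta> \<xi>)" for i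
      by (simp add: A)
    then show ?thesis by (simp only: inner_vec_def sum_distrib_right)
  qed
  then have tang: "(\<Sum>i\<in>UNIV. A i (\<phi> i) \<xi>) = 0" for \<xi> by (simp add: c(3))
  have "us \<xi> \<bullet> (\<chi> i. \<Sum>j\<in>UNIV. T 0 j (\<phi> i) \<xi>) = R\<^sup>2 * ((us \<xi> \<bullet> c \<xi>) * pderiv3 3 (pderiv3 3 \<eta>) \<xi>)" if "\<xi> \<in> Ref_dom a b" for \<xi>
  proof -
    have s: "\<xi> \<in> slab a b" using that by (simp add: Ref_dom_subset_layer layer_subset_slab)
    have "(\<Sum>j\<in>UNIV. T 0 j (\<phi> i) \<xi>) = (e_rho \<xi> \<bullet> e_rho \<xi>) * (R\<^sup>2 * pderiv3 3 (pderiv3 3 \<eta>) \<xi> * c \<xi> $ i)" for i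
    proof -
      have "T 0 j (\<phi> i) \<xi> = e_rho \<xi> $ j \<bullet> e_rho \<xi> $ j * (R\<^sup>2 * pderiv3 3 (pderiv3 3 \<eta>) \<xi> * c \<xi> $ i)" for j
        using H_pos[OF s] sin_pos[OF s] by (simp add: T_def AA mult_ac)
      then show ?thesis by (simp only: inner_vec_def sum_distrib_right)
    qed
    then have "(\<chi> i. \<Sum>j\<in>UNIV. T 0 j (\<phi> i) \<xi>) = (R\<^sup>2 * pderiv3 3 (pderiv3 3 \<eta>) \<xi>) *\<^sub>R c \<xi>"
      by (simp add: vec_eq_iff frame_orthonormal)
    then show ?thesis by simp
  qed
  then have "(LINT \<xi>|lebesgue_on (Ref_dom a b). us \<xi> \<bullet> (\<chi> i. \<Sum>j\<in>UNIV. T 0 j (\<phi> i) \<xi>)) =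
      (LINT \<xi>|lebesgue_on (Ref_dom a b). R\<^sup>2 * ((us \<xi> \<bullet> c \<xi>) * pderiv3 3 (pderiv3 3 \<eta>) \<xi>))"
    by (intro Bochner_Integration.integral_cong) auto
  also have "\<dots> = R\<^sup>2 * (LINT \<xi>|lebesgue_on (Ref_dom a b). (us \<xi> \<bullet> c \<xi>) * pderiv3 3 (pderiv3 3 \<eta>) \<xi>)"
    by (rule integral_mult_right_zero)
  finally have 1: "(LINT \<xi>|lebesgue_on (Ref_dom a b). us \<xi> \<bullet> (\<chi> i. \<Sum>j\<in>UNIV. T 0 j (\<phi> i) \<xi>)) = \<dots>" .
  have 2: "(LINT \<xi>|lebesgue_on (Ref_dom a b). ps \<xi> * (R * (H \<xi> * sin (\<xi>$1) * (\<Sum>i\<in>UNIV. B i (\<phi> i) \<xi>))))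
      = R * (LINT \<xi>|lebesgue_on (Ref_dom a b). ps \<xi> * (H \<xi> * sin (\<xi>$1) * (\<Sum>i\<in>UNIV. B i (\<phi> i) \<xi>)))"
    unfolding mult.left_commute[of _ R] by (rule integral_mult_right_zero)
  have "\<mu> * (R\<^sup>2 * (LINT \<xi>|lebesgue_on (Ref_dom a b). (us \<xi> \<bullet> c \<xi>) * pderiv3 3 (pderiv3 3 \<eta>) \<xi>))
    + R * (LINT \<xi>|lebesgue_on (Ref_dom a b). ps \<xi> * (H \<xi> * sin (\<xi>$1) * (\<Sum>i\<in>UNIV. B i (\<phi> i) \<xi>))) = 0"
    using momentum_limit[OF eps st u p \<phi> tang] unfolding 1 2 .
  then have "R * (\<mu> * R * (LINT \<xi>|lebesgue_on (Ref_dom a b). (us \<xi> \<bullet> c \<xi>) * pderiv3 3 (pderiv3 3 \<eta>) \<xi>)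
    + (LINT \<xi>|lebesgue_on (Ref_dom a b). ps \<xi> * (H \<xi> * sin (\<xi>$1) * (\<Sum>i\<in>UNIV. B i (\<phi> i) \<xi>)))) = 0"
    by (simp add: distrib_left power2_eq_square mult_ac)
  then show ?thesis using R_pos by (simp add: \<phi>_def)
qed

end


section \<open>Surface divergence of the tangential test fields\<close>

context shell
begin

lemma pderiv3_vec_nth:
  assumes "(c has_derivative c') (at \<xi>)"
  shows "pderiv3 j (\<lambda>\<xi>. c \<xi> $ i) \<xi> = c' (axis j 1) $ i"
  by (rule has_derivative_dir_deriv) (rule bounded_linear.has_derivative[OF bounded_linear_vec_nth assms])

text \<open>The product rule for a surface divergence: derivatives of g along the two tangential
  directions, plus g times the divergence of the frame field. A field c with no \<xi>_3-derivative
  is unaffected by the correction terms in \<open>B\<close>.\<close>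

lemma sum_B_tangential:
  assumes c: "(c has_derivative c') (at \<xi>)" "c' (axis 3 1) = 0" and g: "g differentiable (at \<xi>)"
  shows "(\<Sum>i\<in>UNIV. B i (\<lambda>\<xi>. c \<xi> $ i * g \<xi>) \<xi>) =
    (e_phi \<xi> \<bullet> c \<xi>) * (pderiv3 1 g \<xi> - \<xi>$3 * pderiv3 1 H \<xi> / H \<xi> * pderiv3 3 g \<xi>)
    + (e_phi \<xi> \<bullet> c' (axis 1 1)) * g \<xi>
    + ((e_theta \<xi> \<bullet> c \<xi>) * (pderiv3 2 g \<xi> - \<xi>$3 * pderiv3 2 H \<xi> / H \<xi> * pderiv3 3 g \<xi>)
    + (e_theta \<xi> \<bullet> c' (axis 2 1)) * g \<xi>) / sin (\<xi>$1)"
proof -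
  have dc: "(\<lambda>\<xi>. c \<xi> $ i) differentiable (at \<xi>)" for i
    using bounded_linear.has_derivative[OF bounded_linear_vec_nth c(1)] by (auto simp: differentiable_def)
  have d: "pderiv3 j (\<lambda>\<xi>. c \<xi> $ i * g \<xi>) \<xi> = c \<xi> $ i * pderiv3 j g \<xi> + c' (axis j 1) $ i * g \<xi>" for i j
    unfolding dir_deriv_mult[OF dc g] pderiv3_vec_nth[OF c(1)] ..
  show ?thesis
    unfolding B_def d c(2) inner_real3 UNIV_3
    by (simp add: divide_inverse algebra_simps)
qed

lemma pderiv3_H_mult:
  fixes \<eta> :: "real^3 \<Rightarrow> real"
  assumes "\<xi> \<in> slab a b" "\<eta> differentiable (at \<xi>)"
  shows "pderiv3 j (\<lambda>\<xi>. H \<xi> * \<eta> \<xi>) \<xi> = H \<xi> * pderiv3 j \<eta> \<xi> + pderiv3 j H \<xi> * \<eta> \<xi>"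
    "(\<lambda>\<xi>. H \<xi> * \<eta> \<xi>) differentiable (at \<xi>)"
  using assms H_differentiable by (auto intro!: dir_deriv_mult differentiable_mult)

lemma pderiv3_sin_mult:
  fixes \<eta> :: "real^3 \<Rightarrow> real"
  assumes "\<xi> \<in> slab a b" "\<eta> differentiable (at \<xi>)"
  shows "pderiv3 j (\<lambda>\<xi>. \<eta> \<xi> / sin (\<xi>$1)) \<xi> =
      pderiv3 j \<eta> \<xi> / sin (\<xi>$1) - axis j 1 $ 1 * cos (\<xi>$1) * \<eta> \<xi> / (sin (\<xi>$1))\<^sup>2"
    "(\<lambda>\<xi>. \<eta> \<xi> / sin (\<xi>$1)) differentiable (at \<xi>)"
proof -
  have s: "sin (\<xi>$1) \<noteq> 0" using sin_pos[OF assms(1)] by simp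
  have "((\<lambda>\<xi>::real^3. sin (\<xi>$1)) has_derivative (\<lambda>w. w$1 * cos (\<xi>$1))) (at \<xi>)"
    by (rule has_derivative_eq_rhs, (rule derivative_intros bounded_linear_imp_has_derivative[OF bounded_linear_vec_nth])+) simp
  from has_derivative_mult[OF differentiable_frechet_derivative[OF assms(2)] Deriv.has_derivative_inverse[OF s this]]
  have D: "((\<lambda>\<xi>. \<eta> \<xi> / sin (\<xi>$1)) has_derivative (\<lambda>w. \<eta> \<xi> * - (inverse (sin (\<xi>$1)) * (w$1 * cos (\<xi>$1)) * inverse (sin (\<xi>$1)))
      + frechet_derivative \<eta> (at \<xi>) w * inverse (sin (\<xi>$1)))) (at \<xi>)"
    by (simp add: divide_inverse)
  show "(\<lambda>\<xi>. \<eta> \<xi> / sin (\<xi>$1)) differentiable (at \<xi>)" using D by (auto simp: differentiable_def)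
  show "pderiv3 j (\<lambda>\<xi>. \<eta> \<xi> / sin (\<xi>$1)) \<xi> =
      pderiv3 j \<eta> \<xi> / sin (\<xi>$1) - axis j 1 $ 1 * cos (\<xi>$1) * \<eta> \<xi> / (sin (\<xi>$1))\<^sup>2"
    using has_derivative_dir_deriv[OF D]
    by (simp add: has_derivative_dir_deriv[OF differentiable_frechet_derivative[OF assms(2)]] divide_inverse power2_eq_square)
qed

lemma weight_eq: "weight \<eta> = (\<lambda>\<xi>. (H \<xi> * \<eta> \<xi>) / sin (\<xi>$1))"
  by (simp add: fun_eq_iff weight_def)

text \<open>The cotangent from the frame cancels the derivative of 1/sin \<xi>_1 in
  \<open>weight\<close>. Completing H \<partial>_1(H \<eta>) to \<partial>_1(H^2 \<eta>) leaves a
  remainder that combines with the slope term of \<open>B\<close> into a pure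
  \<xi>_3-derivative.\<close>

lemma sum_B_phi:
  assumes \<xi>: "\<xi> \<in> slab a b" and \<eta>: "\<eta> \<in> per_test a b"
  shows "H \<xi> * sin (\<xi>$1) * (\<Sum>i\<in>UNIV. B i (\<lambda>\<xi>. e_phi \<xi> $ i * weight \<eta> \<xi>) \<xi>) =
    pderiv3 1 (\<lambda>\<xi>. (H \<xi>)\<^sup>2 * \<eta> \<xi>) \<xi> - pderiv3 3 (\<lambda>\<xi>. \<xi>$3 * (H \<xi> * pderiv3 1 H \<xi> * \<eta> \<xi>)) \<xi>"
proof -
  note d\<eta> = per_test_differentiable[OF \<eta>, of \<xi>]
  note g = pderiv3_sin_mult[OF \<xi> pderiv3_H_mult(2)[OF \<xi> d\<eta>], folded weight_eq]
  have s: "sin (\<xi>$1) \<noteq> 0" and h: "H \<xi> \<noteq> 0" using sin_pos[OF \<xi>] H_pos[OF \<xi>] by auto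
  have 1: "(\<Sum>i\<in>UNIV. B i (\<lambda>\<xi>. e_phi \<xi> $ i * weight \<eta> \<xi>) \<xi>) =
      pderiv3 1 (weight \<eta>) \<xi> - \<xi>$3 * pderiv3 1 H \<xi> / H \<xi> * pderiv3 3 (weight \<eta>) \<xi> + cos (\<xi>$1) * weight \<eta> \<xi> / sin (\<xi>$1)"
    by (subst sum_B_tangential[OF has_derivative_frame(2) _ g(2)]) (simp_all add: axis_component frame_orthonormal)
  have 2: "pderiv3 1 (\<lambda>\<xi>. (H \<xi>)\<^sup>2 * \<eta> \<xi>) \<xi> = 2 * H \<xi> * pderiv3 1 H \<xi> * \<eta> \<xi> + (H \<xi>)\<^sup>2 * pderiv3 1 \<eta> \<xi>"
    using pderiv3_H_mult(1)[OF \<xi> pderiv3_H_mult(2)[OF \<xi> d\<eta>], of 1] pderiv3_H_mult(1)[OF \<xi> d\<eta>, of 1]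
    by (simp add: power2_eq_square mult.assoc algebra_simps)
  have l: "\<xi> + t *\<^sub>R axis 3 1 + s *\<^sub>R axis j 1 = (\<xi> + s *\<^sub>R axis j 1) + t *\<^sub>R axis 3 1" for t s and j :: 3
    by simp
  have H1: "pderiv3 1 H (\<xi> + t *\<^sub>R axis 3 1) = pderiv3 1 H \<xi>" for t
    unfolding dir_deriv_def l frame_H_shift3 ..
  have 3: "pderiv3 3 (\<lambda>\<xi>. \<xi>$3 * (H \<xi> * pderiv3 1 H \<xi> * \<eta> \<xi>)) \<xi> =
      H \<xi> * pderiv3 1 H \<xi> * (\<xi>$3 * pderiv3 3 \<eta> \<xi> + \<eta> \<xi>)"
  proof -
    have c3: "(\<lambda>\<xi>::real^3. \<xi>$3) differentiable (at \<xi>)"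
      by (rule smooth_on_differentiable[of UNIV]) (auto intro: smooth_on_coord)
    have "pderiv3 3 (\<lambda>\<xi>. H \<xi> * pderiv3 1 H \<xi> * (\<xi>$3 * \<eta> \<xi>)) \<xi> = H \<xi> * pderiv3 1 H \<xi> * pderiv3 3 (\<lambda>\<xi>. \<xi>$3 * \<eta> \<xi>) \<xi>"
      by (rule pderiv3_3_mult) (simp_all add: frame_H_shift3 H1 c3 d\<eta> differentiable_mult)
    moreover have "pderiv3 3 (\<lambda>\<xi>. \<xi>$3 * \<eta> \<xi>) \<xi> = \<xi>$3 * pderiv3 3 \<eta> \<xi> + \<eta> \<xi>"
      using dir_deriv_mult[OF c3 d\<eta>] by (simp add: dir_deriv_coord axis_component)
    ultimately show ?thesis by (simp add: mult.left_commute)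
  qed
  show ?thesis
    unfolding 1 unfolding 2 3 g(1) pderiv3_H_mult(1)[OF \<xi> d\<eta>] pderiv3_H_3 weight_def using s h
    by (simp add: axis_component field_simps power2_eq_square)
qed

text \<open>As for \<open>e_phi\<close>, but sin \<xi>_1 is constant in \<xi>_2 and \<partial>_2
  \<open>e_theta\<close> is orthogonal to \<open>e_theta\<close>, so no cotangent arises.\<close>

lemma sum_B_theta:
  assumes \<xi>: "\<xi> \<in> slab a b" and \<eta>: "\<eta> \<in> per_test a b"
  shows "H \<xi> * sin (\<xi>$1) * (\<Sum>i\<in>UNIV. B i (\<lambda>\<xi>. e_theta \<xi> $ i * weight \<eta> \<xi>) \<xi>) =
    pderiv3 2 (\<lambda>\<xi>. (H \<xi>)\<^sup>2 / sin (\<xi>$1) * \<eta> \<xi>) \<xi> - pderiv3 3 (\<lambda>\<xi>. \<xi>$3 * (H \<xi> * pderiv3 2 H \<xi> / sin (\<xi>$1) * \<eta> \<xi>)) \<xi>"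
proof -
  note d\<eta> = per_test_differentiable[OF \<eta>, of \<xi>]
  note HH = pderiv3_H_mult[OF \<xi> pderiv3_H_mult(2)[OF \<xi> d\<eta>]]
  note g = pderiv3_sin_mult[OF \<xi> pderiv3_H_mult(2)[OF \<xi> d\<eta>], folded weight_eq]
  have s: "sin (\<xi>$1) \<noteq> 0" and h: "H \<xi> \<noteq> 0" using sin_pos[OF \<xi>] H_pos[OF \<xi>] by auto
  have 1: "(\<Sum>i\<in>UNIV. B i (\<lambda>\<xi>. e_theta \<xi> $ i * weight \<eta> \<xi>) \<xi>) =
      (pderiv3 2 (weight \<eta>) \<xi> - \<xi>$3 * pderiv3 2 H \<xi> / H \<xi> * pderiv3 3 (weight \<eta>) \<xi>) / sin (\<xi>$1)"
    by (subst sum_B_tangential[OF has_derivative_frame(3) _ g(2)])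
      (simp_all add: axis_component frame_orthonormal inner_diff_right)
  have "(\<lambda>\<xi>. (H \<xi>)\<^sup>2 / sin (\<xi>$1) * \<eta> \<xi>) = (\<lambda>\<xi>. H \<xi> * (H \<xi> * \<eta> \<xi>) / sin (\<xi>$1))"
    by (simp add: fun_eq_iff power2_eq_square)
  then have 2: "pderiv3 2 (\<lambda>\<xi>. (H \<xi>)\<^sup>2 / sin (\<xi>$1) * \<eta> \<xi>) \<xi> =
      (2 * H \<xi> * pderiv3 2 H \<xi> * \<eta> \<xi> + (H \<xi>)\<^sup>2 * pderiv3 2 \<eta> \<xi>) / sin (\<xi>$1)"
    using pderiv3_sin_mult(1)[OF \<xi> HH(2), of 2] HH(1)[of 2] pderiv3_H_mult(1)[OF \<xi> d\<eta>, of 2]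
    by (simp add: power2_eq_square mult.assoc algebra_simps axis_component)
  have l: "\<xi> + t *\<^sub>R axis 3 1 + s *\<^sub>R axis j 1 = (\<xi> + s *\<^sub>R axis j 1) + t *\<^sub>R axis 3 1" for t s and j :: 3
    by simp
  have H2: "pderiv3 2 H (\<xi> + t *\<^sub>R axis 3 1) = pderiv3 2 H \<xi>" for t
    unfolding dir_deriv_def l frame_H_shift3 ..
  have 3: "pderiv3 3 (\<lambda>\<xi>. \<xi>$3 * (H \<xi> * pderiv3 2 H \<xi> / sin (\<xi>$1) * \<eta> \<xi>)) \<xi> =
      H \<xi> * pderiv3 2 H \<xi> / sin (\<xi>$1) * (\<xi>$3 * pderiv3 3 \<eta> \<xi> + \<eta> \<xi>)"
  proof -
    have c3: "(\<lambda>\<xi>::real^3. \<xi>$3) differentiable (at \<xi>)"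
      by (rule smooth_on_differentiable[of UNIV]) (auto intro: smooth_on_coord)
    have "pderiv3 3 (\<lambda>\<xi>. H \<xi> * pderiv3 2 H \<xi> / sin (\<xi>$1) * (\<xi>$3 * \<eta> \<xi>)) \<xi>
        = H \<xi> * pderiv3 2 H \<xi> / sin (\<xi>$1) * pderiv3 3 (\<lambda>\<xi>. \<xi>$3 * \<eta> \<xi>) \<xi>"
      by (rule pderiv3_3_mult) (simp_all add: frame_H_shift3(4) H2 c3 d\<eta> differentiable_mult axis_component)
    moreover have "pderiv3 3 (\<lambda>\<xi>. \<xi>$3 * \<eta> \<xi>) \<xi> = \<xi>$3 * pderiv3 3 \<eta> \<xi> + \<eta> \<xi>"
      using dir_deriv_mult[OF c3 d\<eta>] by (simp add: dir_deriv_coord axis_component)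
    ultimately show ?thesis by (simp add: mult.left_commute)
  qed
  show ?thesis
    unfolding 1 unfolding 2 3 g(1) pderiv3_H_mult(1)[OF \<xi> d\<eta>] pderiv3_H_3 weight_def using s h
    by (simp add: axis_component field_simps power2_eq_square)
qed

end

text \<open>g is a smooth lift of the boundary values of the component along c. Subtracting it
  cancels the boundary integrals, and the difference integrates by parts like a function with zero
  boundary values; its derivative is D \<bullet> c minus \<partial>_3 g.\<close>

lemma traced_component:
  fixes f :: "real^3 \<Rightarrow> real^3" and c :: "real^3 \<Rightarrow> real^3" and g :: "real^3 \<Rightarrow> real"
  assumes tr: "has_trace per_smooth (Ref_dom a b) {3} (face3_params a b) (face3 0) f f0"
    "has_trace per_smooth (Ref_dom a b) {3} (face3_params a b) (face3 1) f (\<lambda>y. 0)"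
    and c: "smooth_on UNIV c" "\<And>\<xi> t. c (\<xi> + t *\<^sub>R axis 3 1) = c \<xi>"
    and g: "smooth_on UNIV g" "\<And>y. g (face3 0 y) = f0 y \<bullet> c (face3 0 y)" "\<And>y. g (face3 1 y) = 0"
  obtains d where "L2 (Ref_dom a b) d" "L2 (Ref_dom a b) (\<lambda>\<xi>. f \<xi> \<bullet> c \<xi> - g \<xi>)"
    "\<And>\<eta>. smooth_on UNIV \<eta> \<Longrightarrow> (LINT \<xi>|lebesgue_on (Ref_dom a b). (f \<xi> \<bullet> c \<xi> - g \<xi>) * pderiv3 3 \<eta> \<xi>)
      = - (LINT \<xi>|lebesgue_on (Ref_dom a b). d \<xi> * \<eta> \<xi>)"
proof -
  let ?\<Omega> = "Ref_dom a b" and ?Q = "face3_params a b"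
  obtain D where D: "L2 ?\<Omega> D" "\<And>\<Theta>. smooth_on UNIV \<Theta> \<Longrightarrow>
      (LINT x|lebesgue_on ?\<Omega>. f x \<bullet> pderiv3 3 \<Theta> x) + (LINT x|lebesgue_on ?\<Omega>. D x \<bullet> \<Theta> x)
        = - (LINT y|lebesgue_on ?Q. f0 y \<bullet> \<Theta> (face3 0 y))"
    using two_traces_integral_by_parts[OF tr] by blast
  have fL: "L2 ?\<Omega> f" using tr(1) by (auto simp: has_trace_def L2_conv_def)
  have cc: "continuous_on UNIV c" and cg: "continuous_on UNIV g" "continuous_on UNIV (pderiv3 3 g)"
    using c g smooth_on_continuous_on smooth_on_pderiv3 by blast+
  have L: "L2 ?\<Omega> (\<lambda>\<xi>. f \<xi> \<bullet> c \<xi>)" "L2 ?\<Omega> (\<lambda>\<xi>. D \<xi> \<bullet> c \<xi>)" "L2 ?\<Omega> g" "L2 ?\<Omega> (pderiv3 3 g)"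
    using fL D(1) cc cg by (auto intro!: L2_continuous_inner L2_continuous bounded_Ref_dom)
  show ?thesis
  proof (rule that)
    show "L2 ?\<Omega> (\<lambda>\<xi>. D \<xi> \<bullet> c \<xi> - pderiv3 3 g \<xi>)" "L2 ?\<Omega> (\<lambda>\<xi>. f \<xi> \<bullet> c \<xi> - g \<xi>)"
      by (intro L2_diff L)+
    fix \<eta> :: "real^3 \<Rightarrow> real" assume \<eta>: "smooth_on UNIV \<eta>"
    have c\<eta>: "continuous_on UNIV \<eta>" "continuous_on UNIV (pderiv3 3 \<eta>)"
      using \<eta> smooth_on_continuous_on smooth_on_pderiv3 by blast+
    have int: "integrable (lebesgue_on ?\<Omega>) (\<lambda>\<xi>. k \<xi> * l \<xi>)" if "L2 ?\<Omega> k" "continuous_on UNIV l" for k l :: "real^3 \<Rightarrow> real"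
      using L2_continuous_integrable[OF that] by simp
    have d\<eta>: "\<eta> differentiable (at x)" for x using \<eta> smooth_on_differentiable by blast
    have "pderiv3 3 (\<lambda>x. \<eta> x *\<^sub>R c x) x = pderiv3 3 \<eta> x *\<^sub>R c x" for x
    proof -
      have "((\<lambda>t. \<eta> (x + t *\<^sub>R axis 3 1)) has_vector_derivative pderiv3 3 \<eta> x) (at 0)"
        using has_vector_derivative_line[of \<eta> x 0 "axis 3 1"] d\<eta> by simp
      from bounded_linear.has_vector_derivative[OF bounded_linear_scaleR_left this, of "c x"]
      show ?thesis unfolding dir_deriv_def c(2) by (rule vector_derivative_at[unfolded dir_deriv_def])
    qed
    with D(2)[OF smooth_on_scaleR[OF open_UNIV \<eta> c(1)]]
    have 1: "(LINT x|lebesgue_on ?\<Omega>. (f x \<bullet> c x) * pderiv3 3 \<eta> x) + (LINT x|lebesgue_on ?\<Omega>. (D x \<bullet> c x) * \<eta> x)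
        = - (LINT y|lebesgue_on ?Q. (f0 y \<bullet> c (face3 0 y)) * \<eta> (face3 0 y))"
      by (simp add: mult.commute)
    have "pderiv3 3 (\<lambda>x. g x * \<eta> x) x = g x * pderiv3 3 \<eta> x + pderiv3 3 g x * \<eta> x" for x
      using g(1) smooth_on_differentiable d\<eta> by (intro dir_deriv_mult) blast+
    then have 2: "(LINT x|lebesgue_on ?\<Omega>. g x * pderiv3 3 \<eta> x) + (LINT x|lebesgue_on ?\<Omega>. pderiv3 3 g x * \<eta> x)
        = - (LINT y|lebesgue_on ?Q. (f0 y \<bullet> c (face3 0 y)) * \<eta> (face3 0 y))"
      using integral_Ref_dom_pderiv3[OF smooth_on_mult[OF open_UNIV g(1) \<eta>], of a b]
        int[OF L(3) c\<eta>(2)] int[OF L(4) c\<eta>(1)] by (simp add: g(2,3))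
    show "(LINT \<xi>|lebesgue_on ?\<Omega>. (f \<xi> \<bullet> c \<xi> - g \<xi>) * pderiv3 3 \<eta> \<xi>)
        = - (LINT \<xi>|lebesgue_on ?\<Omega>. (D \<xi> \<bullet> c \<xi> - pderiv3 3 g \<xi>) * \<eta> \<xi>)"
      using 1 2 int[OF L(1) c\<eta>(2)] int[OF L(2) c\<eta>(1)] int[OF L(3) c\<eta>(2)] int[OF L(4) c\<eta>(1)]
      by (simp add: left_diff_distrib)
  qed
qed


text \<open>A test function is an element of \<open>H10\<close> through the constant approximating
  sequence. Both modes of convergence then evaluate the same integrals.\<close>

lemma pressure_independent_of_3:
  assumes p: "L2_weak_conv (Ref_dom a b) (\<lambda>n \<xi>. (\<epsilon> n)\<^sup>2 * p n \<xi>) ps"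
    and p3: "Hm1_weak_conv a b (\<lambda>n w. (\<epsilon> n)\<^sup>2 * Hm1_deriv a b 3 (p n) w) (\<lambda>w. 0)"
    and \<eta>: "\<eta> \<in> per_test a b"
  shows "(LINT \<xi>|lebesgue_on (Ref_dom a b). ps \<xi> * pderiv3 3 \<eta> \<xi>) = 0"
proof -
  let ?\<Omega> = "Ref_dom a b"
  have s: "smooth_on UNIV \<eta>" using \<eta> by (simp add: per_test_def per_smooth_def)
  have c: "continuous_on UNIV \<eta>" "continuous_on UNIV (pderiv3 i \<eta>)" for i
    using s smooth_on_continuous_on smooth_on_pderiv3 by blast+
  have L: "L2 ?\<Omega> \<eta>" "L2 ?\<Omega> (pderiv3 3 \<eta>)" "L2 ?\<Omega> (\<lambda>\<xi>. (\<chi> i. pderiv3 i \<eta> \<xi>) :: real^3)"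
    using c by (auto intro!: L2_continuous bounded_Ref_dom continuous_on_vec_lambda)
  then have "(\<eta>, \<lambda>\<xi>. \<chi> i. pderiv3 i \<eta> \<xi>) \<in> H10 a b"
    using \<eta> by (auto simp: H10_def L2_conv_def intro!: exI[of _ "\<lambda>n. \<eta>"])
  then have "(\<lambda>n. (\<epsilon> n)\<^sup>2 * Hm1_deriv a b 3 (p n) (\<eta>, \<lambda>\<xi>. \<chi> i. pderiv3 i \<eta> \<xi>)) \<longlonglongrightarrow> 0"
    using p3 by (auto simp: Hm1_weak_conv_def)
  moreover have "(\<epsilon> n)\<^sup>2 * Hm1_deriv a b 3 (p n) (\<eta>, \<lambda>\<xi>. \<chi> i. pderiv3 i \<eta> \<xi>)
      = - (LINT \<xi>|lebesgue_on ?\<Omega>. (\<epsilon> n)\<^sup>2 * p n \<xi> * pderiv3 3 \<eta> \<xi>)" for n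
    by (simp add: Hm1_deriv_def mult.assoc)
  ultimately have "(\<lambda>n. - (LINT \<xi>|lebesgue_on ?\<Omega>. (\<epsilon> n)\<^sup>2 * p n \<xi> * pderiv3 3 \<eta> \<xi>)) \<longlonglongrightarrow> - 0"
    by simp
  then have "(\<lambda>n. LINT \<xi>|lebesgue_on ?\<Omega>. (\<epsilon> n)\<^sup>2 * p n \<xi> * pderiv3 3 \<eta> \<xi>) \<longlonglongrightarrow> 0"
    by (rule tendsto_minus_cancel)
  moreover have "(\<lambda>n. LINT \<xi>|lebesgue_on ?\<Omega>. (\<epsilon> n)\<^sup>2 * p n \<xi> * pderiv3 3 \<eta> \<xi>)
      \<longlonglongrightarrow> (LINT \<xi>|lebesgue_on ?\<Omega>. ps \<xi> * pderiv3 3 \<eta> \<xi>)"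
    using p L(2) by (simp add: L2_weak_conv_def inner_real_def)
  ultimately show ?thesis by (rule LIMSEQ_unique[symmetric])
qed

section \<open>The limit equation for a tangential velocity component\<close>

context shell
begin

text \<open>The hypothesis \<open>id\<close> is the divergence form from \<open>sum_B_phi\<close> or
  \<open>sum_B_theta\<close>; its \<xi>_3-derivative is annihilated by the pressure, and dividing by
  \<mu> R isolates the velocity.\<close>

lemma reynolds_limit:
  fixes u :: "nat \<Rightarrow> real^3 \<Rightarrow> real^3" and p :: "nat \<Rightarrow> real^3 \<Rightarrow> real" and c :: "real^3 \<Rightarrow> real^3"
  assumes "\<mu> > 0" and eps: "\<And>n. \<epsilon> n > 0" "\<epsilon> \<longlonglongrightarrow> 0"
    and st: "\<And>n. stokes_equations \<mu> (Shell_dom R h a b (\<epsilon> n)) (u n) (p n)"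
    and u: "L2_weak_conv (Ref_dom a b) (\<lambda>n \<xi>. u n (\<Phi> (\<epsilon> n) \<xi>)) us"
    and p: "L2_weak_conv (Ref_dom a b) (\<lambda>n \<xi>. (\<epsilon> n)\<^sup>2 * p n (\<Phi> (\<epsilon> n) \<xi>)) ps"
    and p3: "\<And>\<eta>. \<eta> \<in> per_test a b \<Longrightarrow> (LINT \<xi>|lebesgue_on (Ref_dom a b). ps \<xi> * pderiv3 3 \<eta> \<xi>) = 0"
    and c: "c \<in> per_smooth" "\<And>\<xi> t. c (\<xi> + t *\<^sub>R axis 3 1) = c \<xi>" "\<And>\<xi>. e_rho \<xi> \<bullet> c \<xi> = 0"
    and \<beta>: "\<beta> \<in> periodic_coeff (slab a b)" "\<gamma> \<in> periodic_coeff (slab a b)"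
    and id: "\<And>\<xi>. \<xi> \<in> slab a b \<Longrightarrow> H \<xi> * sin (\<xi>$1) * (\<Sum>i\<in>UNIV. B i (\<lambda>\<xi>. c \<xi> $ i * weight \<eta> \<xi>) \<xi>) =
      pderiv3 i (\<lambda>\<xi>. \<beta> \<xi> * \<eta> \<xi>) \<xi> - pderiv3 3 (\<lambda>\<xi>. \<xi>$3 * (\<gamma> \<xi> * \<eta> \<xi>)) \<xi>"
    and \<eta>: "\<eta> \<in> per_test a b"
  shows "(LINT \<xi>|lebesgue_on (Ref_dom a b). (us \<xi> \<bullet> c \<xi>) * pderiv3 3 (pderiv3 3 \<eta>) \<xi>) =
    - (1 / (\<mu> * R)) * (LINT \<xi>|lebesgue_on (Ref_dom a b). ps \<xi> * pderiv3 i (\<lambda>\<xi>. \<beta> \<xi> * \<eta> \<xi>) \<xi>)"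
proof -
  let ?\<Omega> = "Ref_dom a b"
  have psL: "L2 ?\<Omega> ps" using p by (simp add: L2_weak_conv_def)
  have t: "(\<lambda>\<xi>. \<beta> \<xi> * \<eta> \<xi>) \<in> per_test a b" "(\<lambda>\<xi>. \<xi>$3 * (\<gamma> \<xi> * \<eta> \<xi>)) \<in> per_test a b"
    by (intro per_test_mult slab_coeff_tests \<beta> \<eta> coord_per_smooth; simp)+
  have int: "integrable (lebesgue_on ?\<Omega>) (\<lambda>\<xi>. ps \<xi> * pderiv3 j f \<xi>)" if "f \<in> per_test a b" for f j
    using per_test_integrable[OF psL per_test_pderiv3[OF that]] by (simp add: mult.commute)
  have "(LINT \<xi>|lebesgue_on ?\<Omega>. ps \<xi> * (H \<xi> * sin (\<xi>$1) * (\<Sum>i\<in>UNIV. B i (\<lambda>\<xi>. c \<xi> $ i * weight \<eta> \<xi>) \<xi>)))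
      = (LINT \<xi>|lebesgue_on ?\<Omega>. ps \<xi> * pderiv3 i (\<lambda>\<xi>. \<beta> \<xi> * \<eta> \<xi>) \<xi> - ps \<xi> * pderiv3 3 (\<lambda>\<xi>. \<xi>$3 * (\<gamma> \<xi> * \<eta> \<xi>)) \<xi>)"
    by (intro Bochner_Integration.integral_cong)
      (simp_all add: id Ref_dom_subset_layer layer_subset_slab right_diff_distrib)
  also have "\<dots> = (LINT \<xi>|lebesgue_on ?\<Omega>. ps \<xi> * pderiv3 i (\<lambda>\<xi>. \<beta> \<xi> * \<eta> \<xi>) \<xi>)"
    using int[OF t(1)] int[OF t(2)] p3[OF t(2)] by simp
  finally have "\<mu> * R * (LINT \<xi>|lebesgue_on ?\<Omega>. (us \<xi> \<bullet> c \<xi>) * pderiv3 3 (pderiv3 3 \<eta>) \<xi>)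
      + (LINT \<xi>|lebesgue_on ?\<Omega>. ps \<xi> * pderiv3 i (\<lambda>\<xi>. \<beta> \<xi> * \<eta> \<xi>) \<xi>) = 0"
    using tangential_limit[OF eps st u p c \<eta>] by simp
  then show ?thesis using \<open>\<mu> > 0\<close> R_pos by (simp add: field_simps)
qed

lemma periodic_coeff_H_combinations:
  "(\<lambda>\<xi>. (H \<xi>)\<^sup>2) \<in> periodic_coeff (slab a b)"
  "(\<lambda>\<xi>. (H \<xi>)\<^sup>2 / sin (\<xi>$1)) \<in> periodic_coeff (slab a b)"
  "(\<lambda>\<xi>. H \<xi> * pderiv3 i H \<xi>) \<in> periodic_coeff (slab a b)"
  "(\<lambda>\<xi>. H \<xi> * pderiv3 i H \<xi> / sin (\<xi>$1)) \<in> periodic_coeff (slab a b)"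
  unfolding power2_eq_square
  by (intro periodic_coeff_divide periodic_coeff_mult periodic_coeff_pderiv3 H_coeff per_smooth_coeff sin_per_smooth;
      use sin_pos in force)+

end

text \<open>An affine profile has no second \<xi>_3-derivative. The antiderivative k comes from
  integrating by parts once and vanishes on the faces because \<eta> does so near them; hence
  subtracting the lift leaves the limit equation unchanged.\<close>

lemma integral_affine_second_derivative:
  assumes \<eta>: "\<eta> \<in> per_test a b"
  shows "(LINT \<xi>|lebesgue_on (Ref_dom a b). K * sin (\<xi>$1) * (1 - \<xi>$3) * pderiv3 3 (pderiv3 3 \<eta>) \<xi>) = 0"
proof -
  define k where "k = (\<lambda>\<xi>. K * sin (\<xi>$1) * (1 - \<xi>$3) * pderiv3 3 \<eta> \<xi> + K * sin (\<xi>$1) * \<eta> \<xi>)"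
  have s: "smooth_on UNIV \<eta>" using \<eta> by (simp add: per_test_def per_smooth_def)
  have sk: "smooth_on UNIV k" unfolding k_def
    by (intro smooth_intros smooth_on_pderiv3 s open_UNIV)
  note d = smooth_on_differentiable[OF _ UNIV_I]
  have "pderiv3 3 k \<xi> = K * sin (\<xi>$1) * (1 - \<xi>$3) * pderiv3 3 (pderiv3 3 \<eta>) \<xi>" for \<xi>
  proof -
    note nth = bounded_linear_imp_has_derivative[OF bounded_linear_vec_nth]
      and f = differentiable_frechet_derivative[OF d[OF s]]
        differentiable_frechet_derivative[OF d[OF smooth_on_pderiv3[OF s]]]
    have "(k has_derivative (\<lambda>w. K * sin (\<xi>$1) * (1 - \<xi>$3) * frechet_derivative (pderiv3 3 \<eta>) (at \<xi>) w
        + (K * (w$1 * cos (\<xi>$1)) * (1 - \<xi>$3) - K * sin (\<xi>$1) * w$3) * pderiv3 3 \<eta> \<xi>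
        + (K * sin (\<xi>$1) * frechet_derivative \<eta> (at \<xi>) w + K * (w$1 * cos (\<xi>$1)) * \<eta> \<xi>))) (at \<xi>)"
      unfolding k_def
      by (rule has_derivative_eq_rhs, (rule derivative_intros nth f)+) (simp add: fun_eq_iff algebra_simps)
    from has_derivative_dir_deriv[OF this, of "axis 3 1"] show ?thesis
      by (simp add: has_derivative_dir_deriv[OF f(1)] has_derivative_dir_deriv[OF f(2)] axis_component algebra_simps)
  qed
  then have "(LINT \<xi>|lebesgue_on (Ref_dom a b). K * sin (\<xi>$1) * (1 - \<xi>$3) * pderiv3 3 (pderiv3 3 \<eta>) \<xi>)
      = (LINT y|lebesgue_on (face3_params a b). k (face3 1 y) - k (face3 0 y))"
    using integral_Ref_dom_pderiv3[OF sk, of a b] by simp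
  moreover have "k (face3 z y) = 0" if "z = 0 \<or> z = 1" for y z
  proof -
    have "face3 z y \<notin> layer a b" using that by (auto simp: layer_def face3_def)
    then have "\<eta> (face3 z y) = 0" "pderiv3 3 \<eta> (face3 z y) = 0"
      using \<eta> per.tests_zero_outside[of _ a b] per.tests_pderiv3[of \<eta> a b] by (auto simp: per_tests_eq)
    then show ?thesis by (simp add: k_def)
  qed
  ultimately show ?thesis by simp
qed

lemma pderiv3_const_mult:
  fixes f :: "real^3 \<Rightarrow> real"
  assumes "f differentiable (at \<xi>)"
  shows "pderiv3 i (\<lambda>\<xi>. k * f \<xi>) \<xi> = k * pderiv3 i f \<xi>"
  using dir_deriv_mult[of "\<lambda>_. k" \<xi> f "axis i 1"] assms by simp

lemma dist_mult_deriv_eq: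
  assumes f: "f \<in> lat.tests a b" and eq: "\<And>\<xi>. w \<xi> * \<psi> \<xi> = k * f \<xi>"
  shows "dist_mult w (dist_deriv i (dist_fun (Ref_dom a b) ps)) \<psi>
    = - k * (LINT \<xi>|lebesgue_on (Ref_dom a b). ps \<xi> * pderiv3 i f \<xi>)"
proof -
  have "(\<lambda>\<xi>. w \<xi> * \<psi> \<xi>) = (\<lambda>\<xi>. k * f \<xi>)" using eq by blast
  then show ?thesis
    using lat.tests_differentiable[OF f]
    by (simp add: dist_mult_def dist_deriv_def dist_fun_def pderiv3_const_mult mult_ac)
qed

text \<open>The pressure has only distributional derivatives, so the first two components are
  compared as distributions, with coefficients acting on the test function. The radial identity
  contains no pressure and can be stated almost everywhere.\<close>

theorem theorem7:
  fixes R \<mu> \<omega> \<phi>0 \<phi>1 h0 h1 C :: real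
    and h :: "real \<times> real \<Rightarrow> real"
    and g0 g1 :: "real \<Rightarrow> real"
    and k0 k1 :: "real \<Rightarrow> real \<times> real \<Rightarrow> real"
    and u :: "real \<Rightarrow> real^3 \<Rightarrow> real^3" and p :: "real \<Rightarrow> real^3 \<Rightarrow> real"
    and \<epsilon> :: "nat \<Rightarrow> real"
    and us :: "real^3 \<Rightarrow> real^3" and ps :: "real^3 \<Rightarrow> real"
  defines "\<Omega> \<equiv> Ref_dom \<phi>0 \<phi>1"
    and "\<Phi> \<equiv> Shell_map R h"
    and "\<D> \<equiv> per_test \<phi>0 \<phi>1"
  assumes "R > 0" "\<mu> > 0" "0 < \<phi>0" "\<phi>0 < \<phi>1" "\<phi>1 < pi"
    and h_smooth: "smooth_up_to ({\<phi>0..\<phi>1} \<times> UNIV) h"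
    and h_periodic: "\<And>s t. s \<in> {\<phi>0..\<phi>1} \<Longrightarrow> h (s, t + 2 * pi) = h (s, t)"
    and h_bounds: "0 < h0" "\<And>s t. s \<in> {\<phi>0..\<phi>1} \<Longrightarrow> h0 \<le> h (s, t) \<and> h (s, t) \<le> h1"
    and g: "smooth_up_to {0..1} g0" "g0 0 = 1" "g0 1 = 0"
           "smooth_up_to {0..1} g1" "g1 0 = 1" "g1 1 = 0"
    and k: "\<And>e. e \<in> {0<..1} \<Longrightarrow> lateral_profile (k0 e) C \<and> lateral_profile (k1 e) C"
    and compatibility: "\<And>e. e \<in> {0<..1} \<Longrightarrow>
          surface_integral face1_params (\<Phi> e \<circ> face1 \<phi>1) (k1 e)
          - surface_integral face1_params (\<Phi> e \<circ> face1 \<phi>0) (k0 e) = 0"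
    and stokes: "\<And>e. e \<in> {0<..1} \<Longrightarrow> stokes_equations \<mu> (Shell_dom R h \<phi>0 \<phi>1 e) (u e) (p e)"
    and boundary: "\<And>e. e \<in> {0<..1} \<Longrightarrow>
          shell_boundary_values R \<omega> \<phi>0 \<phi>1 h g0 g1 (k0 e) (k1 e) e (u e)"
    and eps: "\<And>n. \<epsilon> n \<in> {0<..1}" "\<epsilon> \<longlonglongrightarrow> 0"
    and u_conv: "L2_weak_conv \<Omega> (\<lambda>n. u (\<epsilon> n) \<circ> \<Phi> (\<epsilon> n)) us"
    and u_conv3: "\<exists>d ds. (\<forall>n. weak_deriv \<D> \<Omega> 3 (u (\<epsilon> n) \<circ> \<Phi> (\<epsilon> n)) (d n)) \<and>
          weak_deriv \<D> \<Omega> 3 us ds \<and> L2_weak_conv \<Omega> d ds"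
    and u_conv12: "\<And>i. i \<in> {1, 2} \<Longrightarrow>
          \<exists>d. (\<forall>n. weak_deriv \<D> \<Omega> i (u (\<epsilon> n) \<circ> \<Phi> (\<epsilon> n)) (d n)) \<and>
            L2_weak_conv \<Omega> (\<lambda>n \<xi>. \<epsilon> n *\<^sub>R d n \<xi>) (\<lambda>\<xi>. 0)"
    and us_trace: "has_trace per_smooth \<Omega> {3} (face3_params \<phi>0 \<phi>1) (face3 0) us (bottom_data R \<omega>)"
                  "has_trace per_smooth \<Omega> {3} (face3_params \<phi>0 \<phi>1) (face3 1) us (\<lambda>y. 0)"
    and p_conv: "L2_weak_conv \<Omega> (\<lambda>n \<xi>. (\<epsilon> n)\<^sup>2 * p (\<epsilon> n) (\<Phi> (\<epsilon> n) \<xi>)) ps"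
    and p_conv12: "\<And>i. i \<in> {1, 2} \<Longrightarrow> Hm1_weak_conv \<phi>0 \<phi>1
          (\<lambda>n w. (\<epsilon> n)\<^sup>2 * Hm1_deriv \<phi>0 \<phi>1 i (p (\<epsilon> n) \<circ> \<Phi> (\<epsilon> n)) w) (Hm1_deriv \<phi>0 \<phi>1 i ps)"
    and p_conv3: "Hm1_weak_conv \<phi>0 \<phi>1
          (\<lambda>n w. (\<epsilon> n)\<^sup>2 * Hm1_deriv \<phi>0 \<phi>1 3 (p (\<epsilon> n) \<circ> \<Phi> (\<epsilon> n)) w) (\<lambda>w. 0)"
  shows "(\<forall>\<psi>\<in>\<D>. dist_fun \<Omega> (\<lambda>\<xi>. us \<xi> \<bullet> e_phi \<xi>) \<psi> =
            dist_mult (\<lambda>\<xi>. (h (\<xi>$1, \<xi>$2))\<^sup>2 / (2 * \<mu> * R) * (\<xi>$3 * (\<xi>$3 - 1)))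
              (dist_deriv 1 (dist_fun \<Omega> ps)) \<psi>) \<and>
         (\<forall>\<psi>\<in>\<D>. dist_fun \<Omega> (\<lambda>\<xi>. us \<xi> \<bullet> e_theta \<xi>) \<psi> =
            dist_mult (\<lambda>\<xi>. (h (\<xi>$1, \<xi>$2))\<^sup>2 / (2 * \<mu> * R * sin (\<xi>$1)) * (\<xi>$3 * (\<xi>$3 - 1)))
              (dist_deriv 2 (dist_fun \<Omega> ps)) \<psi>
            + dist_fun \<Omega> (\<lambda>\<xi>. R * \<omega> * sin (\<xi>$1) * (1 - \<xi>$3)) \<psi>) \<and>
         (AE \<xi> in lebesgue_on \<Omega>. us \<xi> \<bullet> e_rho \<xi> = 0)"
proof -
  \<comment> \<open>Smoothness up to the boundary provides an extension that agrees with
    \<open>h\<close> on the closed strip; on the open slab the smoothness transfers to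
    \<open>h\<close> itself.\<close>
  have h_slab: "smooth_on (slab \<phi>0 \<phi>1) (\<lambda>\<xi>. h (\<xi>$1, \<xi>$2))"
  proof -
    obtain V k where V: "open V" "{\<phi>0..\<phi>1} \<times> UNIV \<subseteq> V" "smooth_on V k"
      "\<And>x. x \<in> {\<phi>0..\<phi>1} \<times> UNIV \<Longrightarrow> k x = h x"
      using h_smooth unfolding smooth_up_to_def by blast
    have "smooth_on (slab \<phi>0 \<phi>1) (\<lambda>\<xi>. k (\<xi>$1, \<xi>$2))"
    proof (rule smooth_on_compose[OF open_slab V(1) _ _ V(3)])
      show "smooth_on (slab \<phi>0 \<phi>1) (\<lambda>\<xi>. (\<xi>$1, \<xi>$2))"
        by (intro smooth_on_bounded_linear bounded_linear_Pair bounded_linear_vec_nth open_slab)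
      show "(\<xi>$1, \<xi>$2) \<in> V" if "\<xi> \<in> slab \<phi>0 \<phi>1" for \<xi>
        using V(2) that by (auto simp: slab_def)
    qed
    then show ?thesis
      by (rule smooth_on_cong[OF open_slab, rotated]) (use V(4) in \<open>auto simp: slab_def\<close>)
  qed
  interpret S: shell R \<phi>0 \<phi>1 h
  proof
    show "h (s, t) > 0" if "\<phi>0 < s" "s < \<phi>1" for s t
      using h_bounds(1) h_bounds(2)[of s t] that by auto
  qed (use assms(4-8) h_slab h_periodic in auto)
  have eps0: "\<epsilon> n > 0" for n using eps(1)[of n] by auto
  have st: "stokes_equations \<mu> (Shell_dom R h \<phi>0 \<phi>1 (\<epsilon> n)) (u (\<epsilon> n)) (p (\<epsilon> n))" for n
    by (rule stokes[OF eps(1)])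
  have uc: "L2_weak_conv (Ref_dom \<phi>0 \<phi>1) (\<lambda>n \<xi>. u (\<epsilon> n) (Shell_map R h (\<epsilon> n) \<xi>)) us"
    using u_conv by (simp add: \<Omega>_def \<Phi>_def o_def)
  have pc: "L2_weak_conv (Ref_dom \<phi>0 \<phi>1) (\<lambda>n \<xi>. (\<epsilon> n)\<^sup>2 * p (\<epsilon> n) (Shell_map R h (\<epsilon> n) \<xi>)) ps"
    using p_conv by (simp add: \<Omega>_def \<Phi>_def)
  have psL: "L2 (Ref_dom \<phi>0 \<phi>1) ps" using pc by (simp add: L2_weak_conv_def)
  have p3: "(LINT \<xi>|lebesgue_on (Ref_dom \<phi>0 \<phi>1). ps \<xi> * pderiv3 3 \<eta> \<xi>) = 0" if "\<eta> \<in> per_test \<phi>0 \<phi>1" for \<eta>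
    using pressure_independent_of_3[OF pc _ that] p_conv3 by (simp add: \<Phi>_def o_def)
  note tr = us_trace[unfolded \<Omega>_def]
  have M: "(\<lambda>\<xi>. \<xi>$3 * (\<xi>$3 - 1) / 2 * \<psi> \<xi>) \<in> lat.tests \<phi>0 \<phi>1" if "\<psi> \<in> per_test \<phi>0 \<phi>1" for \<psi> :: "real^3 \<Rightarrow> real"
    using that per_test_subset_lat[of \<phi>0 \<phi>1]
    by (intro lat.tests_per_smooth_mult) (auto simp: per_smooth_def periodic2_def axis_component intro!: smooth_intros)
  have phi: "dist_fun \<Omega> (\<lambda>\<xi>. us \<xi> \<bullet> e_phi \<xi>) \<psi> =
      dist_mult (\<lambda>\<xi>. (h (\<xi>$1, \<xi>$2))\<^sup>2 / (2 * \<mu> * R) * (\<xi>$3 * (\<xi>$3 - 1))) (dist_deriv 1 (dist_fun \<Omega> ps)) \<psi>"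
    if "\<psi> \<in> \<D>" for \<psi>
  proof -
    have \<psi>: "\<psi> \<in> per_test \<phi>0 \<phi>1" "\<psi> \<in> lat.tests \<phi>0 \<phi>1" using that per_test_subset_lat by (auto simp: \<D>_def)
    \<comment> \<open>\<open>e_phi\<close> is orthogonal to the velocity of the lower face, so the
      zero function is a lift.\<close>
    obtain d where d: "L2 (Ref_dom \<phi>0 \<phi>1) d" "L2 (Ref_dom \<phi>0 \<phi>1) (\<lambda>\<xi>. us \<xi> \<bullet> e_phi \<xi> - 0)"
      "\<And>\<eta>. smooth_on UNIV \<eta> \<Longrightarrow> (LINT \<xi>|lebesgue_on (Ref_dom \<phi>0 \<phi>1). (us \<xi> \<bullet> e_phi \<xi> - 0) * pderiv3 3 \<eta> \<xi>)
        = - (LINT \<xi>|lebesgue_on (Ref_dom \<phi>0 \<phi>1). d \<xi> * \<eta> \<xi>)"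
      by (rule traced_component[OF tr smooth_on_frame(1) S.frame_H_shift3(1), of "\<lambda>_. 0"])
        (auto simp: smooth_on_const bottom_data_def frame_orthonormal)
    have "(LINT \<xi>|lebesgue_on (Ref_dom \<phi>0 \<phi>1). (us \<xi> \<bullet> e_phi \<xi>) * \<psi> \<xi>) = - (1 / (\<mu> * R)) *
        (LINT \<xi>|lebesgue_on (Ref_dom \<phi>0 \<phi>1). ps \<xi> * pderiv3 1 (\<lambda>\<xi>. (S.H \<xi>)\<^sup>2 * (\<xi>$3 * (\<xi>$3 - 1) / 2 * \<psi> \<xi>)) \<xi>)"
    proof (rule parabolic_profile[OF _ d(1) psL _ _ p3 S.periodic_coeff_H_combinations(1) _ _ \<psi>(2)])
      fix \<eta> assume \<eta>: "\<eta> \<in> per_test \<phi>0 \<phi>1"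
      show "(LINT \<xi>|lebesgue_on (Ref_dom \<phi>0 \<phi>1). (us \<xi> \<bullet> e_phi \<xi>) * pderiv3 3 (pderiv3 3 \<eta>) \<xi>) = - (1 / (\<mu> * R)) *
          (LINT \<xi>|lebesgue_on (Ref_dom \<phi>0 \<phi>1). ps \<xi> * pderiv3 1 (\<lambda>\<xi>. (S.H \<xi>)\<^sup>2 * \<eta> \<xi>) \<xi>)"
        by (rule S.reynolds_limit[OF \<open>\<mu> > 0\<close> eps0 eps(2) st uc pc p3 frame_per_smooth(1) S.frame_H_shift3(1)
            frame_orthonormal(8) S.periodic_coeff_H_combinations(1,3) S.sum_B_phi[OF _ \<eta>] \<eta>])
    qed (use d in \<open>simp_all add: S.H_shrink3\<close>)
    moreover have "(\<lambda>\<xi>. (S.H \<xi>)\<^sup>2 * (\<xi>$3 * (\<xi>$3 - 1) / 2 * \<psi> \<xi>)) \<in> lat.tests \<phi>0 \<phi>1"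
      by (rule lat.tests_coeff_mult[OF S.periodic_coeff_H_combinations(1) M[OF \<psi>(1)]])
    \<comment> \<open>The minus sign of the distributional derivative matches -1/(\<mu> R), and the
      1/2 of the parabola accounts for the 2 in the coefficient.\<close>
    then have "dist_mult (\<lambda>\<xi>. (h (\<xi>$1, \<xi>$2))\<^sup>2 / (2 * \<mu> * R) * (\<xi>$3 * (\<xi>$3 - 1))) (dist_deriv 1 (dist_fun \<Omega> ps)) \<psi>
      = - (1 / (\<mu> * R)) * (LINT \<xi>|lebesgue_on (Ref_dom \<phi>0 \<phi>1). ps \<xi> * pderiv3 1 (\<lambda>\<xi>. (S.H \<xi>)\<^sup>2 * (\<xi>$3 * (\<xi>$3 - 1) / 2 * \<psi> \<xi>)) \<xi>)"
      unfolding \<Omega>_def by (rule dist_mult_deriv_eq) (simp add: S.H_def)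
    ultimately show ?thesis by (simp add: dist_fun_def \<Omega>_def mult.commute)
  qed
  have theta: "dist_fun \<Omega> (\<lambda>\<xi>. us \<xi> \<bullet> e_theta \<xi>) \<psi> =
      dist_mult (\<lambda>\<xi>. (h (\<xi>$1, \<xi>$2))\<^sup>2 / (2 * \<mu> * R * sin (\<xi>$1)) * (\<xi>$3 * (\<xi>$3 - 1))) (dist_deriv 2 (dist_fun \<Omega> ps)) \<psi>
      + dist_fun \<Omega> (\<lambda>\<xi>. R * \<omega> * sin (\<xi>$1) * (1 - \<xi>$3)) \<psi>"
    if "\<psi> \<in> \<D>" for \<psi>
  proof -
    \<comment> \<open>The Couette profile: it equals the \<theta>-component of the boundary velocity
      at the bottom and 0 at the top, and it is affine in \<xi>_3.\<close>
    let ?g = "\<lambda>\<xi>::real^3. R * \<omega> * sin (\<xi>$1) * (1 - \<xi>$3)"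
    have \<psi>: "\<psi> \<in> per_test \<phi>0 \<phi>1" "\<psi> \<in> lat.tests \<phi>0 \<phi>1" using that per_test_subset_lat by (auto simp: \<D>_def)
    have sg: "smooth_on UNIV ?g" by (intro smooth_intros open_UNIV)
    obtain d where d: "L2 (Ref_dom \<phi>0 \<phi>1) d" "L2 (Ref_dom \<phi>0 \<phi>1) (\<lambda>\<xi>. us \<xi> \<bullet> e_theta \<xi> - ?g \<xi>)"
      "\<And>\<eta>. smooth_on UNIV \<eta> \<Longrightarrow> (LINT \<xi>|lebesgue_on (Ref_dom \<phi>0 \<phi>1). (us \<xi> \<bullet> e_theta \<xi> - ?g \<xi>) * pderiv3 3 \<eta> \<xi>)
        = - (LINT \<xi>|lebesgue_on (Ref_dom \<phi>0 \<phi>1). d \<xi> * \<eta> \<xi>)"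
      by (rule traced_component[OF tr smooth_on_frame(2) S.frame_H_shift3(2) sg])
        (auto simp: bottom_data_def frame_orthonormal face3_def)
    have thL: "L2 (Ref_dom \<phi>0 \<phi>1) (\<lambda>\<xi>. us \<xi> \<bullet> e_theta \<xi>)" "L2 (Ref_dom \<phi>0 \<phi>1) ?g"
    proof -
      show "L2 (Ref_dom \<phi>0 \<phi>1) ?g"
        by (intro L2_continuous bounded_Ref_dom smooth_on_continuous_on sg) simp
      from L2_add[OF d(2) this] show "L2 (Ref_dom \<phi>0 \<phi>1) (\<lambda>\<xi>. us \<xi> \<bullet> e_theta \<xi>)" by simp
    qed
    have int: "integrable (lebesgue_on (Ref_dom \<phi>0 \<phi>1)) (\<lambda>\<xi>. k \<xi> * f \<xi>)"
      if "L2 (Ref_dom \<phi>0 \<phi>1) k" "f \<in> per_test \<phi>0 \<phi>1" for k f :: "real^3 \<Rightarrow> real"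
      using S.per_test_integrable[OF that] by (simp add: mult.commute)
    have "(LINT \<xi>|lebesgue_on (Ref_dom \<phi>0 \<phi>1). (us \<xi> \<bullet> e_theta \<xi> - ?g \<xi>) * \<psi> \<xi>) = - (1 / (\<mu> * R)) *
        (LINT \<xi>|lebesgue_on (Ref_dom \<phi>0 \<phi>1). ps \<xi> * pderiv3 2 (\<lambda>\<xi>. (S.H \<xi>)\<^sup>2 / sin (\<xi>$1) * (\<xi>$3 * (\<xi>$3 - 1) / 2 * \<psi> \<xi>)) \<xi>)"
    proof (rule parabolic_profile[OF d(2,1) psL d(3) _ p3 S.periodic_coeff_H_combinations(2) _ _ \<psi>(2)])
      fix \<eta> assume \<eta>: "\<eta> \<in> per_test \<phi>0 \<phi>1"
      note \<eta>33 = S.per_test_pderiv3[OF S.per_test_pderiv3[OF \<eta>], of 3 3]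
      have "(LINT \<xi>|lebesgue_on (Ref_dom \<phi>0 \<phi>1). (us \<xi> \<bullet> e_theta \<xi> - ?g \<xi>) * pderiv3 3 (pderiv3 3 \<eta>) \<xi>)
          = (LINT \<xi>|lebesgue_on (Ref_dom \<phi>0 \<phi>1). (us \<xi> \<bullet> e_theta \<xi>) * pderiv3 3 (pderiv3 3 \<eta>) \<xi>)"
        using int[OF thL(1) \<eta>33] int[OF thL(2) \<eta>33] integral_affine_second_derivative[OF \<eta>, of "R * \<omega>"]
        by (simp add: left_diff_distrib)
      also have "\<dots> = - (1 / (\<mu> * R)) *
          (LINT \<xi>|lebesgue_on (Ref_dom \<phi>0 \<phi>1). ps \<xi> * pderiv3 2 (\<lambda>\<xi>. (S.H \<xi>)\<^sup>2 / sin (\<xi>$1) * \<eta> \<xi>) \<xi>)"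
        by (rule S.reynolds_limit[OF \<open>\<mu> > 0\<close> eps0 eps(2) st uc pc p3 frame_per_smooth(2) S.frame_H_shift3(2)
            frame_orthonormal(9) S.periodic_coeff_H_combinations(2,4) S.sum_B_theta[OF _ \<eta>] \<eta>])
      finally show "(LINT \<xi>|lebesgue_on (Ref_dom \<phi>0 \<phi>1). (us \<xi> \<bullet> e_theta \<xi> - ?g \<xi>) * pderiv3 3 (pderiv3 3 \<eta>) \<xi>)
          = - (1 / (\<mu> * R)) *
          (LINT \<xi>|lebesgue_on (Ref_dom \<phi>0 \<phi>1). ps \<xi> * pderiv3 2 (\<lambda>\<xi>. (S.H \<xi>)\<^sup>2 / sin (\<xi>$1) * \<eta> \<xi>) \<xi>)" .
    qed (simp_all add: S.H_shrink3 shrink3_nth)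
    moreover have "(LINT \<xi>|lebesgue_on (Ref_dom \<phi>0 \<phi>1). (us \<xi> \<bullet> e_theta \<xi> - ?g \<xi>) * \<psi> \<xi>)
        = (LINT \<xi>|lebesgue_on (Ref_dom \<phi>0 \<phi>1). (us \<xi> \<bullet> e_theta \<xi>) * \<psi> \<xi>) - (LINT \<xi>|lebesgue_on (Ref_dom \<phi>0 \<phi>1). ?g \<xi> * \<psi> \<xi>)"
      using int[OF thL(1) \<psi>(1)] int[OF thL(2) \<psi>(1)] by (simp add: left_diff_distrib)
    moreover have "(\<lambda>\<xi>. (S.H \<xi>)\<^sup>2 / sin (\<xi>$1) * (\<xi>$3 * (\<xi>$3 - 1) / 2 * \<psi> \<xi>)) \<in> lat.tests \<phi>0 \<phi>1"
      by (rule lat.tests_coeff_mult[OF S.periodic_coeff_H_combinations(2) M[OF \<psi>(1)]])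
    then have "dist_mult (\<lambda>\<xi>. (h (\<xi>$1, \<xi>$2))\<^sup>2 / (2 * \<mu> * R * sin (\<xi>$1)) * (\<xi>$3 * (\<xi>$3 - 1))) (dist_deriv 2 (dist_fun \<Omega> ps)) \<psi>
      = - (1 / (\<mu> * R)) * (LINT \<xi>|lebesgue_on (Ref_dom \<phi>0 \<phi>1). ps \<xi> * pderiv3 2 (\<lambda>\<xi>. (S.H \<xi>)\<^sup>2 / sin (\<xi>$1) * (\<xi>$3 * (\<xi>$3 - 1) / 2 * \<psi> \<xi>)) \<xi>)"
      unfolding \<Omega>_def by (rule dist_mult_deriv_eq) (simp add: S.H_def)
    ultimately show ?thesis by (simp add: dist_fun_def \<Omega>_def mult.commute)
  qed
  have rho: "AE \<xi> in lebesgue_on \<Omega>. us \<xi> \<bullet> e_rho \<xi> = 0"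
  proof -
    obtain d where d: "L2 (Ref_dom \<phi>0 \<phi>1) d" "L2 (Ref_dom \<phi>0 \<phi>1) (\<lambda>\<xi>. us \<xi> \<bullet> e_rho \<xi> - 0)"
      "\<And>\<eta>. smooth_on UNIV \<eta> \<Longrightarrow> (LINT \<xi>|lebesgue_on (Ref_dom \<phi>0 \<phi>1). (us \<xi> \<bullet> e_rho \<xi> - 0) * pderiv3 3 \<eta> \<xi>)
        = - (LINT \<xi>|lebesgue_on (Ref_dom \<phi>0 \<phi>1). d \<xi> * \<eta> \<xi>)"
      by (rule traced_component[OF tr smooth_on_frame(3) S.frame_H_shift3(3), of "\<lambda>_. 0"])
        (auto simp: smooth_on_const bottom_data_def frame_orthonormal)
    have "(LINT \<xi>|lebesgue_on (Ref_dom \<phi>0 \<phi>1). (us \<xi> \<bullet> e_rho \<xi>) * \<zeta> \<xi>) = 0" if \<zeta>: "\<zeta> \<in> per_test \<phi>0 \<phi>1" for \<zeta>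
    proof -
      \<comment> \<open>The homogeneous case of \<open>parabolic_profile\<close>, with constant c =
        0.\<close>
      have "(LINT \<xi>|lebesgue_on (Ref_dom \<phi>0 \<phi>1). (us \<xi> \<bullet> e_rho \<xi>) * \<zeta> \<xi>) = 0 *
        (LINT \<xi>|lebesgue_on (Ref_dom \<phi>0 \<phi>1). ps \<xi> * pderiv3 1 (\<lambda>\<xi>. (S.H \<xi>)\<^sup>2 * (\<xi>$3 * (\<xi>$3 - 1) / 2 * \<zeta> \<xi>)) \<xi>)"
      proof (rule parabolic_profile[OF _ d(1) psL _ _ p3 S.periodic_coeff_H_combinations(1)])
        fix \<eta> assume \<eta>: "\<eta> \<in> per_test \<phi>0 \<phi>1"
        \<comment> \<open>The mass balance is of first order in \<xi>_3; testing it with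
          \<partial>_3 \<eta> brings it into the required second order form.\<close>
        show "(LINT \<xi>|lebesgue_on (Ref_dom \<phi>0 \<phi>1). (us \<xi> \<bullet> e_rho \<xi>) * pderiv3 3 (pderiv3 3 \<eta>) \<xi>) = 0 *
          (LINT \<xi>|lebesgue_on (Ref_dom \<phi>0 \<phi>1). ps \<xi> * pderiv3 1 (\<lambda>\<xi>. (S.H \<xi>)\<^sup>2 * \<eta> \<xi>) \<xi>)"
          using S.radial_limit[OF eps0 eps(2) st uc S.per_test_pderiv3[OF \<eta>]] by simp
      qed (use d \<zeta> per_test_subset_lat in \<open>auto simp: S.H_shrink3\<close>)
      then show ?thesis by simp
    qed
    then show ?thesis unfolding \<Omega>_def
      using d(2) by (intro AE_zero_if_orthogonal_to_per_test) simp_all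
  qed
  show ?thesis using phi theta rho by blast
qed

end
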